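(* Consider the variational attitude estimator with biased velocity measurements, given by $$\begin{cases}\dot{\hat R}=\hat R\hat\Omega^\times=\hat R(\Omega^m-\omega-\hat\beta)^\times,\\ m\dot\omega=-m\hat\Omega\times\omega+\Phi'\big(\mathcal U^0(\hat R,U^m)\big)S_L(\hat R)-D\omega,\\ \hat\Omega=\Omega^m-\omega-\hat\beta,\\ \dot{\hat\beta}=\Phi'\big(\mathcal U^0(\hat R,U^m)\big)P^{-1}S_L(\hat R),\end{cases}$$ with $P\in\mathbb R^{3\times3}$ positive definite, and let $Q=R\hat R^T$, $\tilde\beta=\beta-\hat\beta$, where the gyro bias $\beta\in\mathbb R^3$ is constant. In the absence of measurement noise, this estimator converges asymptotically to $(Q,\omega,\tilde\beta)=(I,0,0)\in\mathrm TSO(3)\times\mathbb R^3$. Further, the domain of attraction is a dense open subset of $\mathrm TSO(3)\times\mathbb R^3$.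
   Context: $R(t)\in SO(3)$ is the attitude of a rigid body with $\dot R=R\Omega^\times$; $\hat R,\hat\Omega,\hat\beta$ are the estimates of attitude, angular velocity and gyro bias. $\mathrm TSO(3)$ is identified with $SO(3)\times\mathbb R^3$. $a^\times$ is the skew-symmetric matrix with $a^\times c=a\times c$; $\mathrm{vex}$ is the inverse of $a\mapsto a^\times$; $\langle A_1,A_2\rangle=\mathrm{trace}(A_1^TA_2)$. $E\in\mathbb R^{3\times n}$ is the rank-3 matrix of known inertial vectors; $U^m$ is the matrix of their body-frame measurements; $\Omega^m$ is the measured angular velocity. Absence of measurement noise means $U^m=R^TE$ and $\Omega^m=\Omega+\beta$. The positive definite weight matrix is $W=V_EW_0V_E^T$, where $E=U_E\Sigma_EV_E^T$ is a singular value decomposition with singular values $\sigma_1,\sigma_2,\sigma_3$ and $W_0$ is diagonal with positive diagonal entries, the first three being $d_i/\sigma_i^2$ with $d_1,d_2,d_3>0$ distinct (so $K=EWE^T$ has distinct eigenvalues $d_i$). $L=EW(U^m)^T$, $S_L(\hat R)=\mathrm{vex}(L^T\hat R-\hat R^TL)$, $\mathcal U^0(\hat R,U^m)=\frac12\langle E-\hat RU^m,(E-\hat RU^m)W\rangle$. $m>0$ is a scalar, $D\in\mathbb R^{3\times3}$ is positive definite. $\Phi:[0,\infty)\to[0,\infty)$ is a $C^2$ function with $\Phi(0)=0$ and $\Phi'(x)>0$ for all $x\in[0,\infty)$; furthermore $\Phi'(\cdot)\le\alpha(\cdot)$ where $\alpha(\cdot)$ is a Class-$\mathcal K$ function.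
   Formalization: The true angular velocity Ω is assumed continuous and bounded (for fast-growing Ω the bias error need not converge); since Φ'(0)>0 contradicts Φ'≤α with α Class-K, either Φ'>0 on [0,∞), or Φ'>0 on (0,∞) with Φ'≤α, is assumed. *)

theory Defs
  imports "HOL-Analysis.Analysis"
begin

definition skew :: "real^3 \<Rightarrow> real^3^3" where
  "skew a = matrix (cross3 a)"

text \<open>Only meaningful on skew-symmetric matrices, which form the range of \<^const>\<open>skew\<close>.\<close>
definition vex :: "real^3^3 \<Rightarrow> real^3" where
  "vex = inv skew"

definition trace_inner :: "real^'n^'m \<Rightarrow> real^'n^'m \<Rightarrow> real" where
  "trace_inner A B = trace (transpose A ** B)"

definition posdef :: "real^'n^'n \<Rightarrow> bool" where
  "posdef A \<longleftrightarrow> transpose A = A \<and> (\<forall>x. x \<noteq> 0 \<longrightarrow> x \<bullet> (A *v x) > 0)"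

text \<open>
  Singular value decomposition of a 3-row matrix whose columns are indexed by an arbitrary
  finite type. The injection \<open>\<iota>\<close> selects the three columns of \<open>SE\<close> that carry the singular
  values, i.e. it says which column indices count as the first three.
\<close>
definition is_svd ::
  "real^'n^3 \<Rightarrow> real^3^3 \<Rightarrow> real^'n^3 \<Rightarrow> real^'n^'n \<Rightarrow> (3 \<Rightarrow> 'n) \<Rightarrow> (3 \<Rightarrow> real) \<Rightarrow> bool" where
  "is_svd E UE SE VE \<iota> \<sigma> \<longleftrightarrow>
     orthogonal_matrix UE \<and> orthogonal_matrix VE \<and> E = UE ** SE ** transpose VE \<and>
     inj \<iota> \<and> (\<forall>i. \<sigma> i \<ge> 0) \<and> (\<forall>i j. SE $ i $ j = (if j = \<iota> i then \<sigma> i else 0))"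

definition class_K :: "(real \<Rightarrow> real) \<Rightarrow> bool" where
  "class_K \<alpha> \<longleftrightarrow> continuous_on {0..} \<alpha> \<and> strict_mono_on {0..} \<alpha> \<and> \<alpha> 0 = 0"

definition L_matrix :: "real^'n^3 \<Rightarrow> real^'n^'n \<Rightarrow> real^'n^3 \<Rightarrow> real^3^3" where
  "L_matrix E W Um = E ** W ** transpose Um"

definition S_vec :: "real^3^3 \<Rightarrow> real^3^3 \<Rightarrow> real^3" where
  "S_vec L Rh = vex (transpose L ** Rh - transpose Rh ** L)"

definition U0 :: "real^'n^3 \<Rightarrow> real^'n^'n \<Rightarrow> real^3^3 \<Rightarrow> real^'n^3 \<Rightarrow> real" where
  "U0 E W Rh Um = 1/2 * trace_inner (E - Rh ** Um) ((E - Rh ** Um) ** W)"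

text \<open>
  Forward-complete solutions of the estimator equations, driven by the measurement signals
  \<open>Um\<close> and \<open>Om\<close>. The argument \<open>dPhi\<close> is the derivative of the weighting function \<open>\<Phi>\<close>.
\<close>
definition estimator_solution ::
  "real^'n^3 \<Rightarrow> real^'n^'n \<Rightarrow> (real \<Rightarrow> real) \<Rightarrow> real \<Rightarrow> real^3^3 \<Rightarrow> real^3^3 \<Rightarrow>
   (real \<Rightarrow> real^'n^3) \<Rightarrow> (real \<Rightarrow> real^3) \<Rightarrow>
   (real \<Rightarrow> real^3^3) \<Rightarrow> (real \<Rightarrow> real^3) \<Rightarrow> (real \<Rightarrow> real^3) \<Rightarrow> bool" where
  "estimator_solution E W dPhi m D P Um Om Rh \<omega> bh \<longleftrightarrow>
     (\<forall>t\<ge>0.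
        let Oh = Om t - \<omega> t - bh t;
            S = S_vec (L_matrix E W (Um t)) (Rh t);
            c = dPhi (U0 E W (Rh t) (Um t))
        in rotation_matrix (Rh t) \<and>
           (Rh has_vector_derivative Rh t ** skew Oh) (at t within {0..}) \<and>
           (\<exists>\<omega>'. (\<omega> has_vector_derivative \<omega>') (at t within {0..}) \<and>
                 m *\<^sub>R \<omega>' = - (m *\<^sub>R cross3 Oh (\<omega> t)) + c *\<^sub>R S - D *v \<omega> t) \<and>
           (bh has_vector_derivative c *\<^sub>R (matrix_inv P *v S)) (at t within {0..}))"

text \<open>\<open>TSO(3) \<times> R\<^sup>3\<close>, with \<open>TSO(3)\<close> trivialised as \<open>SO(3) \<times> R\<^sup>3\<close>.\<close>
definition TSO3_R3 :: "((real^3^3) \<times> (real^3) \<times> (real^3)) set" where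
  "TSO3_R3 = {Q. rotation_matrix Q} \<times> UNIV \<times> UNIV"

text \<open>
  The trajectories \<open>(Q, \<omega>, \<beta> - bh)\<close>, \<open>Q = R Rh\<^sup>T\<close>, produced by the estimator along one true attitude
  motion \<open>R\<close>. They need not solve an autonomous equation, so they are treated as a set of curves.
\<close>
definition error_trajectories ::
  "real^'n^3 \<Rightarrow> real^'n^'n \<Rightarrow> (real \<Rightarrow> real) \<Rightarrow> real \<Rightarrow> real^3^3 \<Rightarrow> real^3^3 \<Rightarrow>
   (real \<Rightarrow> real^'n^3) \<Rightarrow> (real \<Rightarrow> real^3) \<Rightarrow> (real \<Rightarrow> real^3^3) \<Rightarrow> real^3 \<Rightarrow>
   (real \<Rightarrow> (real^3^3) \<times> (real^3) \<times> (real^3)) set" where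
  "error_trajectories E W dPhi m D P Um Om R \<beta> =
     {(\<lambda>t. (R t ** transpose (Rh t), \<omega> t, \<beta> - bh t)) | Rh \<omega> bh.
        estimator_solution E W dPhi m D P Um Om Rh \<omega> bh}"

text \<open>Initial points in \<open>X\<close> (at time 0) from which a trajectory exists and all of them tend to \<open>e\<close>.\<close>
definition domain_of_attraction ::
  "'s::metric_space set \<Rightarrow> (real \<Rightarrow> 's) set \<Rightarrow> 's \<Rightarrow> 's set" where
  "domain_of_attraction X T e =
     {x \<in> X. (\<exists>z\<in>T. z 0 = x) \<and> (\<forall>z\<in>T. z 0 = x \<longrightarrow> (z \<longlongrightarrow> e) at_top)}"

definition asymptotically_stable ::
  "'s::metric_space set \<Rightarrow> (real \<Rightarrow> 's) set \<Rightarrow> 's \<Rightarrow> bool" where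
  "asymptotically_stable X T e \<longleftrightarrow>
     (\<forall>\<epsilon>>0. \<exists>\<delta>>0. \<forall>z\<in>T. dist (z 0) e < \<delta> \<longrightarrow> (\<forall>t\<ge>0. dist (z t) e < \<epsilon>)) \<and>
     (\<exists>\<delta>>0. \<forall>x\<in>X. dist x e < \<delta> \<longrightarrow> x \<in> domain_of_attraction X T e)"

lemma skew_mult [simp]: "skew a *v c = cross3 a c"
proof -
  have "linear (cross3 a)" by (rule linearI) (simp_all add: cross3_simps)
  then show ?thesis unfolding skew_def by (simp add: matrix_vector_mul(1)[symmetric] matrix_works scalar_mult_eq_scaleR linear_matrix_vector_mul_eq)
qed

lemma vex_skew [simp]: "vex (skew a) = a"
proof -
  have "inj skew"
  proof (rule injI)
    fix a b :: "real^3" assume "skew a = skew b"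
    then have eq: "cross3 a c = cross3 b c" for c by (metis skew_mult)
    show "a = b"
      using eq[of "axis 1 1"] eq[of "axis 2 1"]
      by (simp add: cross3_def vec_eq_iff forall_3 axis_def)
  qed
  then show ?thesis by (simp add: vex_def)
qed

end

theory Submission
  imports Defs
begin

text \<open>
  In the variables \<open>Q = R Rh\<^sup>T\<close>, \<open>\<omega>\<close>, \<open>b = \<beta> - bh\<close> the error dynamics depends on time only through the bounded
  signals \<open>R\<close> and \<open>\<Omega>\<close>, and \<open>V = \<Phi>(U(Q)) + m/2 |\<omega>|\<^sup>2 + 1/2 b \<bullet> P b\<close> with \<open>U(Q) = tr(K (I - Q))\<close> satisfies
  \<open>V' = - \<omega> \<bullet> D \<omega>\<close>. This gives global existence and stability of \<open>(I, 0, 0)\<close>. Applying Barbalat's lemma in turn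
  to \<open>V\<close>, to \<open>\<omega>\<close> and to the gradient \<open>s(Q)\<close> of \<open>U\<close> shows that every trajectory tends to \<open>(Q\<^sub>c, 0, 0)\<close> for one
  of the finitely many critical points \<open>Q\<^sub>c\<close> of \<open>U\<close>, so the basin is open by continuous dependence.

  For density, let \<open>Q\<^sub>c\<close> be a critical point other than \<open>I\<close>; there the Hessian of \<open>U\<close> is invertible with a
  negative direction. The quadratic part of \<open>V\<close>, corrected by small cross terms and evaluated on the difference
  of two trajectories that stay near \<open>(Q\<^sub>c, 0, 0)\<close>, obeys \<open>F' \<le> \<lambda> F\<close>. A negative value would drive the
  bounded function \<open>F\<close> to minus infinity. Hence the states whose trajectory stays near \<open>(Q\<^sub>c, 0, 0)\<close> after time
  \<open>n\<close> form a closed set without interior: turning \<open>Q(n)\<close> slightly about the negative direction makes \<open>F\<close>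
  negative. The complement of the basin is a countable union of such sets, and Baire's theorem applies.
\<close>

subsection \<open>Ordinary differential equations\<close>

text \<open>The signals \<open>R\<close> and \<open>\<Omega>\<close> are arbitrary functions of
  time, so neither LaSalle's principle nor a stable manifold theorem for a fixed vector field is at
  hand: saddles are treated by comparing trajectories with each other. \<open>\<Omega>\<close> is
  only continuous and bounded, so it may enter Barbalat's lemma only through a remainder that tends
  to 0. The derivative of \<open>\<Phi>\<close> may vanish at 0, hence the linearisation at the
  identity can be degenerate, and near the identity only \<open>V\<close> is used; at the other
  critical points \<open>U\<close>, and with it the weight \<open>c0\<close>, is positive. Attitudes
  are compared by \<open>y = s (Q1 - Q2)\<close>: as \<open>s\<close> is linear, the derivative of
  \<open>y\<close> is again a value of \<open>s\<close>, and no chart of the rotation group is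
  needed. With \<open>G\<close> the inverse Hessian, \<open>c0 / 2 * (y \<bullet> (G *v y))\<close>
  is the second-order part of \<open>\<Phi>\<close> composed with \<open>U\<close>. The cross term
  of \<open>R w\<close> with \<open>y\<close> produces decay in \<open>y\<close>, because
  \<open>y\<close> forces \<open>w\<close>; the cross term of \<open>G y\<close> with
  \<open>R b\<close> produces decay in \<open>b\<close>, because \<open>b\<close> drives
  \<open>y\<close>.\<close>

lemma mono_of_deriv_nonneg:
  fixes g :: "real \<Rightarrow> real"
  assumes "a \<le> b"
    and "\<And>t. t \<in> {a..b} \<Longrightarrow> (g has_real_derivative g' t) (at t within {a..b})"
    and "\<And>t. t \<in> {a..b} \<Longrightarrow> 0 \<le> g' t"
  shows "g a \<le> g b"
proof -
  have "\<exists>x\<in>{a..b}. g b - g a = (\<lambda>h. g' x * h) (b - a)"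
    by (rule mvt_very_simple) (use assms in \<open>auto simp: has_field_derivative_def\<close>)
  then obtain x where "x \<in> {a..b}" "g b - g a = g' x * (b - a)" by auto
  moreover have "0 \<le> g' x * (b - a)" using assms(1,3) \<open>x \<in> {a..b}\<close> by simp
  ultimately show ?thesis by linarith
qed

text \<open>Differential Gronwall inequality: \<open>exp (- k * t) * g t\<close> does not increase.
  No sign of \<open>g\<close> is assumed, as the saddle argument requires: there \<open>g\<close>
  takes a negative value, which the bound magnifies.\<close>

lemma exp_upper_bound:
  fixes g :: "real \<Rightarrow> real"
  assumes "a \<le> b"
    and g': "\<And>t. t \<in> {a..b} \<Longrightarrow> (g has_real_derivative g' t) (at t within {a..b})"
    and le: "\<And>t. t \<in> {a..b} \<Longrightarrow> g' t \<le> k * g t"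
  shows "g b \<le> exp (k * (b - a)) * g a"
proof -
  have "- (g a * exp (- k * a)) \<le> - (g b * exp (- k * b))"
  proof (rule mono_of_deriv_nonneg[where g = "\<lambda>t. - (g t * exp (- k * t))" and g' = "\<lambda>t. - (g' t * exp (- k * t) + exp (- k * t) * (- k) * g t)"])
    fix t assume t: "t \<in> {a..b}"
    show "((\<lambda>t. - (g t * exp (- k * t))) has_real_derivative - (g' t * exp (- k * t) + exp (- k * t) * (- k) * g t)) (at t within {a..b})"
      using g'[OF t] by (auto intro!: derivative_eq_intros)
    have "- (g' t * exp (- k * t) + exp (- k * t) * (- k) * g t) = exp (- k * t) * (k * g t - g' t)"
      by (simp add: algebra_simps)
    then show "0 \<le> - (g' t * exp (- k * t) + exp (- k * t) * (- k) * g t)"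
      using le[OF t] by simp
  qed (use assms in auto)
  then have "g b * exp (- k * b) * exp (k * b) \<le> g a * exp (- k * a) * exp (k * b)" by simp
  then show ?thesis by (simp add: mult.assoc algebra_simps flip: exp_add)
qed

lemma norm_has_real_derivative_power2:
  fixes y :: "real \<Rightarrow> 'a::real_inner"
  assumes "(y has_vector_derivative y') (at t within S)"
  shows "((\<lambda>t. (norm (y t))\<^sup>2) has_real_derivative 2 * (y t \<bullet> y')) (at t within S)"
proof -
  have "((\<lambda>t. y t \<bullet> y t) has_derivative (\<lambda>h. y t \<bullet> (h *\<^sub>R y') + (h *\<^sub>R y') \<bullet> y t)) (at t within S)"
    using assms unfolding has_vector_derivative_def by (intro has_derivative_inner)
  moreover have "(\<lambda>h. y t \<bullet> (h *\<^sub>R y') + (h *\<^sub>R y') \<bullet> y t) = (\<lambda>h. 2 * (y t \<bullet> y') * h)"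
    by (auto simp: inner_commute)
  ultimately show ?thesis
    unfolding has_field_derivative_def power2_norm_eq_inner by simp
qed

text \<open>Gronwall for the squared distance, which is differentiable where the distance need not
  be. The Lipschitz bound is asked only along the two curves, so a local constant serves once both
  stay in a bounded set.\<close>

lemma ode_dependence:
  fixes y1 y2 :: "real \<Rightarrow> 'a::real_inner"
  assumes "0 \<le> T"
    and y1: "\<And>t. t \<in> {0..T} \<Longrightarrow> (y1 has_vector_derivative f t (y1 t)) (at t within {0..T})"
    and y2: "\<And>t. t \<in> {0..T} \<Longrightarrow> (y2 has_vector_derivative f t (y2 t)) (at t within {0..T})"
    and lip: "\<And>t. t \<in> {0..T} \<Longrightarrow> norm (f t (y1 t) - f t (y2 t)) \<le> L * norm (y1 t - y2 t)"
  shows "norm (y1 T - y2 T) \<le> exp (L * T) * norm (y1 0 - y2 0)"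
proof -
  let ?d = "\<lambda>t. y1 t - y2 t"
  have "(norm (?d T))\<^sup>2 \<le> exp (2 * L * (T - 0)) * (norm (?d 0))\<^sup>2"
  proof (rule exp_upper_bound[where g' = "\<lambda>t. 2 * (?d t \<bullet> (f t (y1 t) - f t (y2 t)))"])
    fix t assume t: "t \<in> {0..T}"
    show "((\<lambda>t. (norm (?d t))\<^sup>2) has_real_derivative 2 * (?d t \<bullet> (f t (y1 t) - f t (y2 t)))) (at t within {0..T})"
      by (intro norm_has_real_derivative_power2 has_vector_derivative_diff y1 y2 t)
    have "?d t \<bullet> (f t (y1 t) - f t (y2 t)) \<le> norm (?d t) * norm (f t (y1 t) - f t (y2 t))"
      by (rule norm_cauchy_schwarz)
    also have "\<dots> \<le> norm (?d t) * (L * norm (?d t))"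
      by (intro mult_left_mono lip t) simp
    finally show "2 * (?d t \<bullet> (f t (y1 t) - f t (y2 t))) \<le> 2 * L * (norm (?d t))\<^sup>2"
      by (simp add: power2_eq_square mult_ac)
  qed fact
  also have "\<dots> = (exp (L * T) * norm (?d 0))\<^sup>2"
    by (simp add: power_mult_distrib exp_of_nat_mult[symmetric] mult_ac)
  finally show ?thesis
    by (rule power2_le_imp_le) simp
qed

text \<open>Picard iteration on the whole interval at once. Continuity is assumed along continuous
  curves, the form in which it is used under the integral.\<close>

lemma picard_lindelof:
  fixes f :: "real \<Rightarrow> 'a::euclidean_space \<Rightarrow> 'a"
  assumes "0 \<le> T" "0 < L"
    and lip: "\<And>t x y. t \<in> {0..T} \<Longrightarrow> norm (f t x - f t y) \<le> L * norm (x - y)"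
    and cont: "\<And>x. continuous_on {0..T} x \<Longrightarrow> continuous_on {0..T} (\<lambda>t. f t (x t))"
  obtains y where "y 0 = x0"
    "\<And>t. t \<in> {0..T} \<Longrightarrow> (y has_vector_derivative f t (y t)) (at t within {0..T})"
proof -
  define X where "X = rec_nat (\<lambda>t. x0) (\<lambda>_ x t. x0 + integral {0..t} (\<lambda>s. f s (x s)))"
  have X0: "X 0 = (\<lambda>t. x0)" and XS: "X (Suc n) = (\<lambda>t. x0 + integral {0..t} (\<lambda>s. f s (X n s)))" for n
    by (simp_all add: X_def)
  have Xc: "continuous_on {0..T} (X n)" for n
  proof (induction n)
    case (Suc n)
    have "continuous_on {0..T} (\<lambda>t. integral {0..t} (\<lambda>s. f s (X n s)))"
      by (intro indefinite_integral_continuous_1 integrable_continuous_real cont Suc)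
    then show ?case unfolding XS by (intro continuous_intros)
  qed (simp add: X0)
  have fXc: "continuous_on {0..T} (\<lambda>s. f s (X n s))" for n by (intro cont Xc)
  have sub: "continuous_on {0..t} g" if "continuous_on {0..T} g" "t \<in> {0..T}" for t and g :: "real \<Rightarrow> 'a"
    using that by (auto intro: continuous_on_subset)
  obtain B where B: "\<And>t. t \<in> {0..T} \<Longrightarrow> norm (X 1 t - X 0 t) \<le> B" "0 \<le> B"
  proof -
    have "bounded ((\<lambda>t. X 1 t - X 0 t) ` {0..T})"
      by (intro compact_imp_bounded compact_continuous_image continuous_intros Xc) simp
    then obtain B where "B > 0" "\<forall>x \<in> (\<lambda>t. X 1 t - X 0 t) ` {0..T}. norm x \<le> B"
      unfolding bounded_pos by auto
    then show ?thesis by (intro that[of B]) auto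
  qed
  \<comment> \<open>The Bielecki weight \<open>exp (2 * L * t)\<close> makes the integral operator
    contract by one half on an interval of any length: integrating \<open>L\<close> times the weight
    returns at most half of it.\<close>
  have step: "norm (X (Suc n) t - X n t) \<le> B * exp (2 * L * t) / 2 ^ n" if "t \<in> {0..T}" for n t
    using that
  proof (induction n arbitrary: t)
    case 0
    have "norm (X 1 t - X 0 t) \<le> B * 1" using B(1)[OF 0] by simp
    also have "\<dots> \<le> B * exp (2 * L * t)"
      using 0 assms(2) B(2) by (intro mult_left_mono) auto
    finally show ?case by simp
  next
    case (Suc n)
    let ?G = "\<lambda>s. B * exp (2 * L * s) / 2 ^ Suc n"
    have hi: "((\<lambda>s. L * (B * exp (2 * L * s) / 2 ^ n)) has_integral (?G t - ?G 0)) {0..t}"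
      using Suc.prems assms(2)
      by (intro fundamental_theorem_of_calculus)
        (auto intro!: derivative_eq_intros simp: has_real_derivative_iff_has_vector_derivative[symmetric] field_simps)
    have "X (Suc (Suc n)) t - X (Suc n) t
        = integral {0..t} (\<lambda>s. f s (X (Suc n) s)) - integral {0..t} (\<lambda>s. f s (X n s))"
      using fun_cong[OF XS[of "Suc n"], of t] fun_cong[OF XS[of n], of t] by simp
    also have "\<dots> = integral {0..t} (\<lambda>s. f s (X (Suc n) s) - f s (X n s))"
      by (intro Henstock_Kurzweil_Integration.integral_diff[symmetric] integrable_continuous_real
          sub[OF fXc Suc.prems])
    also have "norm \<dots> \<le> integral {0..t} (\<lambda>s. L * (B * exp (2 * L * s) / 2 ^ n))"
    proof (rule integral_norm_bound_integral)
      show "(\<lambda>s. f s (X (Suc n) s) - f s (X n s)) integrable_on {0..t}"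
        by (intro integrable_continuous_real continuous_intros sub[OF fXc Suc.prems])
      show "(\<lambda>s. L * (B * exp (2 * L * s) / 2 ^ n)) integrable_on {0..t}"
        using hi by blast
      fix s assume "s \<in> {0..t}"
      then have s: "s \<in> {0..T}" using Suc.prems by auto
      have "norm (f s (X (Suc n) s) - f s (X n s)) \<le> L * norm (X (Suc n) s - X n s)" by (rule lip[OF s])
      also have "\<dots> \<le> L * (B * exp (2 * L * s) / 2 ^ n)"
        by (intro mult_left_mono Suc.IH s) (use assms in auto)
      finally show "norm (f s (X (Suc n) s) - f s (X n s)) \<le> L * (B * exp (2 * L * s) / 2 ^ n)" .
    qed
    also have "\<dots> = ?G t - ?G 0" using hi by (rule integral_unique)
    also have "\<dots> \<le> ?G t" using B(2) by simp
    finally show ?case .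
  qed
  have step': "norm (X (Suc n) t - X n t) \<le> B * exp (2 * L * T) * (1/2) ^ n" if "t \<in> {0..T}" for n t
  proof -
    have "norm (X (Suc n) t - X n t) \<le> B * exp (2 * L * t) / 2 ^ n" by (rule step[OF that])
    also have "\<dots> \<le> B * exp (2 * L * T) / 2 ^ n"
      using that assms B(2) by (intro divide_right_mono mult_left_mono) auto
    finally show ?thesis by (simp add: power_divide)
  qed
  define y where "y = (\<lambda>t. x0 + (\<Sum>n. X (Suc n) t - X n t))"
  have "uniform_limit {0..T} (\<lambda>n t. \<Sum>i<n. X (Suc i) t - X i t) (\<lambda>t. \<Sum>n. X (Suc n) t - X n t) sequentially"
    by (rule Weierstrass_m_test[OF step']) (auto intro!: summable_mult summable_geometric)
  then have "uniform_limit {0..T} (\<lambda>n t. X n t - x0) (\<lambda>t. y t - x0) sequentially"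
    using sum_lessThan_telescope[of "\<lambda>n. X n t" for t] by (simp add: X0 y_def)
  then have lim: "uniform_limit {0..T} X y sequentially"
    by (simp add: uniform_limit_iff dist_norm)
  have yc: "continuous_on {0..T} y"
    by (rule uniform_limit_theorem[OF _ lim]) (auto simp: Xc)
  have fyc: "continuous_on {0..T} (\<lambda>s. f s (y s))" by (rule cont[OF yc])
  have yi: "y t = x0 + integral {0..t} (\<lambda>s. f s (y s))" if t: "t \<in> {0..T}" for t
  proof (rule LIMSEQ_unique)
    show "(\<lambda>n. X (Suc n) t) \<longlonglongrightarrow> y t"
      using tendsto_uniform_limitI[OF lim t] by (rule LIMSEQ_Suc)
    have ul: "uniform_limit {0..t} (\<lambda>n s. f s (X n s)) (\<lambda>s. f s (y s)) sequentially"
    proof (rule uniform_limitI)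
      fix e :: real assume e: "e > 0"
      have "\<forall>\<^sub>F n in sequentially. \<forall>s\<in>{0..T}. dist (X n s) (y s) < e / L"
        by (rule uniform_limitD[OF lim]) (use e assms in simp)
      then show "\<forall>\<^sub>F n in sequentially. \<forall>s\<in>{0..t}. dist (f s (X n s)) (f s (y s)) < e"
      proof eventually_elim
        case (elim n)
        show ?case
        proof
          fix s assume "s \<in> {0..t}"
          then have s: "s \<in> {0..T}" using t by auto
          have "dist (f s (X n s)) (f s (y s)) \<le> L * dist (X n s) (y s)"
            using lip[OF s] by (simp add: dist_norm)
          also have "\<dots> < L * (e / L)"
            using elim s assms by (intro mult_strict_left_mono) auto
          finally show "dist (f s (X n s)) (f s (y s)) < e" using assms by simp
        qed
      qed
    qed
    obtain I J where IJ: "\<And>n. ((\<lambda>s. f s (X n s)) has_integral I n) {0..t}"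
        "((\<lambda>s. f s (y s)) has_integral J) {0..t}" "(I \<longlongrightarrow> J) sequentially"
      using uniform_limit_integral[OF ul sub[OF fXc t]] by auto
    have "(\<lambda>n. integral {0..t} (\<lambda>s. f s (X n s))) \<longlonglongrightarrow> integral {0..t} (\<lambda>s. f s (y s))"
      using IJ(3) unfolding integral_unique[OF IJ(1)] integral_unique[OF IJ(2)] .
    then have "(\<lambda>n. x0 + integral {0..t} (\<lambda>s. f s (X n s))) \<longlonglongrightarrow> x0 + integral {0..t} (\<lambda>s. f s (y s))"
      by (intro tendsto_intros)
    then show "(\<lambda>n. X (Suc n) t) \<longlonglongrightarrow> x0 + integral {0..t} (\<lambda>s. f s (y s))"
      by (simp add: XS)
  qed
  show ?thesis
  proof (rule that[of y])
    show "y 0 = x0" using yi[of 0] assms by simp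
    fix t assume t: "t \<in> {0..T}"
    have "((\<lambda>t. x0 + integral {0..t} (\<lambda>s. f s (y s))) has_vector_derivative 0 + f t (y t)) (at t within {0..T})"
      by (intro has_vector_derivative_add has_vector_derivative_const integral_has_vector_derivative fyc t)
    then show "(y has_vector_derivative f t (y t)) (at t within {0..T})"
      using has_vector_derivative_transform[OF t yi] by simp
  qed
qed

text \<open>Composing the field with the nearest-point projection onto the ball makes it globally
  Lipschitz. Up to the first time of norm \<open>r\<close> the truncated solution solves the
  original equation, so \<open>apriori\<close> excludes such a time.\<close>

lemma ode_exists_bounded:
  fixes f :: "real \<Rightarrow> 'a::euclidean_space \<Rightarrow> 'a"
  assumes T: "0 \<le> T" and x0: "norm x0 < r" and L: "0 < L"
    and lip: "\<And>t x y. t \<in> {0..T} \<Longrightarrow> x \<in> cball 0 r \<Longrightarrow> y \<in> cball 0 r \<Longrightarrow> norm (f t x - f t y) \<le> L * norm (x - y)"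
    and cont: "\<And>x. continuous_on {0..T} x \<Longrightarrow> continuous_on {0..T} (\<lambda>t. f t (x t))"
    and apriori: "\<And>\<tau> y. \<lbrakk>\<tau> \<in> {0..T}; y 0 = x0;
        \<And>t. t \<in> {0..\<tau>} \<Longrightarrow> (y has_vector_derivative f t (y t)) (at t within {0..\<tau>})\<rbrakk> \<Longrightarrow> norm (y \<tau>) < r"
  obtains y where "y 0 = x0"
    "\<And>t. t \<in> {0..T} \<Longrightarrow> (y has_vector_derivative f t (y t)) (at t within {0..T})"
proof -
  let ?B = "cball (0::'a) r"
  let ?p = "closest_point ?B"
  have r: "0 < r" using x0 norm_ge_zero[of x0] by linarith
  then have B: "convex ?B" "closed ?B" "?B \<noteq> {}" by auto
  have pB: "?p x \<in> ?B" for x using B closest_point_in_set by blast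
  obtain y where y0: "y 0 = x0"
    and y: "\<And>t. t \<in> {0..T} \<Longrightarrow> (y has_vector_derivative f t (?p (y t))) (at t within {0..T})"
  proof (rule picard_lindelof[of T L "\<lambda>t x. f t (?p x)" x0])
    fix t x y assume "t \<in> {0..T}"
    then have "norm (f t (?p x) - f t (?p y)) \<le> L * norm (?p x - ?p y)"
      by (intro lip pB)
    also have "\<dots> \<le> L * norm (x - y)"
      using closest_point_lipschitz[OF B, of x y] L by (simp add: dist_norm)
    finally show "norm (f t (?p x) - f t (?p y)) \<le> L * norm (x - y)" .
  next
    fix x :: "real \<Rightarrow> 'a" assume "continuous_on {0..T} x"
    then show "continuous_on {0..T} (\<lambda>t. f t (?p (x t)))"
      by (intro cont continuous_on_compose2[OF continuous_on_closest_point[OF B, of UNIV]]) auto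
  qed (use T L in auto)
  have yc: "continuous_on {0..T} (\<lambda>t. norm (y t))"
    using y by (intro continuous_on_norm continuous_on_vector_derivative) auto
  have pid: "?p (y t) = y t" if "norm (y t) \<le> r" for t
    using that by (intro closest_point_self) simp
  have lt: "norm (y t) < r" if t: "t \<in> {0..T}" for t
  proof (rule ccontr)
    assume nt: "\<not> norm (y t) < r"
    \<comment> \<open>The times of norm \<open>r\<close> form a compact set. Its least element is
      the first exit time, up to which the projection acts as the identity.\<close>
    define Z where "Z = {s \<in> {0..T}. norm (y s) = r}"
    have "\<exists>s\<ge>0. s \<le> t \<and> norm (y s) = r"
      by (rule IVT') (use nt t x0 y0 continuous_on_subset[OF yc] in auto)
    then have Z: "Z \<noteq> {}" using t unfolding Z_def by fastforce
    have "closed Z"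
      unfolding Z_def by (intro continuous_closed_preimage_constant yc closed_atLeastAtMost)
    then have "compact Z"
      by (rule compact_Int_closed[OF compact_Icc[of 0 T], THEN back_subst[of compact]]) (auto simp: Z_def)
    then obtain \<tau> where \<tau>: "\<tau> \<in> Z" "\<And>s. s \<in> Z \<Longrightarrow> \<tau> \<le> s"
      using compact_attains_inf[OF _ Z] by blast
    then have \<tau>T: "\<tau> \<in> {0..T}" and \<tau>r: "norm (y \<tau>) = r" by (auto simp: Z_def)
    have le: "norm (y s) \<le> r" if s: "s \<in> {0..\<tau>}" for s
    proof (rule ccontr)
      assume ns: "\<not> norm (y s) \<le> r"
      have "\<exists>u\<ge>0. u \<le> s \<and> norm (y u) = r"
        by (rule IVT') (use ns s \<tau>T x0 y0 continuous_on_subset[OF yc] in auto)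
      then obtain u where u: "0 \<le> u" "u \<le> s" "norm (y u) = r" by blast
      then have "u \<in> Z" using s \<tau>T by (auto simp: Z_def)
      then have "\<tau> \<le> u" by (rule \<tau>(2))
      then have "s = u" using u s by auto
      then show False using u ns by simp
    qed
    have "norm (y \<tau>) < r"
    proof (rule apriori[where y = y, OF \<tau>T y0])
      fix s assume s: "s \<in> {0..\<tau>}"
      have "(y has_vector_derivative f s (?p (y s))) (at s within {0..\<tau>})"
        by (rule has_vector_derivative_within_subset[OF y]) (use s \<tau>T in auto)
      then show "(y has_vector_derivative f s (y s)) (at s within {0..\<tau>})"
        by (simp add: pid[OF le[OF s]])
    qed
    then show False using \<tau>r by simp
  qed
  show ?thesis
  proof (rule that[where y = y, OF y0])
    fix t assume t: "t \<in> {0..T}"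
    show "(y has_vector_derivative f t (y t)) (at t within {0..T})"
      using y[OF t] pid[OF less_imp_le[OF lt[OF t]]] by simp
  qed
qed

text \<open>By uniqueness the solutions \<open>Y T\<close> on \<open>{0..T}\<close> agree where they
  overlap. The glued curve is the diagonal \<open>Y t t\<close>; its derivative at \<open>t\<close>
  is read off \<open>Y (t + 1)\<close>, whose interval contains a neighbourhood of \<open>t\<close>
  in \<open>{0..}\<close>.\<close>

lemma ode_glue:
  fixes f :: "real \<Rightarrow> 'a::real_normed_vector \<Rightarrow> 'a"
  assumes ex: "\<And>T. 0 \<le> T \<Longrightarrow> \<exists>y. y 0 = x0 \<and>
      (\<forall>t\<in>{0..T}. (y has_vector_derivative f t (y t)) (at t within {0..T}))"
    and uniq: "\<And>T y z. \<lbrakk>0 \<le> T; y 0 = x0; z 0 = x0;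
      \<forall>t\<in>{0..T}. (y has_vector_derivative f t (y t)) (at t within {0..T});
      \<forall>t\<in>{0..T}. (z has_vector_derivative f t (z t)) (at t within {0..T})\<rbrakk> \<Longrightarrow> y T = z T"
  obtains y where "y 0 = x0"
    "\<And>t. 0 \<le> t \<Longrightarrow> (y has_vector_derivative f t (y t)) (at t within {0..})"
proof -
  obtain Y where Y0: "\<And>T. 0 \<le> T \<Longrightarrow> Y T 0 = x0"
    and Y: "\<And>T. 0 \<le> T \<Longrightarrow> \<forall>t\<in>{0..T}. (Y T has_vector_derivative f t (Y T t)) (at t within {0..T})"
    using ex by metis
  have Ysub: "\<forall>s\<in>{0..t}. (Y T has_vector_derivative f s (Y T s)) (at s within {0..t})" if "0 \<le> t" "t \<le> T" for t T
  proof
    fix s assume "s \<in> {0..t}"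
    then show "(Y T has_vector_derivative f s (Y T s)) (at s within {0..t})"
      using Y[of T] that by (auto intro: has_vector_derivative_within_subset[where S = "{0..T}"])
  qed
  have eq: "Y T t = Y t t" if "0 \<le> t" "t \<le> T" for t T
    using uniq[of t "Y T" "Y t"] Ysub[OF that] Ysub[OF that(1) order_refl] Y0 that by simp
  show ?thesis
  proof (rule that[of "\<lambda>t. Y t t"])
    fix t :: real assume t: "0 \<le> t"
    have "(Y (t + 1) has_vector_derivative f t (Y (t + 1) t)) (at t within {0..t + 1})"
      using Y[of "t + 1"] t by auto
    moreover have "at t within {0..t + 1} = at t within {0..}"
      by (rule at_within_nhd[where S = "{..<t + 1}"]) auto
    ultimately have der: "(Y (t + 1) has_vector_derivative f t (Y t t)) (at t within {0..})"
      using eq[of t "t + 1"] t by simp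
    have "Y (t + 1) u = Y u u" if "u \<in> {0..}" "dist u t < 1" for u
      by (rule eq) (use that in \<open>auto simp: dist_real_def\<close>)
    then show "((\<lambda>t. Y t t) has_vector_derivative f t (Y t t)) (at t within {0..})"
      by (rule has_vector_derivative_transform_within[OF der zero_less_one atLeast_iff[THEN iffD2, OF t]])
  qed (use Y0 in auto)
qed

text \<open>Over a window of fixed length \<open>h\<close> the function \<open>p\<close> is almost
  constant, so a value of \<open>p\<close> away from 0 would move \<open>f\<close> by a fixed
  amount. Splitting the derivative into \<open>p + r\<close> extends the classical statement: only
  \<open>p\<close> has to be uniformly continuous, while \<open>r\<close> tends to 0.\<close>

lemma barbalat:
  fixes f p r :: "real \<Rightarrow> 'a::real_normed_vector"
  assumes f: "(f \<longlongrightarrow> l) at_top"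
    and f': "\<And>t. 0 \<le> t \<Longrightarrow> (f has_vector_derivative p t + r t) (at t within {0..})"
    and p: "uniformly_continuous_on {0..} p"
    and r: "(r \<longlongrightarrow> 0) at_top"
  shows "(p \<longlongrightarrow> 0) at_top"
proof (rule tendstoI)
  fix e :: real assume "e > 0"
  define e' where "e' = e / 4"
  have e': "e' > 0" using \<open>e > 0\<close> by (simp add: e'_def)
  obtain h' where h': "h' > 0" "\<And>s t. s \<ge> 0 \<Longrightarrow> t \<ge> 0 \<Longrightarrow> dist t s < h' \<Longrightarrow> dist (p t) (p s) < e'"
    using p e' unfolding uniformly_continuous_on_def by (metis atLeast_iff)
  define h where "h = h' / 2"
  have h: "h > 0" "h < h'" using h' by (auto simp: h_def)
  have "\<forall>\<^sub>F t in at_top. dist (f t) l < e' * h / 2"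
    by (rule tendstoD[OF f]) (use e' h in simp)
  then obtain T1 where T1: "\<And>t. t \<ge> T1 \<Longrightarrow> dist (f t) l < e' * h / 2"
    by (auto simp: eventually_at_top_linorder)
  have "\<forall>\<^sub>F t in at_top. dist (r t) 0 < e'"
    by (rule tendstoD[OF r e'])
  then obtain T2 where T2: "\<And>t. t \<ge> T2 \<Longrightarrow> dist (r t) 0 < e'"
    by (auto simp: eventually_at_top_linorder)
  have "dist (p t) 0 < e" if t: "t \<ge> max 0 (max T1 T2)" for t
  proof -
    have "norm (f (t + h) - f t - (t + h - t) *\<^sub>R p t) \<le> norm (t + h - t) * (2 * e')"
    proof -
      have "norm ((f (t + h) - (t + h) *\<^sub>R p t) - (f t - t *\<^sub>R p t)) \<le> 2 * e' * norm (t + h - t)"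
      proof (rule differentiable_bound[where S = "{t..t + h}" and f' = "\<lambda>s k. k *\<^sub>R (p s + r s - p t)"])
        fix s assume s: "s \<in> {t..t + h}"
        have "(f has_vector_derivative p s + r s) (at s within {t..t + h})"
          by (rule has_vector_derivative_within_subset[OF f']) (use s t in auto)
        then have "((\<lambda>s. f s - s *\<^sub>R p t) has_vector_derivative p s + r s - p t) (at s within {t..t + h})"
          by (auto intro!: derivative_eq_intros)
        then show "((\<lambda>s. f s - s *\<^sub>R p t) has_derivative (\<lambda>k. k *\<^sub>R (p s + r s - p t))) (at s within {t..t + h})"
          by (simp add: has_vector_derivative_def)
        have "norm (p s - p t + r s) \<le> norm (p s - p t) + norm (r s)" by (rule norm_triangle_ineq)
        also have "\<dots> \<le> e' + e'"
          using h'(2)[of t s] T2[of s] s t h by (intro add_mono) (auto simp: dist_norm)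
        finally have "norm (p s + r s - p t) \<le> 2 * e'" by (simp add: algebra_simps)
        then show "onorm (\<lambda>k. k *\<^sub>R (p s + r s - p t)) \<le> 2 * e'"
          by (intro onorm_le) (simp add: mult.commute[of _ "norm _"] mult_right_mono)
      qed (use h in auto)
      then show ?thesis by (simp add: algebra_simps)
    qed
    then have "norm (h *\<^sub>R p t) \<le> 2 * e' * h + norm (f (t + h) - f t)"
      using h norm_triangle_sub[of "h *\<^sub>R p t" "f (t + h) - f t"] by (simp add: norm_minus_commute mult_ac)
    also have "norm (f (t + h) - f t) < e' * h"
      using T1[of t] T1[of "t + h"] t h dist_triangle2[of "f (t + h)" "f t" l]
      by (auto simp: dist_norm)
    finally have "h * norm (p t) < h * (3 * e')" using h by (simp add: algebra_simps)
    then have "norm (p t) < 3 * e'" using h by simp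
    then show ?thesis using e' by (simp add: e'_def)
  qed
  then show "\<forall>\<^sub>F t in at_top. dist (p t) 0 < e"
    unfolding eventually_at_top_linorder by blast
qed

subsection \<open>Skew-symmetric matrices and rotations\<close>

declare transpose_matrix_vector [simp del]

lemma bounded_bilinear_matrix_mult:
  "bounded_bilinear ((**) :: real^'n^'m \<Rightarrow> real^'k^'n \<Rightarrow> real^'k^'m)"
  unfolding bilinear_conv_bounded_bilinear[symmetric] bilinear_def
  by (auto intro!: linearI simp: matrix_matrix_mult_def vec_eq_iff algebra_simps sum.distrib sum_distrib_left)

lemma bounded_bilinear_matrix_vector_mult:
  "bounded_bilinear ((*v) :: real^'n^'m \<Rightarrow> real^'n \<Rightarrow> real^'m)"
  unfolding bilinear_conv_bounded_bilinear[symmetric] bilinear_def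
  by (auto intro!: linearI simp: matrix_vector_mult_def vec_eq_iff algebra_simps sum.distrib sum_distrib_left)

lemma bounded_bilinear_cross3: "bounded_bilinear cross3"
  unfolding bilinear_conv_bounded_bilinear[symmetric] by (rule bilinear_cross)

lemma bounded_linear_transpose: "bounded_linear (transpose :: real^'n^'m \<Rightarrow> real^'m^'n)"
  by (intro linear_conv_bounded_linear[THEN iffD1] linearI) (simp_all add: transpose_def vec_eq_iff)

lemma bounded_linear_trace: "bounded_linear (trace :: real^'n^'n \<Rightarrow> real)"
  by (intro linear_conv_bounded_linear[THEN iffD1] linearI) (simp_all add: trace_def sum.distrib sum_distrib_left)

lemmas transpose_add = bounded_linear_transpose[THEN bounded_linear.linear, THEN linear_add]
  and transpose_diff = bounded_linear_transpose[THEN bounded_linear.linear, THEN linear_diff]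
  and transpose_scaleR = bounded_linear_transpose[THEN bounded_linear.linear, THEN linear_cmul]
  and transpose_continuous_on = bounded_linear.continuous_on[OF bounded_linear_transpose]
  and transpose_has_vector_derivative = bounded_linear.has_vector_derivative[OF bounded_linear_transpose]

lemmas trace_add = bounded_linear_trace[THEN bounded_linear.linear, THEN linear_add]
  and trace_diff = bounded_linear_trace[THEN bounded_linear.linear, THEN linear_diff]
  and trace_scaleR = bounded_linear_trace[THEN bounded_linear.linear, THEN linear_cmul]
  and trace_has_vector_derivative = bounded_linear.has_vector_derivative[OF bounded_linear_trace]

interpretation matrix_mult: bounded_bilinear "(**) :: real^'n^'m \<Rightarrow> real^'k^'n \<Rightarrow> real^'k^'m"
  by (rule bounded_bilinear_matrix_mult)

interpretation matrix_vector_mult: bounded_bilinear "(*v) :: real^'n^'m \<Rightarrow> real^'n \<Rightarrow> real^'m"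
  by (rule bounded_bilinear_matrix_vector_mult)

interpretation cross3: bounded_bilinear cross3
  by (rule bounded_bilinear_cross3)

text \<open>Twice the axial vector of the antisymmetric part. Unlike \<open>vex\<close> it is linear
  on all matrices, and the doubling makes \<open>skew (axl M)\<close> equal to
  \<open>M - transpose M\<close> itself.\<close>

definition axl :: "real^3^3 \<Rightarrow> real^3" where
  "axl M = vector [M$3$2 - M$2$3, M$1$3 - M$3$1, M$2$1 - M$1$2]"

lemma skew_components:
  "skew a = vector [vector [0, - a$3, a$2], vector [a$3, 0, - a$1], vector [- a$2, a$1, 0]]"
  by (simp add: skew_def matrix_def cross3_def vec_eq_iff forall_3 axis_def)

lemmas matrix3_simps = vec_eq_iff forall_3 sum_3 matrix_matrix_mult_def matrix_vector_mult_def
  transpose_def trace_def inner_vec_def skew_components axl_def mat_def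

lemma skew_axl: "skew (axl M) = M - transpose M"
  by (simp add: matrix3_simps)

lemma axl_eq_0_iff: "axl M = 0 \<longleftrightarrow> transpose M = M"
  by (auto simp: matrix3_simps)

lemma trace_skew_mult: "trace (skew a ** M) = - (a \<bullet> axl M)"
  by (simp add: matrix3_simps algebra_simps)

lemma transpose_skew: "transpose (skew a) = - skew a"
  by (simp add: matrix3_simps)

lemma bounded_linear_skew: "bounded_linear skew"
  by (intro linear_conv_bounded_linear[THEN iffD1] linearI) (simp_all add: matrix3_simps algebra_simps)

lemma bounded_linear_axl: "bounded_linear axl"
  by (intro linear_conv_bounded_linear[THEN iffD1] linearI) (simp_all add: matrix3_simps algebra_simps)

lemmas skew_add = bounded_linear_skew[THEN bounded_linear.linear, THEN linear_add]
  and skew_diff = bounded_linear_skew[THEN bounded_linear.linear, THEN linear_diff]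
  and skew_neg = bounded_linear_skew[THEN bounded_linear.linear, THEN linear_neg]
  and skew_scaleR = bounded_linear_skew[THEN bounded_linear.linear, THEN linear_cmul]
  and skew_zero = bounded_linear_skew[THEN bounded_linear.linear, THEN linear_0]
  and skew_continuous_on = bounded_linear.continuous_on[OF bounded_linear_skew]
  and skew_tendsto = bounded_linear.tendsto[OF bounded_linear_skew]

lemmas axl_neg = bounded_linear_axl[THEN bounded_linear.linear, THEN linear_neg]

text \<open>With \<open>M = Q ** K\<close> at a critical point, the right-hand side is the Hessian
  of the potential acting on \<open>a\<close>.\<close>

lemma axl_symmetric_skew:
  assumes "transpose M = M"
  shows "axl (M ** skew a) = trace M *\<^sub>R a - M *v a"
proof -
  have "M$2$1 = M$1$2" "M$3$1 = M$1$3" "M$3$2 = M$2$3"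
    using assms by (simp_all add: transpose_def vec_eq_iff)
  then show ?thesis by (simp add: matrix3_simps algebra_simps)
qed

lemma rotation_conj_skew:
  assumes "rotation_matrix R"
  shows "R ** skew a ** transpose R = skew (R *v a)"
proof -
  have R: "R ** transpose R = mat 1"
    using assms by (simp add: rotation_matrix_def orthogonal_matrix_def)
  have "(R ** skew a ** transpose R) *v x = skew (R *v a) *v x" for x
  proof -
    have "(R ** skew a ** transpose R) *v x = R *v cross3 a (transpose R *v x)"
      by (simp flip: matrix_vector_mul_assoc)
    also have "\<dots> = cross3 (R *v a) (R *v (transpose R *v x))"
      by (simp add: cross_rotation_matrix assms)
    also have "R *v (transpose R *v x) = x"
      by (simp only: matrix_vector_mul_assoc R matrix_vector_mul_lid)
    finally show ?thesis by simp
  qed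
  then show ?thesis by (simp add: matrix_eq)
qed

lemma rotation_matrix_transpose: "rotation_matrix R \<Longrightarrow> rotation_matrix (transpose R)"
  by (auto simp: rotation_matrix_def orthogonal_matrix_def)

lemma rotation_matrix_mult:
  fixes A B :: "real^'n^'n"
  shows "rotation_matrix A \<Longrightarrow> rotation_matrix B \<Longrightarrow> rotation_matrix (A ** B)"
  by (auto simp: rotation_matrix_def det_mul intro: orthogonal_matrix_mul)

lemma skew_cubed: "skew a ** (skew a ** skew a) = - (a \<bullet> a) *\<^sub>R skew a"
  by (simp add: matrix3_simps) (algebra)

text \<open>Rodrigues's formula for the exponential of \<open>t *\<^sub>R skew a\<close> with
  \<open>a\<close> a unit vector; the closed form replaces the exponential series.\<close>

definition rodrigues :: "real^3 \<Rightarrow> real \<Rightarrow> real^3^3" where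
  "rodrigues a t = mat 1 + sin t *\<^sub>R skew a + (1 - cos t) *\<^sub>R (skew a ** skew a)"

lemma rodrigues_add:
  assumes "norm a = 1"
  shows "rodrigues a s ** rodrigues a t = rodrigues a (s + t)"
proof -
  define A where "A = skew a"
  have 3: "A ** (A ** A) = - A"
    using assms skew_cubed[of a] by (simp add: A_def norm_eq_1)
  show ?thesis
    unfolding rodrigues_def A_def[symmetric]
    by (simp add: matrix_mult.add_left matrix_mult.add_right matrix_mult.scaleR_left matrix_mult.scaleR_right
        matrix_mult.minus_right matrix_mult.minus_left 3 matrix_mul_assoc[symmetric] sin_add cos_add)
      (simp add: algebra_simps)
qed

lemma transpose_rodrigues: "transpose (rodrigues a t) = rodrigues a (- t)"
  unfolding rodrigues_def
  by (simp add: transpose_add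
      transpose_scaleR
      matrix_transpose_mul transpose_skew matrix_mult.minus_left matrix_mult.minus_right)

lemma rotation_rodrigues:
  assumes "norm a = 1"
  shows "rotation_matrix (rodrigues a t)"
proof -
  have orth: "orthogonal_matrix (rodrigues a s)" for s
    unfolding orthogonal_matrix_def transpose_rodrigues rodrigues_add[OF assms]
    by (simp add: rodrigues_def)
  \<comment> \<open>Halving the angle writes the determinant as a square, which leaves 1 as the only
    possible value.\<close>
  have "det (rodrigues a t) = det (rodrigues a (t / 2)) * det (rodrigues a (t / 2))"
    by (simp add: rodrigues_add[OF assms] flip: det_mul)
  also have "\<dots> = 1" using det_orthogonal_matrix[OF orth, of "t / 2"] by auto
  finally show ?thesis using orth by (simp add: rotation_matrix_def)
qed

subsection \<open>Critical points of the potential\<close>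

definition diagm :: "('n::finite \<Rightarrow> real) \<Rightarrow> real^'n^'n" where
  "diagm d = (\<chi> i j. if i = j then d i else 0)"

lemma diagm_mult: "diagm a ** diagm b = diagm (\<lambda>i. a i * b i)"
  by (auto simp: diagm_def matrix_matrix_mult_def vec_eq_iff if_distrib[of "\<lambda>x. x * _"] cong: if_cong)

lemma transpose_diagm [simp]: "transpose (diagm a) = diagm a"
  by (auto simp: diagm_def transpose_def vec_eq_iff)

lemma diagm_1: "diagm (\<lambda>i. 1) = mat 1"
  by (auto simp: diagm_def mat_def vec_eq_iff)

lemma trace_diagm: "trace (diagm a) = sum a UNIV"
  by (simp add: diagm_def trace_def)

lemma orthogonal_conj_simps:
  fixes U :: "real^'n^'n"
  assumes "orthogonal_matrix U"
  shows "transpose U ** (U ** A) = A" "U ** (transpose U ** A) = A"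
    "transpose U ** U = mat 1" "U ** transpose U = mat 1"
  using assms by (simp_all add: orthogonal_matrix_def matrix_mul_assoc)

lemma trace_orthogonal_conj:
  fixes U :: "real^'n^'n"
  assumes "orthogonal_matrix U"
  shows "trace (U ** A ** transpose U) = trace A"
  using trace_mul_sym[of "U ** A" "transpose U"] by (simp add: orthogonal_conj_simps[OF assms] matrix_mul_assoc[symmetric])

lemma orthogonal_entry_le_1:
  fixes A :: "real^'n^'n"
  assumes "orthogonal_matrix A"
  shows "\<bar>A $ i $ j\<bar> \<le> 1"
proof -
  have "norm (A $ i) = 1"
    using assms orthogonal_matrix_orthonormal_rows[of A] by (auto simp: row_def vec_nth_inverse)
  then show ?thesis using component_le_norm_cart[of "A $ i" j] by simp
qed

text \<open>In the eigenbasis of \<open>K\<close> the trace is the sum of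
  \<open>A $ i $ i * d i\<close> with \<open>A\<close> orthogonal, and entries of \<open>A\<close>
  are at most 1. Equality forces every diagonal entry to be 1, and a unit row with diagonal entry 1
  is a coordinate vector.\<close>

lemma trace_gap:
  fixes U Q :: "real^'n^'n"
  assumes U: "orthogonal_matrix U" and K: "K = U ** diagm d ** transpose U"
    and Q: "orthogonal_matrix Q" and d: "\<And>i. d i > 0"
  shows "trace (Q ** K) \<le> trace K" and "trace (Q ** K) = trace K \<longleftrightarrow> Q = mat 1"
proof -
  define A where "A = transpose U ** Q ** U"
  have A: "orthogonal_matrix A"
    unfolding A_def by (intro orthogonal_matrix_mul Q U) (simp add: U)
  have "Q ** K = U ** (A ** diagm d) ** transpose U"
    by (simp add: A_def K orthogonal_conj_simps[OF U] matrix_mul_assoc[symmetric])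
  then have "trace (Q ** K) = trace (A ** diagm d)"
    by (simp only: trace_orthogonal_conj[OF U])
  then have tQ: "trace (Q ** K) = (\<Sum>i\<in>UNIV. A $ i $ i * d i)"
    by (subst (asm) (2) trace_def) (simp add: matrix_matrix_mult_def diagm_def if_distrib[of "\<lambda>x. _ * x"] cong: if_cong)
  have tK: "trace K = (\<Sum>i\<in>UNIV. d i)"
    by (simp add: K trace_orthogonal_conj[OF U] trace_diagm)
  have le: "A $ i $ i * d i \<le> d i" for i
    using orthogonal_entry_le_1[OF A, of i i] d[of i] by (simp add: abs_le_iff)
  show "trace (Q ** K) \<le> trace K"
    unfolding tQ tK by (intro sum_mono le)
  show "trace (Q ** K) = trace K \<longleftrightarrow> Q = mat 1"
  proof
    assume "trace (Q ** K) = trace K"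
    then have "(\<Sum>i\<in>UNIV. d i - A $ i $ i * d i) = 0"
      by (simp add: tQ tK sum_subtractf)
    then have "\<forall>i. d i - A $ i $ i * d i = 0"
      by (subst (asm) sum_nonneg_eq_0_iff) (auto simp: le)
    then have Aii: "A $ i $ i = 1" for i
      using d[of i] by (metis eq_iff_diff_eq_0 less_irrefl mult_cancel_right1)
    have "A = mat 1"
    proof -
      have n: "norm (A $ i) = 1" for i
        using A orthogonal_matrix_orthonormal_rows[of A] by (auto simp: row_def vec_nth_inverse)
      have "A $ i = axis i 1" for i
      proof -
        have "(norm (A $ i - axis i 1))\<^sup>2 = 0"
          using n[of i] by (simp add: power2_norm_eq_inner inner_diff_left inner_diff_right inner_axis inner_axis' Aii inner_axis_axis norm_eq_1)
        then show ?thesis by simp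
      qed
      then show ?thesis by (simp add: vec_eq_iff mat_def axis_def)
    qed
    then have "U ** A ** transpose U = mat 1" by (simp add: orthogonal_conj_simps[OF U])
    then show "Q = mat 1"
      by (simp add: A_def orthogonal_conj_simps[OF U] matrix_mul_assoc[symmetric])
  qed simp
qed

text \<open>In the eigenbasis, symmetry of \<open>A ** diagm d\<close> and orthogonality of
  \<open>A\<close> give two relations between \<open>A $ i $ j\<close> and \<open>A $ j $ i\<close>.
  Together they yield \<open>A $ i $ j * (d j)\<^sup>2 = A $ i $ j * (d i)\<^sup>2\<close>, so
  distinct positive eigenvalues leave a diagonal \<open>A\<close>; orthogonality and the determinant
  reduce it to signs with product 1.\<close>

lemma critical_point_form:
  fixes U Q :: "real^3^3"
  assumes U: "orthogonal_matrix U" and K: "K = U ** diagm d ** transpose U"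
    and Q: "rotation_matrix Q" and d: "\<And>i. d i > 0" "inj d"
    and sym: "transpose (Q ** K) = Q ** K"
  obtains \<epsilon> where "\<And>i. \<epsilon> i = 1 \<or> \<epsilon> i = - 1" "\<epsilon> 1 * \<epsilon> 2 * \<epsilon> 3 = (1::real)"
    "Q = U ** diagm \<epsilon> ** transpose U"
proof -
  define A where "A = transpose U ** Q ** U"
  have oA: "orthogonal_matrix A"
    unfolding A_def by (intro orthogonal_matrix_mul U) (use Q U in \<open>auto simp: rotation_matrix_def\<close>)
  have "det U * det U = 1" using det_orthogonal_matrix[OF U] by auto
  then have detA: "det A = 1"
    using Q by (simp add: A_def det_mul rotation_matrix_def)
  have QK: "Q ** K = U ** (A ** diagm d) ** transpose U"
    by (simp add: A_def K orthogonal_conj_simps[OF U] matrix_mul_assoc[symmetric])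
  have "A ** diagm d = transpose U ** (Q ** K) ** U"
    unfolding QK by (simp add: orthogonal_conj_simps[OF U] matrix_mul_assoc[symmetric])
  then have s1: "transpose (A ** diagm d) = A ** diagm d"
    using sym by (simp add: matrix_transpose_mul matrix_mul_assoc)
  \<comment> \<open>Multiplying the symmetry relation by \<open>transpose A\<close> on the left and
    \<open>A\<close> on the right produces the second relation.\<close>
  have s2: "transpose A ** diagm d = diagm d ** A"
  proof -
    have "diagm d ** transpose A = A ** diagm d" using s1 by (simp add: matrix_transpose_mul)
    then have "transpose A ** (diagm d ** transpose A) ** A = transpose A ** (A ** diagm d) ** A" by simp
    then show ?thesis by (simp add: orthogonal_conj_simps[OF oA] matrix_mul_assoc[symmetric])
  qed
  have e1: "A $ j $ i * d i = A $ i $ j * d j" for i j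
    using s1[unfolded vec_eq_iff, rule_format, of i j]
    by (simp add: transpose_def matrix_matrix_mult_def diagm_def if_distrib[of "\<lambda>x. _ * x"] cong: if_cong)
  have e2: "A $ j $ i * d j = d i * A $ i $ j" for i j
    using s2[unfolded vec_eq_iff, rule_format, of i j]
    by (simp add: transpose_def matrix_matrix_mult_def diagm_def if_distrib[of "\<lambda>x. _ * x"] if_distrib[of "\<lambda>x. x * _"] cong: if_cong)
  have off: "A $ i $ j = 0" if "i \<noteq> j" for i j
  proof -
    have "A $ i $ j * (d j)\<^sup>2 = (A $ j $ i * d j) * d i"
      using e1[of j i] by (simp add: power2_eq_square)
    also have "\<dots> = A $ i $ j * (d i)\<^sup>2" using e2[of j i] by (simp add: power2_eq_square)
    finally have "A $ i $ j * ((d j)\<^sup>2 - (d i)\<^sup>2) = 0" by (simp add: algebra_simps)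
    moreover have "(d j)\<^sup>2 \<noteq> (d i)\<^sup>2"
      using d that by (metis injD less_eq_real_def power2_eq_iff_nonneg)
    ultimately show ?thesis by simp
  qed
  define \<epsilon> where "\<epsilon> i = A $ i $ i" for i
  have A: "A = diagm \<epsilon>" by (auto simp: vec_eq_iff diagm_def \<epsilon>_def off)
  have "diagm (\<lambda>i. \<epsilon> i * \<epsilon> i) = mat 1"
    using oA by (simp add: A orthogonal_matrix_def diagm_mult)
  then have "\<epsilon> i * \<epsilon> i = 1" for i
    by (simp add: vec_eq_iff diagm_def mat_def) (metis (full_types))
  then have 1: "\<epsilon> i = 1 \<or> \<epsilon> i = - 1" for i
    by (metis square_eq_1_iff)
  have 2: "\<epsilon> 1 * \<epsilon> 2 * \<epsilon> 3 = 1"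
    using detA by (simp add: A det_3 diagm_def)
  have "Q = U ** A ** transpose U"
    by (simp add: A_def orthogonal_conj_simps[OF U] matrix_mul_assoc[symmetric])
  then show ?thesis using that[OF 1 2] by (simp add: A)
qed

text \<open>\<open>H\<close> is diagonal in the eigenbasis, and \<open>h i\<close> is the sum of
  \<open>\<epsilon> j * d j\<close> over the two indices \<open>j\<close> other than
  \<open>i\<close>. Two distinct positive numbers with signs never add up to 0. If \<open>Q\<close>
  is not the identity, exactly two signs are -1, and the third index has a negative
  \<open>h\<close>.\<close>

lemma hessian_critical_point:
  fixes U Q :: "real^3^3"
  assumes U: "orthogonal_matrix U" and K: "K = U ** diagm d ** transpose U"
    and Q: "rotation_matrix Q" and d: "\<And>i. d i > 0" "inj d"
    and sym: "transpose (Q ** K) = Q ** K"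
  defines "H \<equiv> trace (Q ** K) *\<^sub>R mat 1 - Q ** K"
  obtains G where "transpose G = G" "G ** H = mat 1" "H ** G = mat 1"
    "Q \<noteq> mat 1 \<Longrightarrow> \<exists>\<theta>. norm \<theta> = 1 \<and> \<theta> \<bullet> (H *v \<theta>) < 0"
proof -
  obtain \<epsilon> where \<epsilon>: "\<And>i. \<epsilon> i = 1 \<or> \<epsilon> i = - 1" "\<epsilon> 1 * \<epsilon> 2 * \<epsilon> 3 = 1"
    and Qf: "Q = U ** diagm \<epsilon> ** transpose U"
    using critical_point_form[OF U K Q d sym] by blast
  have QK: "Q ** K = U ** diagm (\<lambda>i. \<epsilon> i * d i) ** transpose U"
    unfolding Qf K by (simp add: orthogonal_conj_simps[OF U] matrix_mul_assoc[symmetric] flip: diagm_mult)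
  define h where "h i = (\<Sum>j\<in>UNIV. \<epsilon> j * d j) - \<epsilon> i * d i" for i
  have Hf: "H = U ** diagm h ** transpose U"
  proof -
    have "diagm h = trace (Q ** K) *\<^sub>R mat 1 - diagm (\<lambda>i. \<epsilon> i * d i)"
      by (auto simp: vec_eq_iff h_def diagm_def mat_def QK trace_orthogonal_conj[OF U] trace_diagm[unfolded diagm_def])
    then show ?thesis
      unfolding H_def by (simp add: QK matrix_mult.diff_left matrix_mult.diff_right matrix_mult.scaleR_left matrix_mult.scaleR_right
          orthogonal_conj_simps[OF U])
  qed
  have dne: "d 1 \<noteq> d 2" "d 1 \<noteq> d 3" "d 2 \<noteq> d 3" "d 2 \<noteq> d 1" "d 3 \<noteq> d 1" "d 3 \<noteq> d 2"
    using d(2) by (auto simp: inj_eq)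
  have h0: "h i \<noteq> 0" for i
    using \<epsilon>(1)[of 1] \<epsilon>(1)[of 2] \<epsilon>(1)[of 3] dne d(1)[of 1] d(1)[of 2] d(1)[of 3] exhaust_3[of i]
    by (auto simp: h_def sum_3)
  define G where "G = U ** diagm (\<lambda>i. 1 / h i) ** transpose U"
  show ?thesis
  proof (rule that[of G])
    show "transpose G = G" by (simp add: G_def matrix_transpose_mul matrix_mul_assoc)
    show "G ** H = mat 1" "H ** G = mat 1"
      unfolding G_def Hf
      by (simp_all add: orthogonal_conj_simps[OF U] matrix_mul_assoc[symmetric])
        (simp_all add: matrix_mul_assoc diagm_mult h0 diagm_1 orthogonal_conj_simps[OF U])
    assume "Q \<noteq> mat 1"
    have "\<exists>k. h k < 0"
    proof (rule ccontr)
      assume "\<nexists>k. h k < 0"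
      then have "\<not> h 1 < 0" "\<not> h 2 < 0" "\<not> h 3 < 0" by auto
      then have "\<epsilon> i = 1" for i
        using \<epsilon>(1)[of 1] \<epsilon>(1)[of 2] \<epsilon>(1)[of 3] \<epsilon>(2) d(1)[of 1] d(1)[of 2] d(1)[of 3] exhaust_3[of i]
        by (auto simp: h_def sum_3)
      then have "\<epsilon> = (\<lambda>i. 1)" by auto
      then show False using \<open>Q \<noteq> mat 1\<close> Qf by (simp add: diagm_1 orthogonal_conj_simps[OF U])
    qed
    then obtain k where k: "h k < 0" by blast
    define \<theta> where "\<theta> = U *v axis k 1"
    have n: "norm \<theta> = 1"
      using U
      by (simp add: \<theta>_def orthogonal_transformation_norm[of "(*v) U"] orthogonal_transformation_matrix)
    have "\<theta> \<bullet> (H *v \<theta>) = (transpose U *v \<theta>) \<bullet> (diagm h *v (transpose U *v \<theta>))"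
      by (simp add: Hf dot_lmul_matrix[symmetric] transpose_matrix_vector flip: matrix_vector_mul_assoc)
    also have "transpose U *v \<theta> = axis k 1"
      by (simp add: \<theta>_def matrix_vector_mul_assoc orthogonal_conj_simps[OF U])
    also have "axis k 1 \<bullet> (diagm h *v axis k 1) = h k"
      by (simp add: inner_vec_def matrix_vector_mult_def diagm_def axis_def if_distrib[of "\<lambda>x. _ * x"] if_distrib[of "\<lambda>x. x * _"] cong: if_cong)
    finally show "\<exists>\<theta>. norm \<theta> = 1 \<and> \<theta> \<bullet> (H *v \<theta>) < 0" using n k by auto
  qed
qed

subsection \<open>The error dynamics\<close>

text \<open>One constant serves for boundedness and for the Lipschitz estimate because the product
  rule needs both. The parameter is a time for the vector field, and a single point for a function
  of the attitude alone.\<close>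

definition ulip :: "'p set \<Rightarrow> 'a::real_normed_vector set \<Rightarrow> ('p \<Rightarrow> 'a \<Rightarrow> 'b::real_normed_vector) \<Rightarrow> bool" where
  "ulip I S f \<longleftrightarrow> (\<exists>B\<ge>0. \<forall>t\<in>I. \<forall>x\<in>S. norm (f t x) \<le> B \<and> (\<forall>y\<in>S. norm (f t x - f t y) \<le> B * norm (x - y)))"

lemma ulipI:
  assumes "\<And>t x. t \<in> I \<Longrightarrow> x \<in> S \<Longrightarrow> norm (f t x) \<le> B"
    and "\<And>t x y. t \<in> I \<Longrightarrow> x \<in> S \<Longrightarrow> y \<in> S \<Longrightarrow> norm (f t x - f t y) \<le> C * norm (x - y)"
  shows "ulip I S f"
  unfolding ulip_def
proof (intro exI[of _ "max 0 (max B C)"] conjI ballI)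
  fix t x y assume "t \<in> I" "x \<in> S" "y \<in> S"
  then have "norm (f t x - f t y) \<le> C * norm (x - y)" by (rule assms(2))
  also have "\<dots> \<le> max 0 (max B C) * norm (x - y)" by (intro mult_right_mono) auto
  finally show "norm (f t x - f t y) \<le> max 0 (max B C) * norm (x - y)" .
qed (use assms(1) in force)+

lemma ulipE:
  assumes "ulip I S f"
  obtains B where "B > 0" "\<And>t x. t \<in> I \<Longrightarrow> x \<in> S \<Longrightarrow> norm (f t x) \<le> B"
    "\<And>t x y. t \<in> I \<Longrightarrow> x \<in> S \<Longrightarrow> y \<in> S \<Longrightarrow> norm (f t x - f t y) \<le> B * norm (x - y)"
proof -
  obtain B where B: "B \<ge> 0" "\<And>t x. t \<in> I \<Longrightarrow> x \<in> S \<Longrightarrow> norm (f t x) \<le> B"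
    "\<And>t x y. t \<in> I \<Longrightarrow> x \<in> S \<Longrightarrow> y \<in> S \<Longrightarrow> norm (f t x - f t y) \<le> B * norm (x - y)"
    using assms unfolding ulip_def by metis
  show ?thesis
  proof (rule that[of "B + 1"])
    fix t x y assume "t \<in> I" "x \<in> S" "y \<in> S"
    then have "norm (f t x - f t y) \<le> B * norm (x - y)" by (rule B(3))
    then show "norm (f t x - f t y) \<le> (B + 1) * norm (x - y)"
      by (simp add: distrib_right add_increasing2)
  qed (use B(1) in \<open>auto intro: order_trans[OF B(2)]\<close>)
qed

lemma ulip_bilinear:
  assumes "bounded_bilinear bil" "ulip I S f" "ulip I S g"
  shows "ulip I S (\<lambda>t x. bil (f t x) (g t x))"
proof -
  interpret bounded_bilinear bil by fact
  obtain K where K: "0 < K" "\<And>a b. norm (bil a b) \<le> norm a * norm b * K"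
    using pos_bounded by blast
  obtain B where B: "B > 0" "\<And>t x. t \<in> I \<Longrightarrow> x \<in> S \<Longrightarrow> norm (f t x) \<le> B"
    "\<And>t x y. t \<in> I \<Longrightarrow> x \<in> S \<Longrightarrow> y \<in> S \<Longrightarrow> norm (f t x - f t y) \<le> B * norm (x - y)"
    using assms(2) by (rule ulipE) blast
  obtain C where C: "C > 0" "\<And>t x. t \<in> I \<Longrightarrow> x \<in> S \<Longrightarrow> norm (g t x) \<le> C"
    "\<And>t x y. t \<in> I \<Longrightarrow> x \<in> S \<Longrightarrow> y \<in> S \<Longrightarrow> norm (g t x - g t y) \<le> C * norm (x - y)"
    using assms(3) by (rule ulipE) blast
  show ?thesis
  proof (rule ulipI)
    fix t x assume t: "t \<in> I" and x: "x \<in> S"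
    have "norm (bil (f t x) (g t x)) \<le> norm (f t x) * norm (g t x) * K" by (rule K)
    also have "\<dots> \<le> B * C * K"
      by (intro mult_right_mono mult_mono B C t x) (use B C K in auto)
    finally show "norm (bil (f t x) (g t x)) \<le> B * C * K" .
    fix y assume y: "y \<in> S"
    have "bil (f t x) (g t x) - bil (f t y) (g t y)
        = bil (f t x - f t y) (g t x) + bil (f t y) (g t x - g t y)"
      by (simp add: diff_left diff_right)
    also have "norm \<dots> \<le> norm (f t x - f t y) * norm (g t x) * K + norm (f t y) * norm (g t x - g t y) * K"
      by (intro norm_triangle_le add_mono K)
    also have "\<dots> \<le> (B * norm (x - y)) * C * K + B * (C * norm (x - y)) * K"
      by (intro add_mono mult_right_mono mult_mono B C t x y) (use B C K in auto)
    finally show "norm (bil (f t x) (g t x) - bil (f t y) (g t y)) \<le> (2 * B * C * K) * norm (x - y)"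
      by (simp add: algebra_simps)
  qed
qed

lemma ulip_linear:
  assumes "bounded_linear h" "ulip I S f"
  shows "ulip I S (\<lambda>t x. h (f t x))"
proof -
  interpret bounded_linear h by fact
  obtain K where K: "0 < K" "\<And>a. norm (h a) \<le> norm a * K"
    using pos_bounded by blast
  obtain B where B: "B > 0" "\<And>t x. t \<in> I \<Longrightarrow> x \<in> S \<Longrightarrow> norm (f t x) \<le> B"
    "\<And>t x y. t \<in> I \<Longrightarrow> x \<in> S \<Longrightarrow> y \<in> S \<Longrightarrow> norm (f t x - f t y) \<le> B * norm (x - y)"
    using assms(2) by (rule ulipE) blast
  show ?thesis
  proof (rule ulipI)
    fix t x y assume t: "t \<in> I" and x: "x \<in> S"
    show "norm (h (f t x)) \<le> B * K"
      by (rule order_trans[OF K(2)]) (intro mult_right_mono B t x less_imp_le[OF K(1)])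
    assume y: "y \<in> S"
    have "norm (h (f t x) - h (f t y)) \<le> norm (f t x - f t y) * K" by (metis K(2) diff)
    also have "\<dots> \<le> (B * norm (x - y)) * K"
      by (intro mult_right_mono B t x y less_imp_le[OF K(1)])
    finally show "norm (h (f t x) - h (f t y)) \<le> (B * K) * norm (x - y)" by (simp add: algebra_simps)
  qed
qed

lemma ulip_param: "bounded (g ` I) \<Longrightarrow> ulip I S (\<lambda>t x. g t)"
  unfolding bounded_iff by (auto intro!: ulipI[where C = 0])

lemma ulip_const: "ulip I S (\<lambda>t x. c)"
  by (intro ulipI[where C = 0 and B = "norm c"]) auto

lemma ulip_id: "bounded S \<Longrightarrow> ulip I S (\<lambda>t x. x)"
  unfolding bounded_iff by (auto intro!: ulipI[where C = 1])

lemma ulip_add: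
  assumes "ulip I S f" "ulip I S g"
  shows "ulip I S (\<lambda>t x. f t x + g t x)"
proof -
  obtain B where B: "B > 0" "\<And>t x. t \<in> I \<Longrightarrow> x \<in> S \<Longrightarrow> norm (f t x) \<le> B"
    "\<And>t x y. t \<in> I \<Longrightarrow> x \<in> S \<Longrightarrow> y \<in> S \<Longrightarrow> norm (f t x - f t y) \<le> B * norm (x - y)"
    using assms(1) by (rule ulipE) blast
  obtain C where C: "C > 0" "\<And>t x. t \<in> I \<Longrightarrow> x \<in> S \<Longrightarrow> norm (g t x) \<le> C"
    "\<And>t x y. t \<in> I \<Longrightarrow> x \<in> S \<Longrightarrow> y \<in> S \<Longrightarrow> norm (g t x - g t y) \<le> C * norm (x - y)"
    using assms(2) by (rule ulipE) blast
  show ?thesis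
  proof (rule ulipI)
    fix t x y assume t: "t \<in> I" and x: "x \<in> S"
    show "norm (f t x + g t x) \<le> B + C" by (intro norm_triangle_mono B C t x)
    assume y: "y \<in> S"
    have "norm ((f t x - f t y) + (g t x - g t y)) \<le> B * norm (x - y) + C * norm (x - y)"
      by (intro norm_triangle_mono B C t x y)
    then show "norm (f t x + g t x - (f t y + g t y)) \<le> (B + C) * norm (x - y)"
      by (simp add: algebra_simps)
  qed
qed

lemma ulip_minus: "ulip I S f \<Longrightarrow> ulip I S (\<lambda>t x. - f t x)"
  by (rule ulip_linear[OF bounded_linear_minus[OF bounded_linear_ident]])

lemma ulip_diff: "ulip I S f \<Longrightarrow> ulip I S g \<Longrightarrow> ulip I S (\<lambda>t x. f t x - g t x)"
  using ulip_add[OF _ ulip_minus, of I S f g] by simp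

lemma ulip_Pair:
  assumes "ulip I S f" "ulip I S g"
  shows "ulip I S (\<lambda>t x. (f t x, g t x))"
proof -
  have "ulip I S (\<lambda>t x. (f t x, 0) + (0, g t x))"
    by (intro ulip_add ulip_linear[OF _ assms(1)] ulip_linear[OF _ assms(2)] bounded_linear_Pair
        bounded_linear_ident bounded_linear_zero)
  then show ?thesis by simp
qed

text \<open>\<open>\<phi>\<close> is controlled on nonnegative arguments only, hence the absolute
  value inside; being 1-Lipschitz, it preserves the estimate.\<close>

lemma ulip_compose:
  fixes f :: "'p \<Rightarrow> 'a::real_normed_vector \<Rightarrow> real"
  assumes \<phi>: "\<And>M. \<exists>L. \<forall>x\<in>{0..M}. \<forall>y\<in>{0..M}. \<bar>\<phi> x - \<phi> y\<bar> \<le> L * \<bar>x - y\<bar>" and f: "ulip I S f"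
  shows "ulip I S (\<lambda>t x. \<phi> \<bar>f t x\<bar> :: real)"
proof -
  obtain B where B: "B > 0" "\<And>t x. t \<in> I \<Longrightarrow> x \<in> S \<Longrightarrow> norm (f t x) \<le> B"
    "\<And>t x y. t \<in> I \<Longrightarrow> x \<in> S \<Longrightarrow> y \<in> S \<Longrightarrow> norm (f t x - f t y) \<le> B * norm (x - y)"
    using f by (rule ulipE) blast
  obtain L where L: "\<And>x y. x \<in> {0..B} \<Longrightarrow> y \<in> {0..B} \<Longrightarrow> \<bar>\<phi> x - \<phi> y\<bar> \<le> L * \<bar>x - y\<bar>"
    using \<phi> by blast
  have L': "\<bar>\<phi> x - \<phi> y\<bar> \<le> \<bar>L\<bar> * \<bar>x - y\<bar>" if "x \<in> {0..B}" "y \<in> {0..B}" for x y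
    using L[OF that] mult_right_mono[of L "\<bar>L\<bar>" "\<bar>x - y\<bar>"] by linarith
  show ?thesis
  proof (rule ulipI)
    fix t x y assume t: "t \<in> I" and x: "x \<in> S"
    have "\<bar>\<phi> \<bar>f t x\<bar> - \<phi> 0\<bar> \<le> \<bar>L\<bar> * \<bar>\<bar>f t x\<bar> - 0\<bar>"
      by (rule L') (use B(1) B(2)[OF t x] in auto)
    also have "\<dots> \<le> \<bar>L\<bar> * B" using B(2)[OF t x] by (intro mult_left_mono) auto
    finally show "norm (\<phi> \<bar>f t x\<bar>) \<le> \<bar>\<phi> 0\<bar> + \<bar>L\<bar> * B" by simp
    assume y: "y \<in> S"
    have "\<bar>\<phi> \<bar>f t x\<bar> - \<phi> \<bar>f t y\<bar>\<bar> \<le> \<bar>L\<bar> * \<bar>\<bar>f t x\<bar> - \<bar>f t y\<bar>\<bar>"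
      by (rule L') (use B(2)[OF t x] B(2)[OF t y] in auto)
    also have "\<dots> \<le> \<bar>L\<bar> * (B * norm (x - y))"
      using B(3)[OF t x y] by (intro mult_left_mono) auto
    finally show "norm (\<phi> \<bar>f t x\<bar> - \<phi> \<bar>f t y\<bar>) \<le> (\<bar>L\<bar> * B) * norm (x - y)"
      by (simp add: mult.assoc)
  qed
qed

lemma ulip_fst: "ulip I S f \<Longrightarrow> ulip I S (\<lambda>t x. fst (f t x))"
  by (rule ulip_linear[OF bounded_linear_fst])

lemma ulip_snd: "ulip I S f \<Longrightarrow> ulip I S (\<lambda>t x. snd (f t x))"
  by (rule ulip_linear[OF bounded_linear_snd])

section \<open>Positive definite matrices and norms of rotations\<close>

lemma posdef_lower_bound:
  fixes A :: "real^'n^'n"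
  assumes "posdef A"
  obtains \<mu> where "\<mu> > 0" "\<And>x. \<mu> * (norm x)\<^sup>2 \<le> x \<bullet> (A *v x)"
proof -
  have "compact (sphere (0::real^'n) 1)" "sphere (0::real^'n) 1 \<noteq> {}" by auto
  moreover have "continuous_on (sphere 0 1) (\<lambda>x. x \<bullet> (A *v x))"
    by (intro continuous_intros linear_continuous_on) simp
  ultimately obtain u where u: "norm u = 1" "\<And>x. norm x = 1 \<Longrightarrow> u \<bullet> (A *v u) \<le> x \<bullet> (A *v x)"
    using continuous_attains_inf[of "sphere 0 1" "\<lambda>x. x \<bullet> (A *v x)"] by auto
  show ?thesis
  proof (rule that[of "u \<bullet> (A *v u)"])
    show "0 < u \<bullet> (A *v u)" using assms u(1) unfolding posdef_def by (metis norm_zero zero_neq_one)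
    fix x :: "real^'n"
    show "u \<bullet> (A *v u) * (norm x)\<^sup>2 \<le> x \<bullet> (A *v x)"
    proof (cases "x = 0")
      case False
      have "u \<bullet> (A *v u) \<le> (x /\<^sub>R norm x) \<bullet> (A *v (x /\<^sub>R norm x))"
        by (rule u(2)) (use False in simp)
      also have "\<dots> = (x \<bullet> (A *v x)) / (norm x)\<^sup>2"
        by (simp add: matrix_vector_mult.scaleR_right power2_eq_square field_simps)
      finally show ?thesis using False by (simp add: field_simps)
    qed simp
  qed
qed

lemma posdef_inverse:
  fixes A :: "real^'n^'n"
  assumes "posdef A"
  shows "A ** matrix_inv A = mat 1" "matrix_inv A ** A = mat 1"
proof -
  have "inj ((*v) A)"
  proof (rule injI)
    fix x y assume "A *v x = A *v y"
    then have "A *v (x - y) = 0" by (simp add: matrix_vector_mult_diff_distrib)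
    then show "x = y" using assms by (auto simp: posdef_def dest: spec[of _ "x - y"])
  qed
  then have "invertible A" by (simp add: invertible_left_inverse matrix_left_invertible_injective)
  then have "\<exists>B. A ** B = mat 1 \<and> B ** A = mat 1" by (simp add: invertible_def)
  from someI_ex[OF this] show "A ** matrix_inv A = mat 1" "matrix_inv A ** A = mat 1"
    by (simp_all add: matrix_inv_def)
qed

lemma continuous_on_det3:
  assumes "continuous_on S q" shows "continuous_on S (\<lambda>t. det (q t :: real^3^3))"
proof -
  have c: "continuous_on S (\<lambda>t. q t $ i $ j)" for i j
    using assms by (intro continuous_on_component)
  show ?thesis unfolding det_3
    by (intro continuous_on_add continuous_on_diff continuous_on_mult c)
qed

type_synonym state = "(real^3^3) \<times> (real^3) \<times> (real^3)"

lemma norm_rotation: "rotation_matrix (Q :: real^3^3) \<Longrightarrow> norm Q = sqrt 3"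
  using orthogonal_matrix_orthonormal_rows[of Q]
  by (auto simp: rotation_matrix_def norm_vec_def L2_set_def row_def vec_nth_inverse sum_3)

lemma norm_rotation_mult:
  assumes "rotation_matrix (R :: real^'n^'n)" shows "norm (R *v x) = norm x" "norm (transpose R *v x) = norm x"
  using assms by (auto intro!: orthogonal_transformation_norm simp: orthogonal_transformation_matrix rotation_matrix_def)

text \<open>\<open>\<phi>\<close> is the derivative of \<open>\<Phi>\<close>, and \<open>K = E W E\<^sup>T\<close>.\<close>
locale attitude_error =
  fixes UE K :: "real^3^3" and d :: "3 \<Rightarrow> real" and \<phi> \<Phi> :: "real \<Rightarrow> real" and m :: real
    and D P :: "real^3^3" and R :: "real \<Rightarrow> real^3^3" and \<Omega> :: "real \<Rightarrow> real^3"
  assumes UE: "orthogonal_matrix UE" and K: "K = UE ** diagm d ** transpose UE"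
    and d: "\<And>i. d i > 0" "inj d"
    and \<Phi>_0: "\<Phi> 0 = 0"
    and \<Phi>_deriv: "\<And>x. x \<ge> 0 \<Longrightarrow> (\<Phi> has_real_derivative \<phi> x) (at x within {0..})"
    and \<phi>_lip: "\<And>M. \<exists>L. \<forall>x\<in>{0..M}. \<forall>y\<in>{0..M}. \<bar>\<phi> x - \<phi> y\<bar> \<le> L * \<bar>x - y\<bar>"
    and \<phi>_pos: "\<And>x. x > 0 \<Longrightarrow> \<phi> x > 0"
    and m: "m > 0" and D: "posdef D" and P: "posdef P"
    and R_rot: "\<And>t. t \<ge> 0 \<Longrightarrow> rotation_matrix (R t)"
    and R_kin: "\<And>t. t \<ge> 0 \<Longrightarrow> (R has_vector_derivative R t ** skew (\<Omega> t)) (at t within {0..})"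
    and \<Omega>_cont: "continuous_on {0..} \<Omega>"
    and \<Omega>_bounded: "bounded (\<Omega> ` {0..})"
begin

text \<open>
  For rotations, \<open>U\<close> is \<open>U\<^sup>0\<close> and \<open>R\<^sup>T s\<close> is \<open>S\<^sub>L\<close> in terms of \<open>Q\<close>. The absolute value in \<open>h\<close> only
  matters for other matrices, where \<open>U\<close> may be negative and \<open>\<phi>\<close> is not controlled.
\<close>
definition U :: "real^3^3 \<Rightarrow> real" where "U Q = trace K - trace (Q ** K)"
definition s :: "real^3^3 \<Rightarrow> real^3" where "s Q = axl (K ** transpose Q)"
definition h :: "real^3^3 \<Rightarrow> real^3" where "h Q = \<phi> \<bar>U Q\<bar> *\<^sub>R s Q"

text \<open>The estimated angular velocity equals \<open>\<Omega> t + b - w\<close>; its gyroscopic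
  term loses the \<open>- w\<close> because \<open>cross3 w w = 0\<close>. The field is defined on
  the full vector space, so that ODE theory there applies; the rotations turn out to be
  invariant.\<close>

definition f :: "real \<Rightarrow> state \<Rightarrow> state" where
  "f t = (\<lambda>(Q, w, b). (skew (R t *v (w - b)) ** Q,
     - cross3 (\<Omega> t + b) w + (1 / m) *\<^sub>R (transpose (R t) *v h Q - D *v w),
     - (matrix_inv P *v (transpose (R t) *v h Q))))"

definition V :: "state \<Rightarrow> real" where
  "V = (\<lambda>(Q, w, b). \<Phi> (U Q) + m / 2 * (norm w)\<^sup>2 + (b \<bullet> (P *v b)) / 2)"

lemma K_sym: "transpose K = K"
  by (simp add: K matrix_transpose_mul matrix_mul_assoc)

lemma U_nonneg: "rotation_matrix Q \<Longrightarrow> 0 \<le> U Q"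
  using trace_gap(1)[OF UE K _ d(1)] by (simp add: U_def rotation_matrix_def)

lemma U_eq_0_iff: "rotation_matrix Q \<Longrightarrow> U Q = 0 \<longleftrightarrow> Q = mat 1"
  using trace_gap(2)[OF UE K _ d(1), of Q] by (auto simp: U_def rotation_matrix_def)

lemma bounded_linear_s: "bounded_linear s"
  unfolding s_def
  by (intro bounded_linear_compose[OF bounded_linear_axl]
      bounded_linear_compose[OF matrix_mult.bounded_linear_right] bounded_linear_transpose)

lemmas s_add = bounded_linear_s[THEN bounded_linear.linear, THEN linear_add]
  and s_diff = bounded_linear_s[THEN bounded_linear.linear, THEN linear_diff]
  and s_neg = bounded_linear_s[THEN bounded_linear.linear, THEN linear_neg]
  and s_scaleR = bounded_linear_s[THEN bounded_linear.linear, THEN linear_cmul]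
  and s_zero = bounded_linear_s[THEN bounded_linear.linear, THEN linear_0]
  and s_continuous_on = bounded_linear.continuous_on[OF bounded_linear_s]
  and s_has_vector_derivative = bounded_linear.has_vector_derivative[OF bounded_linear_s]
  and s_pos_bounded = bounded_linear.pos_bounded[OF bounded_linear_s]
  and s_tendsto = bounded_linear.tendsto[OF bounded_linear_s]

lemma ulip_h: "ulip I S q \<Longrightarrow> ulip I S (\<lambda>t x. h (q t x))"
  unfolding h_def U_def
  by (intro ulip_bilinear[OF bounded_bilinear_scaleR] ulip_compose[OF \<phi>_lip] ulip_diff ulip_const
      ulip_linear[OF bounded_linear_trace] ulip_bilinear[OF bounded_bilinear_matrix_mult]
      ulip_linear[OF bounded_linear_s])

lemma R_bounded: "bounded (R ` {0..})"
  using norm_rotation[OF R_rot] by (auto simp: bounded_iff intro!: exI[of _ "sqrt 3"])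

text \<open>The constant does not depend on time, since \<open>R\<close> and \<open>\<Omega>\<close>
  are bounded; this later bounds the speed of a trajectory for all times.\<close>

lemma f_ulip:
  assumes "bounded S"
  shows "ulip {0..} S f"
proof -
  have "ulip {0..} S (\<lambda>t z. (skew (R t *v (fst (snd z) - snd (snd z))) ** fst z,
     - cross3 (\<Omega> t + snd (snd z)) (fst (snd z)) + (1 / m) *\<^sub>R (transpose (R t) *v h (fst z) - D *v fst (snd z)),
     - (matrix_inv P *v (transpose (R t) *v h (fst z)))))"
    by (intro ulip_Pair ulip_minus ulip_add ulip_diff ulip_h
        ulip_bilinear[OF bounded_bilinear_matrix_mult] ulip_bilinear[OF bounded_bilinear_matrix_vector_mult]
        ulip_bilinear[OF bounded_bilinear_cross3] ulip_bilinear[OF bounded_bilinear_scaleR]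
        ulip_linear[OF bounded_linear_skew] ulip_linear[OF bounded_linear_transpose]
        ulip_fst ulip_snd ulip_id ulip_const ulip_param R_bounded \<Omega>_bounded assms)
  then show ?thesis by (simp add: f_def[abs_def] case_prod_beta')
qed

lemma R_cont: "continuous_on {0..} R"
  using R_kin by (intro continuous_on_vector_derivative) auto

lemma \<phi>_cont: "continuous_on {0..} \<phi>"
proof (rule continuous_on_subset[OF _ subset_refl], unfold continuous_on_def, intro ballI)
  fix x :: real assume x: "x \<in> {0..}"
  obtain L where L: "\<forall>y\<in>{0..x+1}. \<forall>z\<in>{0..x+1}. \<bar>\<phi> y - \<phi> z\<bar> \<le> L * \<bar>y - z\<bar>"
    using \<phi>_lip by blast
  have "continuous_on {0..x+1} \<phi>"
  proof (rule lipschitz_on_continuous_on[of "max 0 L"], rule lipschitz_onI)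
    fix y z assume "y \<in> {0..x+1}" "z \<in> {0..x+1}"
    then have "\<bar>\<phi> y - \<phi> z\<bar> \<le> L * \<bar>y - z\<bar>" using L by blast
    also have "\<dots> \<le> max 0 L * \<bar>y - z\<bar>" by (intro mult_right_mono) auto
    finally show "dist (\<phi> y) (\<phi> z) \<le> max 0 L * dist y z" by (simp add: dist_real_def)
  qed simp
  then have "(\<phi> \<longlongrightarrow> \<phi> x) (at x within {0..x+1})"
    using x by (auto simp: continuous_on_def)
  moreover have "at x within {0..x+1} = at x within {0..}"
    by (rule at_within_nhd[where S = "{..<x+1}"]) auto
  ultimately show "(\<phi> \<longlongrightarrow> \<phi> x) (at x within {0..})" by simp
qed

lemma U_cont: "continuous_on S U"
  unfolding U_def
  by (intro continuous_intros linear_continuous_on bounded_linear_compose[OF bounded_linear_trace]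
      matrix_mult.bounded_linear_left)

lemma s_cont: "continuous_on S s"
  by (rule linear_continuous_on[OF bounded_linear_s])

lemma h_cont: "continuous_on S h"
  unfolding h_def
  by (intro continuous_intros continuous_on_compose2[OF \<phi>_cont] U_cont s_cont) auto

lemma f_cont:
  assumes "continuous_on S \<theta>" "\<theta> ` S \<subseteq> {0..}" "continuous_on S z"
  shows "continuous_on S (\<lambda>t. f (\<theta> t) (z t))"
proof -
  have [continuous_intros]: "continuous_on S (\<lambda>t. R (\<theta> t))" "continuous_on S (\<lambda>t. \<Omega> (\<theta> t))"
    using assms by (auto intro: continuous_on_compose2[OF R_cont] continuous_on_compose2[OF \<Omega>_cont])
  show ?thesis
    unfolding f_def case_prod_beta'
    by (intro continuous_on_Pair continuous_intros matrix_mult.continuous_on matrix_vector_mult.continuous_on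
        cross3.continuous_on skew_continuous_on
        transpose_continuous_on
        continuous_on_compose2[OF h_cont[of UNIV]] assms) auto
qed


abbreviation X :: "state set" where "X \<equiv> {Q. rotation_matrix Q} \<times> UNIV"

lemma f_fst: "fst (f t z) = skew (R t *v (fst (snd z) - snd (snd z))) ** fst z"
  and f_snd: "fst (snd (f t z)) = - cross3 (\<Omega> t + snd (snd z)) (fst (snd z)) + (1 / m) *\<^sub>R (transpose (R t) *v h (fst z) - D *v fst (snd z))"
  and f_thd: "snd (snd (f t z)) = - (matrix_inv P *v (transpose (R t) *v h (fst z)))"
  by (simp_all add: f_def case_prod_beta')

text \<open>The sign \<open>sg\<close> and the clock \<open>\<theta>\<close> cover the equation itself and its time reversal.\<close>
definition sol :: "real \<Rightarrow> (real \<Rightarrow> real) \<Rightarrow> real set \<Rightarrow> (real \<Rightarrow> state) \<Rightarrow> bool" where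
  "sol sg \<theta> S z \<longleftrightarrow> (\<forall>t\<in>S. (z has_vector_derivative sg *\<^sub>R f (\<theta> t) (z t)) (at t within S))"

lemma sol_subset: "sol sg \<theta> S z \<Longrightarrow> T \<subseteq> S \<Longrightarrow> sol sg \<theta> T z"
  unfolding sol_def by (blast intro: has_vector_derivative_within_subset)

lemma sol_components:
  assumes "sol sg \<theta> S z" "t \<in> S"
  shows "((\<lambda>t. fst (z t)) has_vector_derivative sg *\<^sub>R fst (f (\<theta> t) (z t))) (at t within S)"
    and "((\<lambda>t. fst (snd (z t))) has_vector_derivative sg *\<^sub>R fst (snd (f (\<theta> t) (z t)))) (at t within S)"
    and "((\<lambda>t. snd (snd (z t))) has_vector_derivative sg *\<^sub>R snd (snd (f (\<theta> t) (z t)))) (at t within S)"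
proof -
  have z: "(z has_vector_derivative sg *\<^sub>R f (\<theta> t) (z t)) (at t within S)"
    using assms by (simp add: sol_def)
  show "((\<lambda>t. fst (z t)) has_vector_derivative sg *\<^sub>R fst (f (\<theta> t) (z t))) (at t within S)"
    using bounded_linear.has_vector_derivative[OF bounded_linear_fst z] by simp
  note z2 = bounded_linear.has_vector_derivative[OF bounded_linear_snd z]
  show "((\<lambda>t. fst (snd (z t))) has_vector_derivative sg *\<^sub>R fst (snd (f (\<theta> t) (z t)))) (at t within S)"
    using bounded_linear.has_vector_derivative[OF bounded_linear_fst z2] by simp
  show "((\<lambda>t. snd (snd (z t))) has_vector_derivative sg *\<^sub>R snd (snd (f (\<theta> t) (z t)))) (at t within S)"
    using bounded_linear.has_vector_derivative[OF bounded_linear_snd z2] by simp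
qed

lemma sol_continuous: "sol sg \<theta> S z \<Longrightarrow> continuous_on S z"
  unfolding sol_def by (rule continuous_on_vector_derivative) auto

text \<open>A skew generator keeps \<open>transpose Q ** Q\<close> constant in either time
  direction. The determinant is then continuous with values in 1 and -1, so it cannot leave 1
  without crossing 0.\<close>

lemma sol_rotation:
  assumes z: "sol sg \<theta> {0..T} z" and T: "0 \<le> T" and z0: "z 0 \<in> X"
  shows "z T \<in> X"
proof -
  let ?Q = "\<lambda>t. fst (z t)"
  let ?A = "\<lambda>t. skew (R (\<theta> t) *v (fst (snd (z t)) - snd (snd (z t))))"
  have d0: "((\<lambda>t. transpose (?Q t) ** ?Q t) has_vector_derivative 0) (at t within {0..T})" if t: "t \<in> {0..T}" for t
  proof -
    have 1: "(?Q has_vector_derivative sg *\<^sub>R (?A t ** ?Q t)) (at t within {0..T})"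
      using sol_components(1)[OF z t] by (simp add: f_fst)
    have "((\<lambda>t. transpose (?Q t) ** ?Q t) has_vector_derivative
        transpose (?Q t) ** (sg *\<^sub>R (?A t ** ?Q t)) + transpose (sg *\<^sub>R (?A t ** ?Q t)) ** ?Q t) (at t within {0..T})"
      by (intro matrix_mult.has_vector_derivative transpose_has_vector_derivative 1)
    also have "transpose (?Q t) ** (sg *\<^sub>R (?A t ** ?Q t)) + transpose (sg *\<^sub>R (?A t ** ?Q t)) ** ?Q t = 0"
      by (simp add: transpose_scaleR matrix_transpose_mul transpose_skew
          matrix_mult.scaleR_left matrix_mult.scaleR_right matrix_mult.minus_left matrix_mult.minus_right matrix_mul_assoc)
    finally show ?thesis .
  qed
  obtain c where "\<And>t. t \<in> {0..T} \<Longrightarrow> transpose (?Q t) ** ?Q t = c"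
    by (rule has_vector_derivative_zero_constant[OF convex_real_interval(5) d0]) blast+
  then have "transpose (?Q t) ** ?Q t = mat 1" if "t \<in> {0..T}" for t
    using that z0 T by (force simp: rotation_matrix_def orthogonal_matrix)
  then have orth: "orthogonal_matrix (?Q t)" if "t \<in> {0..T}" for t
    using that by (simp add: orthogonal_matrix)
  have "det (?Q T) = 1"
  proof (rule ccontr)
    assume "det (?Q T) \<noteq> 1"
    then have n: "det (?Q T) = -1" using det_orthogonal_matrix[OF orth[of T]] T by auto
    have Qc: "continuous_on {0..T} ?Q"
      by (intro continuous_intros sol_continuous[OF z])
    have "continuous_on {0..T} (\<lambda>t. det (?Q t))"
      by (rule continuous_on_det3[OF Qc])
    moreover have "det (?Q 0) = 1" using z0 by (cases "z 0") (simp add: rotation_matrix_def)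
    ultimately have "\<exists>t\<ge>0. t \<le> T \<and> det (?Q t) = 0"
      using T n by (intro IVT2') simp_all
    then obtain t where "t \<in> {0..T}" "det (?Q t) = 0" by auto
    then show False using det_orthogonal_matrix[OF orth[of t]] by auto
  qed
  then show ?thesis using orth[of T] T by (cases "z T") (auto simp: rotation_matrix_def)
qed

lemma sol_in_X: "sol sg \<theta> {0..T} z \<Longrightarrow> z 0 \<in> X \<Longrightarrow> t \<in> {0..T} \<Longrightarrow> z t \<in> X"
  by (rule sol_rotation[of sg \<theta> t]) (auto intro: sol_subset)

text \<open>With tangent vectors written as \<open>skew a ** Q\<close>, this makes \<open>s\<close>
  minus the gradient of \<open>U\<close>; the sign arises because \<open>s\<close> is built from the
  transpose of \<open>Q ** K\<close>.\<close>

lemma U_has_derivative: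
  assumes "(Q has_vector_derivative sg *\<^sub>R (skew a ** Q t)) (at t within S)"
  shows "((\<lambda>t. U (Q t)) has_real_derivative - sg * (a \<bullet> s (Q t))) (at t within S)"
proof -
  have "((\<lambda>t. trace K - trace (Q t ** K)) has_vector_derivative 0 - trace (sg *\<^sub>R (skew a ** Q t) ** K)) (at t within S)"
    by (intro has_vector_derivative_diff has_vector_derivative_const
        trace_has_vector_derivative
        bounded_linear.has_vector_derivative[OF matrix_mult.bounded_linear_left] assms)
  also have "0 - trace (sg *\<^sub>R (skew a ** Q t) ** K) = sg * (a \<bullet> axl (Q t ** K))"
    by (simp add: matrix_mult.scaleR_left trace_scaleR
        trace_skew_mult flip: matrix_mul_assoc)
  also have "axl (Q t ** K) = - s (Q t)"
  proof -
    have "Q t ** K = transpose (K ** transpose (Q t))" by (simp add: matrix_transpose_mul K_sym)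
    moreover have "axl (transpose M) = - axl M" for M by (simp add: matrix3_simps)
    ultimately show ?thesis unfolding s_def by metis
  qed
  finally show ?thesis
    by (simp add: has_real_derivative_iff_has_vector_derivative U_def)
qed

text \<open>With \<open>y = transpose (R t) *v h Q\<close>, the potential contributes
  \<open>- (w - b) \<bullet> y\<close>, the kinetic part \<open>w \<bullet> y\<close> and the bias
  part \<open>- b \<bullet> y\<close>; these cancel, the gyroscopic term is orthogonal to
  \<open>w\<close>, and only the damping remains. Membership in \<open>X\<close> keeps
  \<open>U\<close> in the half-line on which \<open>\<Phi>\<close> is differentiated.\<close>

lemma V_has_derivative:
  assumes z: "sol sg \<theta> S z" and t: "t \<in> S" and rot: "\<And>t. t \<in> S \<Longrightarrow> z t \<in> X"
    and \<theta>: "\<theta> t \<ge> 0"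
  shows "((\<lambda>t. V (z t)) has_real_derivative - sg * (fst (snd (z t)) \<bullet> (D *v fst (snd (z t))))) (at t within S)"
proof -
  define Q w b where "Q = (\<lambda>t. fst (z t))" and "w = (\<lambda>t. fst (snd (z t)))" and "b = (\<lambda>t. snd (snd (z t)))"
  define a where "a = R (\<theta> t) *v (w t - b t)"
  define y where "y = transpose (R (\<theta> t)) *v h (Q t)"
  have Q': "(Q has_vector_derivative sg *\<^sub>R (skew a ** Q t)) (at t within S)"
    using sol_components(1)[OF z t] by (simp add: f_fst Q_def w_def b_def a_def)
  have w': "(w has_vector_derivative sg *\<^sub>R (- cross3 (\<Omega> (\<theta> t) + b t) (w t) + (1 / m) *\<^sub>R (y - D *v w t))) (at t within S)"
    using sol_components(2)[OF z t] by (simp add: f_snd Q_def w_def b_def y_def)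
  have b': "(b has_vector_derivative sg *\<^sub>R (- (matrix_inv P *v y))) (at t within S)"
    using sol_components(3)[OF z t] by (simp add: f_thd Q_def w_def b_def y_def)
  have U0: "U (Q t) \<ge> 0" if "t \<in> S" for t
    using rot[OF that] by (intro U_nonneg) (auto simp: Q_def)
  have 1: "((\<lambda>t. \<Phi> (U (Q t))) has_real_derivative \<phi> (U (Q t)) * (- sg * (a \<bullet> s (Q t)))) (at t within S)"
  proof -
    have "(\<Phi> has_real_derivative \<phi> (U (Q t))) (at (U (Q t)) within (\<lambda>t. U (Q t)) ` S)"
      by (rule DERIV_subset[OF \<Phi>_deriv]) (use U0 t in auto)
    from DERIV_image_chain[OF this U_has_derivative[OF Q']] show ?thesis by (simp add: o_def)
  qed
  have 2: "((\<lambda>t. m / 2 * (norm (w t))\<^sup>2) has_real_derivative m / 2 * (2 * (w t \<bullet> (sg *\<^sub>R (- cross3 (\<Omega> (\<theta> t) + b t) (w t) + (1 / m) *\<^sub>R (y - D *v w t)))))) (at t within S)"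
    by (intro DERIV_cmult norm_has_real_derivative_power2 w')
  have 3: "((\<lambda>t. (b t \<bullet> (P *v b t)) / 2) has_real_derivative
      (b t \<bullet> (P *v (sg *\<^sub>R (- (matrix_inv P *v y)))) + (sg *\<^sub>R (- (matrix_inv P *v y))) \<bullet> (P *v b t)) / 2) (at t within S)"
    unfolding has_real_derivative_iff_has_vector_derivative divide_inverse
    by (intro has_vector_derivative_mult_left bounded_bilinear.has_vector_derivative[OF bounded_bilinear_inner] b'
        bounded_linear.has_vector_derivative[OF matrix_vector_mult.bounded_linear_right])
  have P1: "P *v (matrix_inv P *v y) = y"
    by (simp add: matrix_vector_mul_assoc posdef_inverse[OF P])
  have P2: "(matrix_inv P *v y) \<bullet> (P *v b t) = y \<bullet> b t"
  proof -
    have "(matrix_inv P *v y) \<bullet> (P *v b t) = (transpose P *v (matrix_inv P *v y)) \<bullet> b t"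
      by (simp add: dot_lmul_matrix transpose_matrix_vector)
    then show ?thesis using P P1 by (simp add: posdef_def)
  qed
  have 4: "a \<bullet> h (Q t) = (w t - b t) \<bullet> y"
    unfolding a_def y_def transpose_matrix_vector
    by (subst (1 2) inner_commute) (simp add: dot_lmul_matrix)
  have "\<phi> (U (Q t)) * (- sg * (a \<bullet> s (Q t))) + m / 2 * (2 * (w t \<bullet> (sg *\<^sub>R (- cross3 (\<Omega> (\<theta> t) + b t) (w t) + (1 / m) *\<^sub>R (y - D *v w t)))))
     + (b t \<bullet> (P *v (sg *\<^sub>R (- (matrix_inv P *v y)))) + (sg *\<^sub>R (- (matrix_inv P *v y))) \<bullet> (P *v b t)) / 2
     = - sg * (a \<bullet> h (Q t)) + sg * (w t \<bullet> y - w t \<bullet> (D *v w t)) - sg * (b t \<bullet> y)"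
    using m U0[OF t]
    by (simp add: h_def P1 P2 matrix_vector_mult.scaleR_right matrix_vector_mult.minus_right inner_add_right inner_diff_right
        dot_cross_self inner_commute[of y] field_simps)
  also have "\<dots> = - sg * (w t \<bullet> (D *v w t))"
    unfolding 4 by (simp add: inner_diff_left algebra_simps)
  finally have eq: "\<phi> (U (Q t)) * (- sg * (a \<bullet> s (Q t))) + m / 2 * (2 * (w t \<bullet> (sg *\<^sub>R (- cross3 (\<Omega> (\<theta> t) + b t) (w t) + (1 / m) *\<^sub>R (y - D *v w t)))))
     + (b t \<bullet> (P *v (sg *\<^sub>R (- (matrix_inv P *v y)))) + (sg *\<^sub>R (- (matrix_inv P *v y))) \<bullet> (P *v b t)) / 2 = - sg * (w t \<bullet> (D *v w t))" .
  show ?thesis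
    using DERIV_add[OF DERIV_add[OF 1 2] 3] unfolding eq
    by (simp add: V_def case_prod_beta' Q_def w_def b_def)
qed

section \<open>Bounds derived from the energy\<close>

lemma \<Phi>_mono: "0 \<le> x \<Longrightarrow> x \<le> y \<Longrightarrow> \<Phi> x \<le> \<Phi> y"
proof -
  assume xy: "0 \<le> x" "x \<le> y"
  \<comment> \<open>\<open>\<phi>\<close> is assumed positive only for positive arguments;
    continuity gives the sign at 0.\<close>
  have "\<phi> 0 \<ge> 0"
  proof -
    have "(\<phi> \<longlongrightarrow> \<phi> 0) (at 0 within {0..})" using \<phi>_cont by (simp add: continuous_on_def)
    then have "(\<phi> \<longlongrightarrow> \<phi> 0) (at_right 0)" by (rule tendsto_within_subset) auto
    then show ?thesis
      by (rule tendsto_lowerbound) (auto simp: eventually_at_filter intro!: always_eventually less_imp_le \<phi>_pos)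
  qed
  then have nonneg: "\<phi> y \<ge> 0" if "y \<ge> 0" for y
    using \<phi>_pos[of y] that by (cases "y = 0") auto
  show ?thesis
  proof (rule mono_of_deriv_nonneg[OF xy(2)])
    fix t assume t: "t \<in> {x..y}"
    show "(\<Phi> has_real_derivative \<phi> t) (at t within {x..y})"
      by (rule DERIV_subset[OF \<Phi>_deriv]) (use t xy in auto)
    show "0 \<le> \<phi> t" by (rule nonneg) (use t xy in auto)
  qed
qed

lemma \<Phi>_pos: "0 < x \<Longrightarrow> 0 < \<Phi> x"
proof -
  assume x: "0 < x"
  have "\<exists>y\<in>{0<..<x}. \<Phi> x - \<Phi> 0 = (\<lambda>h. \<phi> y * h) (x - 0)"
  proof (rule mvt_simple[OF x])
    fix y assume "0 \<le> y" "y \<le> x"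
    then have "(\<Phi> has_real_derivative \<phi> y) (at y within {0..x})"
      by (intro DERIV_subset[OF \<Phi>_deriv]) auto
    then show "(\<Phi> has_derivative (\<lambda>h. \<phi> y * h)) (at y within {0..x})"
      by (simp add: has_field_derivative_def)
  qed
  then obtain y where "0 < y" "\<Phi> x = \<phi> y * x" by (auto simp: \<Phi>_0)
  then show ?thesis using x \<phi>_pos[of y] by (metis mult_pos_pos)
qed

lemma V_lower:
  obtains p where "p > 0" "\<And>z. z \<in> X \<Longrightarrow> \<Phi> (U (fst z)) + m / 2 * (norm (fst (snd z)))\<^sup>2 + p * (norm (snd (snd z)))\<^sup>2 \<le> V z"
    "\<And>z. z \<in> X \<Longrightarrow> 0 \<le> \<Phi> (U (fst z))"
proof -
  obtain p where p: "p > 0" "\<And>x. p * (norm x)\<^sup>2 \<le> x \<bullet> (P *v x)"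
    using posdef_lower_bound[OF P] by blast
  show ?thesis
  proof (rule that[of "p / 2"])
    fix z assume z: "z \<in> X"
    show "\<Phi> (U (fst z)) + m / 2 * (norm (fst (snd z)))\<^sup>2 + p / 2 * (norm (snd (snd z)))\<^sup>2 \<le> V z"
      using p(2)[of "snd (snd z)"] by (simp add: V_def case_prod_beta')
    show "0 \<le> \<Phi> (U (fst z))"
      using \<Phi>_mono[of 0 "U (fst z)"] U_nonneg[of "fst z"] z by (auto simp: \<Phi>_0)
  qed (use p in simp)
qed

lemma V_nonneg: "z \<in> X \<Longrightarrow> 0 \<le> V z"
proof -
  assume z: "z \<in> X"
  obtain p where "p > 0" "\<And>z. z \<in> X \<Longrightarrow> \<Phi> (U (fst z)) + m / 2 * (norm (fst (snd z)))\<^sup>2 + p * (norm (snd (snd z)))\<^sup>2 \<le> V z"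
    "\<And>z. z \<in> X \<Longrightarrow> 0 \<le> \<Phi> (U (fst z))" by (rule V_lower) blast
  then show ?thesis using z m
    by (smt (verit) mult_nonneg_nonneg zero_le_power2 divide_nonneg_nonneg)
qed

lemma V_sublevel_bounded:
  obtains r where "r > 0" "\<And>z. z \<in> X \<Longrightarrow> V z \<le> c \<Longrightarrow> norm z < r"
proof -
  obtain p where p: "p > 0" "\<And>z. z \<in> X \<Longrightarrow> \<Phi> (U (fst z)) + m / 2 * (norm (fst (snd z)))\<^sup>2 + p * (norm (snd (snd z)))\<^sup>2 \<le> V z"
    "\<And>z. z \<in> X \<Longrightarrow> 0 \<le> \<Phi> (U (fst z))" by (rule V_lower) blast
  define r where "r = sqrt 3 + sqrt (2 * \<bar>c\<bar> / m) + sqrt (\<bar>c\<bar> / p) + 1"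
  show ?thesis
  proof (rule that[of r])
    show "r > 0" using m p(1) by (auto simp: r_def intro!: add_nonneg_pos)
    fix z assume z: "z \<in> X" and c: "V z \<le> c"
    have "m / 2 * (norm (fst (snd z)))\<^sup>2 \<ge> 0" "p * (norm (snd (snd z)))\<^sup>2 \<ge> 0" using m p(1) by auto
    then have "m / 2 * (norm (fst (snd z)))\<^sup>2 \<le> \<bar>c\<bar>" "p * (norm (snd (snd z)))\<^sup>2 \<le> \<bar>c\<bar>"
      using p(2,3)[OF z] c by linarith+
    then have "(norm (fst (snd z)))\<^sup>2 \<le> 2 * \<bar>c\<bar> / m" "(norm (snd (snd z)))\<^sup>2 \<le> \<bar>c\<bar> / p"
      using m p(1) by (simp_all add: field_simps)
    then have "norm (fst (snd z)) \<le> sqrt (2 * \<bar>c\<bar> / m)" "norm (snd (snd z)) \<le> sqrt (\<bar>c\<bar> / p)"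
      by (simp_all add: real_le_rsqrt)
    moreover have "norm (fst z) = sqrt 3" using z by (intro norm_rotation) auto
    moreover have "norm z \<le> norm (fst z) + (norm (fst (snd z)) + norm (snd (snd z)))"
      using norm_Pair_le[of "fst z" "snd z"] norm_Pair_le[of "fst (snd z)" "snd (snd z)"] by simp
    ultimately show "norm z < r" by (simp add: r_def)
  qed
qed

text \<open>Backward in time \<open>V\<close> grows, but at most exponentially, because the damping
  is at most \<open>k\<close> times the kinetic part of \<open>V\<close>. One bound for both
  directions is the a priori estimate behind existence.\<close>

lemma V_growth:
  obtains k where "k > 0" "\<And>sg \<theta> T z. \<lbrakk>\<bar>sg\<bar> = 1; sol sg \<theta> {0..T} z; 0 \<le> T; z 0 \<in> X; \<And>t. t \<in> {0..T} \<Longrightarrow> 0 \<le> \<theta> t\<rbrakk>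
    \<Longrightarrow> V (z T) \<le> exp (k * T) * V (z 0)"
proof -
  obtain B where B: "B > 0" "\<And>x. norm (D *v x) \<le> norm x * B"
    using matrix_vector_mult.bounded_linear_right[THEN bounded_linear.pos_bounded] by blast
  obtain p where p: "p > 0" "\<And>z. z \<in> X \<Longrightarrow> \<Phi> (U (fst z)) + m / 2 * (norm (fst (snd z)))\<^sup>2 + p * (norm (snd (snd z)))\<^sup>2 \<le> V z"
    "\<And>z. z \<in> X \<Longrightarrow> 0 \<le> \<Phi> (U (fst z))" by (rule V_lower) blast
  define k where "k = 2 * B / m"
  show ?thesis
  proof (rule that[of k])
    show "k > 0" using B(1) m by (simp add: k_def)
    fix sg T :: real and \<theta> z
    assume sg: "\<bar>sg\<bar> = 1" and z: "sol sg \<theta> {0..T} z" and T: "0 \<le> T" and z0: "z 0 \<in> X"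
      and \<theta>: "\<And>t. t \<in> {0..T} \<Longrightarrow> 0 \<le> \<theta> t"
    have "V (z T) \<le> exp (k * (T - 0)) * V (z 0)"
    proof (rule exp_upper_bound[OF T])
      fix t assume t: "t \<in> {0..T}"
      show "((\<lambda>t. V (z t)) has_real_derivative - sg * (fst (snd (z t)) \<bullet> (D *v fst (snd (z t))))) (at t within {0..T})"
        by (rule V_has_derivative[OF z t _ \<theta>[OF t]]) (rule sol_in_X[OF z z0])
      let ?w = "fst (snd (z t))"
      have "- sg * (?w \<bullet> (D *v ?w)) \<le> \<bar>?w \<bullet> (D *v ?w)\<bar>"
        using sg by (auto simp: abs_if split: if_splits)
      also have "\<dots> \<le> norm ?w * norm (D *v ?w)" by (rule Cauchy_Schwarz_ineq2)
      also have "\<dots> \<le> norm ?w * (norm ?w * B)" by (intro mult_left_mono B) simp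
      also have "\<dots> = k * (m / 2 * (norm ?w)\<^sup>2)" using m by (simp add: k_def power2_eq_square)
      also have "\<dots> \<le> k * V (z t)"
      proof (rule mult_left_mono)
        have "p * (norm (snd (snd (z t))))\<^sup>2 \<ge> 0" using p(1) by simp
        then show "m / 2 * (norm ?w)\<^sup>2 \<le> V (z t)"
          using p(2,3)[OF sol_in_X[OF z z0 t]] by linarith
      qed (use \<open>k > 0\<close> in simp)
      finally show "- sg * (?w \<bullet> (D *v ?w)) \<le> k * V (z t)" .
    qed
    then show "V (z T) \<le> exp (k * T) * V (z 0)" by simp
  qed
qed

lemma V_antimono:
  assumes z: "sol 1 \<theta> {0..} z" and z0: "z 0 \<in> X" and \<theta>: "\<And>t. 0 \<le> t \<Longrightarrow> 0 \<le> \<theta> t" and "0 \<le> t" "t \<le> u"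
  shows "V (z u) \<le> V (z t)"
proof -
  obtain p where p: "p > 0" "\<And>x. p * (norm x)\<^sup>2 \<le> x \<bullet> (D *v x)"
    using posdef_lower_bound[OF D] by blast
  have X: "z t \<in> X" if "0 \<le> t" for t
    by (rule sol_in_X[OF sol_subset[OF z, of "{0..t}"] z0]) (use that in auto)
  have "- V (z t) \<le> - V (z u)"
  proof (rule mono_of_deriv_nonneg[where g = "\<lambda>t. - V (z t)" and a = t and b = u and g' = "\<lambda>t. fst (snd (z t)) \<bullet> (D *v fst (snd (z t)))"])
    fix v assume v: "v \<in> {t..u}"
    have *: "((\<lambda>t. V (z t)) has_real_derivative - 1 * (fst (snd (z v)) \<bullet> (D *v fst (snd (z v))))) (at v within {t..u})"
      by (rule V_has_derivative[OF sol_subset[OF z] v]) (use assms X v in auto)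
    show "((\<lambda>t. - V (z t)) has_real_derivative fst (snd (z v)) \<bullet> (D *v fst (snd (z v)))) (at v within {t..u})"
      using DERIV_minus[OF *] by simp
    show "0 \<le> fst (snd (z v)) \<bullet> (D *v fst (snd (z v)))"
      using p(2)[of "fst (snd (z v))"] p(1) by (meson order_trans mult_nonneg_nonneg less_imp_le zero_le_power2)
  qed (use assms in auto)
  then show ?thesis by simp
qed

section \<open>Continuous dependence, uniqueness and existence of solutions\<close>

lemma sol_dependence:
  assumes "bounded S"
  obtains L where "L > 0" "\<And>sg \<theta> T y z. \<lbrakk>\<bar>sg\<bar> = 1; sol sg \<theta> {0..T} y; sol sg \<theta> {0..T} z; 0 \<le> T;
      \<And>t. t \<in> {0..T} \<Longrightarrow> 0 \<le> \<theta> t \<and> y t \<in> S \<and> z t \<in> S\<rbrakk>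
    \<Longrightarrow> norm (y T - z T) \<le> exp (L * T) * norm (y 0 - z 0)"
proof -
  obtain L where L: "L > 0" "\<And>t y z. \<lbrakk>t \<in> {0..}; y \<in> S; z \<in> S\<rbrakk> \<Longrightarrow> norm (f t y - f t z) \<le> L * norm (y - z)"
    using f_ulip[OF assms] by (rule ulipE) blast
  show ?thesis
  proof (rule that[OF L(1)])
    fix sg \<theta> T y z assume sg: "\<bar>sg\<bar> = 1" and y: "sol sg \<theta> {0..T} y" and z: "sol sg \<theta> {0..T} z" and T: "0 \<le> T"
      and S: "\<And>t. t \<in> {0..T} \<Longrightarrow> 0 \<le> \<theta> t \<and> y t \<in> S \<and> z t \<in> S"
    show "norm (y T - z T) \<le> exp (L * T) * norm (y 0 - z 0)"
    proof (rule ode_dependence[OF T, where f = "\<lambda>t z. sg *\<^sub>R f (\<theta> t) z"])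
      fix t assume t: "t \<in> {0..T}"
      show "norm (sg *\<^sub>R f (\<theta> t) (y t) - sg *\<^sub>R f (\<theta> t) (z t)) \<le> L * norm (y t - z t)"
        using L(2)[of "\<theta> t" "y t" "z t"] S[OF t] sg by (simp flip: scaleR_diff_right)
    qed (use y z in \<open>auto simp: sol_def\<close>)
  qed
qed

lemma sol_unique:
  assumes sg: "\<bar>sg\<bar> = 1" and y: "sol sg \<theta> {0..T} y" and z: "sol sg \<theta> {0..T} z" and T: "0 \<le> T"
    and \<theta>: "\<And>t. t \<in> {0..T} \<Longrightarrow> 0 \<le> \<theta> t" and eq: "y 0 = z 0"
  shows "y T = z T"
proof -
  have "bounded (y ` {0..T} \<union> z ` {0..T})"
    by (auto intro!: compact_imp_bounded compact_continuous_image sol_continuous y z)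
  then obtain L where "\<And>sg \<theta> T' u v. \<lbrakk>\<bar>sg\<bar> = 1; sol sg \<theta> {0..T'} u; sol sg \<theta> {0..T'} v; 0 \<le> T';
      \<And>t. t \<in> {0..T'} \<Longrightarrow> 0 \<le> \<theta> t \<and> u t \<in> y ` {0..T} \<union> z ` {0..T} \<and> v t \<in> y ` {0..T} \<union> z ` {0..T}\<rbrakk>
    \<Longrightarrow> norm (u T' - v T') \<le> exp (L * T') * norm (u 0 - v 0)"
    by (rule sol_dependence) blast
  from this[OF sg y z T] show ?thesis using \<theta> eq by auto
qed

text \<open>The exponential bound on \<open>V\<close> confines every solution on
  \<open>{0..T}\<close> to a ball fixed by \<open>T\<close> and \<open>x\<close>, and there the
  field is Lipschitz. The clock is any continuous nonnegative function, so reversed time is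
  covered.\<close>

lemma sol_exists:
  assumes sg: "\<bar>sg\<bar> = 1" and T: "0 \<le> T" and x: "x \<in> X"
    and \<theta>: "continuous_on {0..T} \<theta>" "\<And>t. t \<in> {0..T} \<Longrightarrow> 0 \<le> \<theta> t"
  obtains z where "z 0 = x" "sol sg \<theta> {0..T} z"
proof -
  obtain k where k: "k > 0" "\<And>sg \<theta> T z. \<lbrakk>\<bar>sg\<bar> = 1; sol sg \<theta> {0..T} z; 0 \<le> T; z 0 \<in> X; \<And>t. t \<in> {0..T} \<Longrightarrow> 0 \<le> \<theta> t\<rbrakk>
    \<Longrightarrow> V (z T) \<le> exp (k * T) * V (z 0)"
    using V_growth by blast
  obtain r where r: "r > 0" "\<And>z. z \<in> X \<Longrightarrow> V z \<le> exp (k * T) * V x \<Longrightarrow> norm z < r"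
    by (rule V_sublevel_bounded) blast
  obtain L where L: "L > 0" "\<And>t y z. \<lbrakk>t \<in> {0..}; y \<in> cball 0 r; z \<in> cball 0 r\<rbrakk> \<Longrightarrow> norm (f t y - f t z) \<le> L * norm (y - z)"
    using f_ulip[OF bounded_cball[of 0 r]] by (rule ulipE) blast
  have apriori: "norm (z \<tau>) < r" if \<tau>: "\<tau> \<in> {0..T}" and z0: "z 0 = x" and z: "sol sg \<theta> {0..\<tau>} z" for \<tau> z
  proof (rule r(2))
    show "z \<tau> \<in> X" by (rule sol_in_X[OF z]) (use z0 x \<tau> in auto)
    have "V (z \<tau>) \<le> exp (k * \<tau>) * V (z 0)"
      by (rule k(2)[OF sg z]) (use \<tau> z0 x \<theta> in auto)
    also have "\<dots> \<le> exp (k * T) * V x"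
      unfolding z0 using \<tau> k(1) V_nonneg[OF x] by (intro mult_right_mono) auto
    finally show "V (z \<tau>) \<le> exp (k * T) * V x" .
  qed
  show ?thesis
  proof (rule ode_exists_bounded[of T x r L "\<lambda>t z. sg *\<^sub>R f (\<theta> t) z"])
    have "1 * V x \<le> exp (k * T) * V x"
      using T k(1) V_nonneg[OF x] by (intro mult_right_mono) auto
    then show "norm x < r" by (intro r(2) x) simp
  next
    fix t and y z :: state assume "t \<in> {0..T}" "y \<in> cball 0 r" "z \<in> cball 0 r"
    then show "norm (sg *\<^sub>R f (\<theta> t) y - sg *\<^sub>R f (\<theta> t) z) \<le> L * norm (y - z)"
      using L(2)[of "\<theta> t" y z] \<theta> sg by (simp flip: scaleR_diff_right)
  next
    fix z :: "real \<Rightarrow> state" assume "continuous_on {0..T} z"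
    then show "continuous_on {0..T} (\<lambda>t. sg *\<^sub>R f (\<theta> t) (z t))"
      using \<theta> by (intro continuous_intros f_cont) auto
  next
    fix \<tau> z assume "\<tau> \<in> {0..T}" "z 0 = x" "\<And>t. t \<in> {0..\<tau>} \<Longrightarrow> (z has_vector_derivative sg *\<^sub>R f (\<theta> t) (z t)) (at t within {0..\<tau>})"
    then show "norm (z \<tau>) < r" by (intro apriori) (auto simp: sol_def)
  next
    fix z assume "z 0 = x" "\<And>t. t \<in> {0..T} \<Longrightarrow> (z has_vector_derivative sg *\<^sub>R f (\<theta> t) (z t)) (at t within {0..T})"
    then show thesis by (intro that[of z]) (auto simp: sol_def)
  qed (use T L in auto)
qed

abbreviation fsol :: "(real \<Rightarrow> state) \<Rightarrow> bool" where
  "fsol z \<equiv> sol 1 (\<lambda>t. t) {0..} z"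

lemma fsol_exists:
  assumes x: "x \<in> X"
  obtains z where "z 0 = x" "fsol z"
proof (rule ode_glue[where f = "\<lambda>t z. 1 *\<^sub>R f t z" and ?x0.0 = x])
  fix T :: real assume T: "0 \<le> T"
  obtain z where "z 0 = x" "sol 1 (\<lambda>t. t) {0..T} z"
    by (rule sol_exists[of 1 T x "\<lambda>t. t"]) (use T x in auto)
  then show "\<exists>y. y 0 = x \<and> (\<forall>t\<in>{0..T}. (y has_vector_derivative 1 *\<^sub>R f t (y t)) (at t within {0..T}))"
    by (auto simp: sol_def)
next
  fix T :: real and y z :: "real \<Rightarrow> state"
  assume T: "0 \<le> T" and "y 0 = x" "z 0 = x"
    and y: "\<forall>t\<in>{0..T}. (y has_vector_derivative 1 *\<^sub>R f t (y t)) (at t within {0..T})"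
    and z: "\<forall>t\<in>{0..T}. (z has_vector_derivative 1 *\<^sub>R f t (z t)) (at t within {0..T})"
  show "y T = z T"
  proof (rule sol_unique)
    show "sol 1 (\<lambda>t. t) {0..T} y" "sol 1 (\<lambda>t. t) {0..T} z" using y z by (simp_all add: sol_def)
  qed (use T \<open>y 0 = x\<close> \<open>z 0 = x\<close> in auto)
next
  fix y :: "real \<Rightarrow> state"
  assume "y 0 = x" "\<And>t. 0 \<le> t \<Longrightarrow> (y has_vector_derivative 1 *\<^sub>R f t (y t)) (at t within {0..})"
  then show thesis by (intro that[of y]) (auto simp: sol_def)
qed

lemma fsol_in_X: "fsol z \<Longrightarrow> z 0 \<in> X \<Longrightarrow> 0 \<le> t \<Longrightarrow> z t \<in> X"
  by (rule sol_in_X[OF sol_subset[of _ _ "{0..}" _ "{0..t}"]]) auto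

lemma fsol_unique: "fsol y \<Longrightarrow> fsol z \<Longrightarrow> y 0 = z 0 \<Longrightarrow> 0 \<le> t \<Longrightarrow> y t = z t"
  by (rule sol_unique[of 1 "\<lambda>t. t" t]) (auto intro: sol_subset)

lemma fsol_V_antimono: "fsol z \<Longrightarrow> z 0 \<in> X \<Longrightarrow> 0 \<le> t \<Longrightarrow> t \<le> u \<Longrightarrow> V (z u) \<le> V (z t)"
  using V_antimono[of "\<lambda>t. t" z t u] by simp

end

subsection \<open>Convergence to the critical points\<close>

lemma uniformly_continuous_of_bounded_deriv:
  fixes y :: "real \<Rightarrow> 'a::real_normed_vector"
  assumes "\<And>t. 0 \<le> t \<Longrightarrow> (y has_vector_derivative y' t) (at t within {0..})"
    and "\<And>t. 0 \<le> t \<Longrightarrow> norm (y' t) \<le> B" and "0 \<le> B"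
  shows "uniformly_continuous_on {0..} y"
proof (rule lipschitz_on_uniformly_continuous, rule lipschitz_onI)
  fix t u :: real assume tu: "t \<in> {0..}" "u \<in> {0..}"
  have "norm (y t - y u) \<le> B * norm (t - u)"
  proof (rule differentiable_bound[where S = "{0..}" and f' = "\<lambda>t h. h *\<^sub>R y' t"])
    fix x :: real assume x: "x \<in> {0..}"
    show "(y has_derivative (\<lambda>h. h *\<^sub>R y' x)) (at x within {0..})"
      using assms(1) x by (simp add: has_vector_derivative_def)
    have "norm (h *\<^sub>R y' x) \<le> B * norm h" for h
      using assms(2)[of x] x by (simp add: mult.commute[of B] mult_left_mono)
    then show "onorm (\<lambda>h. h *\<^sub>R y' x) \<le> B" by (rule onorm_le)
  qed (use tu in auto)
  then show "dist (y t) (y u) \<le> B * dist t u" by (simp add: dist_norm)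
qed fact

lemma compact_positive_lower_bound:
  fixes g :: "'a::topological_space \<Rightarrow> real"
  assumes "compact C" "continuous_on C g" "\<And>x. x \<in> C \<Longrightarrow> 0 < g x"
  obtains \<mu> where "\<mu> > 0" "\<And>x. x \<in> C \<Longrightarrow> \<mu> \<le> g x"
proof (cases "C = {}")
  case False
  then obtain x where "x \<in> C" "\<And>y. y \<in> C \<Longrightarrow> g x \<le> g y"
    using continuous_attains_inf[OF assms(1) _ assms(2)] by blast
  then show ?thesis using that[of "g x"] assms(3) by blast
qed (use that[of 1] in auto)

lemma finite_positive_lower_bound:
  fixes A :: "real set"
  assumes "finite A" "\<And>x. x \<in> A \<Longrightarrow> 0 < x"
  shows "\<exists>\<delta>>0. \<forall>x\<in>A. \<delta> \<le> x"
  using assms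
proof (cases "A = {}")
  case False
  then show ?thesis using assms by (intro exI[of _ "Min A"]) auto
qed (auto intro: exI[of _ 1])

text \<open>A tail of the curve is connected and lies in finitely many disjoint balls, so it stays
  in one of them. Shrinking the radius cannot change the centre, as distinct centres are at least
  \<open>\<delta>\<close> apart.\<close>

lemma tendsto_finite_set:
  fixes q :: "real \<Rightarrow> 'a::metric_space"
  assumes C: "finite C" and q: "continuous_on {0..} q"
    and ev: "\<And>e. e > 0 \<Longrightarrow> \<forall>\<^sub>F t in at_top. \<exists>c\<in>C. dist (q t) c < e"
  obtains c where "c \<in> C" "(q \<longlongrightarrow> c) at_top"
proof -
  obtain \<delta> where \<delta>: "\<delta> > 0" "\<And>c c'. c \<in> C \<Longrightarrow> c' \<in> C \<Longrightarrow> c \<noteq> c' \<Longrightarrow> \<delta> \<le> dist c c'"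
  proof -
    have "finite ((\<lambda>(c, c'). dist c c') ` {(c, c'). c \<in> C \<and> c' \<in> C \<and> c \<noteq> c'})"
      by (rule finite_imageI, rule finite_subset[of _ "C \<times> C"]) (use C in auto)
    then have "\<exists>\<delta>>0. \<forall>x \<in> (\<lambda>(c, c'). dist c c') ` {(c, c'). c \<in> C \<and> c' \<in> C \<and> c \<noteq> c'}. \<delta> \<le> x"
      by (intro finite_positive_lower_bound) auto
    then show ?thesis using that by fastforce
  qed
  have stay: "\<exists>c\<in>C. \<exists>T\<ge>0. \<forall>t\<ge>T. dist (q t) c < e" if e: "0 < e" "e \<le> \<delta> / 2" for e
  proof -
    obtain T0 where "\<forall>t\<ge>T0. \<exists>c\<in>C. dist (q t) c < e"
      using ev[OF e(1)] by (auto simp: eventually_at_top_linorder)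
    then have T: "\<exists>c\<in>C. dist (q t) c < e" if "t \<ge> max 0 T0" for t
      using that by auto
    define T where "T = max 0 T0"
    obtain c where c: "c \<in> C" "dist (q T) c < e" using T[of T] by (auto simp: T_def)
    let ?A = "ball c e" and ?B = "\<Union>c'\<in>C - {c}. ball c' e"
    have con: "connected (q ` {T..})"
      by (intro connected_continuous_image continuous_on_subset[OF q]) (auto simp: T_def)
    have disj: "?A \<inter> ?B = {}"
    proof -
      have False if "c' \<in> C" "c' \<noteq> c" "dist c x < e" "dist c' x < e" for c' x
        using \<delta>(2)[of c c'] c that e dist_triangle2[of c c' x] by auto
      then show ?thesis by (auto simp: set_eq_iff)
    qed
    have "q ` {T..} \<subseteq> ?A \<union> ?B"
    proof
      fix x assume "x \<in> q ` {T..}"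
      then obtain t where t: "x = q t" "t \<ge> max 0 T0" by (auto simp: T_def)
      obtain c' where "c' \<in> C" "dist (q t) c' < e" using T[OF t(2)] by blast
      then show "x \<in> ?A \<union> ?B" unfolding t(1) by (cases "c' = c") (auto simp: dist_commute)
    qed
    then have "?A \<inter> q ` {T..} = {} \<or> ?B \<inter> q ` {T..} = {}"
      using connectedD[OF con, of ?A ?B] disj by auto
    moreover have "q T \<in> ?A \<inter> q ` {T..}" using c by (auto simp: dist_commute)
    ultimately have "q ` {T..} \<subseteq> ?A" using \<open>q ` {T..} \<subseteq> ?A \<union> ?B\<close> by blast
    then show ?thesis using c(1)
      by (intro bexI[of _ c] exI[of _ T]) (auto simp: T_def dist_commute image_subset_iff)
  qed
  obtain c T where c: "c \<in> C" "\<And>t. t \<ge> T \<Longrightarrow> dist (q t) c < \<delta> / 2"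
    using stay[of "\<delta> / 2"] \<delta>(1) by auto
  have "(q \<longlongrightarrow> c) at_top"
  proof (rule tendstoI)
    fix e :: real assume "e > 0"
    then obtain c' T' where c': "c' \<in> C" "\<And>t. t \<ge> T' \<Longrightarrow> dist (q t) c' < min e (\<delta> / 2)"
      using stay[of "min e (\<delta> / 2)"] \<delta>(1) by (metis half_gt_zero min.cobounded2 min_less_iff_conj)
    have "c' = c"
    proof (rule ccontr)
      assume "c' \<noteq> c"
      then have "\<delta> \<le> dist c c'" using \<delta>(2) c(1) c'(1) by auto
      moreover have "dist (q (max T T')) c < \<delta> / 2" "dist (q (max T T')) c' < \<delta> / 2"
        using c(2)[of "max T T'"] c'(2)[of "max T T'"] by auto
      ultimately show False using dist_triangle3[of c c' "q (max T T')"] by linarith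
    qed
    then show "\<forall>\<^sub>F t in at_top. dist (q t) c < e"
      using c'(2) unfolding eventually_at_top_linorder by auto
  qed
  then show ?thesis using c(1) that by blast
qed

lemma antimono_bounded_below_convergent:
  fixes g :: "real \<Rightarrow> real"
  assumes mono: "\<And>t u. 0 \<le> t \<Longrightarrow> t \<le> u \<Longrightarrow> g u \<le> g t" and B: "\<And>t. 0 \<le> t \<Longrightarrow> B \<le> g t"
  obtains l where "(g \<longlongrightarrow> l) at_top"
proof -
  define l where "l = Inf (g ` {0..})"
  have bb: "bdd_below (g ` {0..})" using B by (auto intro!: bdd_belowI)
  have "(g \<longlongrightarrow> l) at_top"
  proof (rule tendstoI)
    fix e :: real assume e: "e > 0"
    then have "\<exists>x\<in>g ` {0..}. x < l + e"
      unfolding l_def by (intro cInf_lessD) auto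
    then obtain t where t: "0 \<le> t" "g t < l + e" by auto
    have "dist (g u) l < e" if "u \<ge> t" for u
    proof -
      have "l \<le> g u" unfolding l_def by (intro cInf_lower bb) (use t that in auto)
      then show ?thesis using mono[OF t(1) that] t(2) by (simp add: dist_real_def)
    qed
    then show "\<forall>\<^sub>F u in at_top. dist (g u) l < e"
      unfolding eventually_at_top_linorder by blast
  qed
  then show ?thesis by (rule that)
qed

lemma compact_rotations: "compact {Q :: real^3^3. rotation_matrix Q}"
proof -
  have "closed {Q :: real^3^3. transpose Q ** Q = mat 1 \<and> det Q = 1}"
    by (intro closed_Collect_conj closed_Collect_eq matrix_mult.continuous_on continuous_on_det3
        transpose_continuous_on continuous_on_id continuous_on_const)
  moreover have "bounded {Q :: real^3^3. rotation_matrix Q}"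
    using norm_rotation by (auto simp: bounded_iff intro!: exI[of _ "sqrt 3"])
  ultimately show ?thesis
    by (simp add: compact_eq_bounded_closed rotation_matrix_def orthogonal_matrix)
qed

context attitude_error
begin

lemma closed_X: "closed X"
  by (rule closed_Times[OF compact_imp_closed[OF compact_rotations] closed_UNIV])

abbreviation e0 :: state where "e0 \<equiv> (mat 1, 0, 0)"

definition crit :: "(real^3^3) set" where
  "crit = {Q. rotation_matrix Q \<and> s Q = 0}"

lemma crit_sym: "Q \<in> crit \<Longrightarrow> transpose (Q ** K) = Q ** K"
proof -
  assume "Q \<in> crit"
  then have "transpose (K ** transpose Q) = K ** transpose Q"
    by (simp add: crit_def s_def axl_eq_0_iff)
  then show ?thesis by (simp add: matrix_transpose_mul K_sym)
qed

text \<open>As \<open>s\<close> is linear, this is its exact derivative in the direction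
  \<open>skew a ** Q\<close>; symmetry of \<open>Q ** K\<close> at a critical point brings it into
  the form of \<open>axl_symmetric_skew\<close>.\<close>

lemma s_skew_crit:
  assumes "Q \<in> crit"
  shows "s (skew a ** Q) = - ((trace (Q ** K) *\<^sub>R mat 1 - Q ** K) *v a)"
proof -
  have QK: "K ** transpose Q = Q ** K"
    using crit_sym[OF assms] by (simp add: matrix_transpose_mul K_sym)
  have "s (skew a ** Q) = axl (- ((Q ** K) ** skew a))"
    by (simp add: s_def matrix_transpose_mul transpose_skew matrix_mul_assoc QK matrix_mult.minus_right)
  also have "\<dots> = - (trace (Q ** K) *\<^sub>R a - (Q ** K) *v a)"
    by (simp add: axl_neg axl_symmetric_skew[OF crit_sym[OF assms]])
  finally show ?thesis
    by (simp add: matrix_vector_mult.diff_left matrix_vector_mult.scaleR_left)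
qed

lemma crit_inverse:
  assumes "Q \<in> crit"
  obtains H G where "\<And>a. s (skew a ** Q) = - (H *v a)" "transpose G = G" "G ** H = mat 1" "H ** G = mat 1"
    "Q \<noteq> mat 1 \<Longrightarrow> \<exists>\<theta>. norm \<theta> = 1 \<and> \<theta> \<bullet> (H *v \<theta>) < 0"
proof -
  have rot: "rotation_matrix Q" using assms by (simp add: crit_def)
  let ?H = "trace (Q ** K) *\<^sub>R mat 1 - Q ** K"
  obtain G where "transpose G = G" "G ** ?H = mat 1" "?H ** G = mat 1"
    "Q \<noteq> mat 1 \<Longrightarrow> \<exists>\<theta>. norm \<theta> = 1 \<and> \<theta> \<bullet> (?H *v \<theta>) < 0"
    using hessian_critical_point[OF UE K rot d crit_sym[OF assms]] by blast
  then show ?thesis using that[of ?H G] s_skew_crit[OF assms] by blast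
qed

lemma finite_crit: "finite crit"
proof -
  have "crit \<subseteq> (\<lambda>B :: 3 set. UE ** diagm (\<lambda>i. if i \<in> B then 1 else - 1) ** transpose UE) ` UNIV"
  proof
    fix Q assume Q: "Q \<in> crit"
    obtain \<epsilon> where \<epsilon>: "\<And>i. \<epsilon> i = 1 \<or> \<epsilon> i = - 1" "Q = UE ** diagm \<epsilon> ** transpose UE"
      using critical_point_form[OF UE K _ d crit_sym[OF Q]] Q by (auto simp: crit_def)
    then have "\<epsilon> = (\<lambda>i. if i \<in> {i. \<epsilon> i = 1} then 1 else - 1)" by force
    then show "Q \<in> (\<lambda>B :: 3 set. UE ** diagm (\<lambda>i. if i \<in> B then 1 else - 1) ** transpose UE) ` UNIV"
      using \<epsilon>(2) by (intro image_eqI[of _ _ "{i. \<epsilon> i = 1}"]) auto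
  qed
  then show ?thesis by (rule finite_subset) simp
qed

lemma mat_1_crit: "mat 1 \<in> crit"
  by (simp add: crit_def s_def rotation_matrix_def axl_eq_0_iff K_sym orthogonal_matrix_def)

text \<open>Away from the identity \<open>U\<close> is positive, hence so is the weight; at the
  identity both sides hold, because it is critical. A weight that vanishes at 0 thus adds no
  zeros.\<close>

lemma h_eq_0_iff: "rotation_matrix Q \<Longrightarrow> h Q = 0 \<longleftrightarrow> s Q = 0"
  using \<phi>_pos[of "U Q"] U_nonneg[of Q] U_eq_0_iff[of Q] mat_1_crit
  by (cases "U Q = 0") (auto simp: h_def crit_def)

lemma fsol_bounded:
  assumes "fsol z" "z 0 \<in> X"
  obtains r where "r > 0" "\<And>t. 0 \<le> t \<Longrightarrow> norm (z t) < r"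
proof -
  obtain r where r: "r > 0" "\<And>x. x \<in> X \<Longrightarrow> V x \<le> V (z 0) \<Longrightarrow> norm x < r"
    by (rule V_sublevel_bounded) blast
  show ?thesis
    by (rule that[OF r(1)], rule r(2)) (use fsol_in_X fsol_V_antimono[OF assms order_refl] assms in auto)
qed

text \<open>\<open>R\<close> and \<open>z\<close> have bounded derivatives and remain in a compact
  set, so any continuous function of them is uniformly continuous in time. \<open>\<Omega>\<close>
  is not among the arguments of \<open>G\<close>: it is continuous and bounded, but possibly not
  uniformly continuous.\<close>

lemma uniformly_continuous_along_fsol:
  fixes G :: "(real^3^3) \<times> state \<Rightarrow> 'b::real_normed_vector"
  assumes z: "fsol z" "z 0 \<in> X" and G: "continuous_on UNIV G"
  shows "uniformly_continuous_on {0..} (\<lambda>t. G (R t, z t))"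
proof -
  obtain r where r: "r > 0" "\<And>t. 0 \<le> t \<Longrightarrow> norm (z t) < r"
    using fsol_bounded[OF z] by blast
  obtain B where B: "B > 0" "\<And>t x. t \<in> {0..} \<Longrightarrow> x \<in> cball 0 r \<Longrightarrow> norm (f t x) \<le> B"
    using f_ulip[OF bounded_cball[of 0 r]] by (rule ulipE) blast
  obtain BR where BR: "BR > 0" "\<And>t x. t \<in> {0..} \<Longrightarrow> x \<in> UNIV \<Longrightarrow> norm (R t ** skew (\<Omega> t)) \<le> BR"
    by (rule ulipE[OF ulip_bilinear[OF bounded_bilinear_matrix_mult ulip_param[OF R_bounded]
            ulip_linear[OF bounded_linear_skew ulip_param[OF \<Omega>_bounded]]], of UNIV]) blast
  have "uniformly_continuous_on {0..} z"
  proof (rule uniformly_continuous_of_bounded_deriv[where y' = "\<lambda>t. f t (z t)" and B = B])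
    fix t :: real assume t: "0 \<le> t"
    show "(z has_vector_derivative f t (z t)) (at t within {0..})" using z t by (simp add: sol_def)
    show "norm (f t (z t)) \<le> B" using B(2)[of t "z t"] r(2)[OF t] t by simp
  qed (use B in simp)
  moreover have "uniformly_continuous_on {0..} R"
    by (rule uniformly_continuous_of_bounded_deriv[OF R_kin BR(2)]) (use BR in auto)
  ultimately have uc: "uniformly_continuous_on {0..} (\<lambda>t. (R t, z t))"
    using uniformly_continuous_on_add[of "{0..}" "\<lambda>t. (R t, 0)" "\<lambda>t. (0, z t)"]
      bounded_linear.uniformly_continuous_on[OF bounded_linear_Pair[OF bounded_linear_ident bounded_linear_zero]]
      bounded_linear.uniformly_continuous_on[OF bounded_linear_Pair[OF bounded_linear_zero bounded_linear_ident]]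
    by fastforce
  let ?C = "cball (0 :: real^3^3) (sqrt 3) \<times> cball (0 :: state) r"
  have sub: "(\<lambda>t. (R t, z t)) ` {0..} \<subseteq> ?C"
  proof (rule image_subsetI)
    fix t :: real assume "t \<in> {0..}"
    then show "(R t, z t) \<in> ?C" using norm_rotation[OF R_rot, of t] r(2)[of t] by simp
  qed
  have "uniformly_continuous_on ?C G"
    by (intro compact_uniformly_continuous continuous_on_subset[OF G] compact_Times compact_cball) auto
  then have "uniformly_continuous_on ((\<lambda>t. (R t, z t)) ` {0..}) G"
    using sub unfolding uniformly_continuous_on_def by (meson subsetD)
  from uniformly_continuous_on_compose[OF uc this] show ?thesis by simp
qed

text \<open>The order of the three limits matters: \<open>w\<close> tending to 0 turns the
  gyroscopic term in the equation for \<open>w\<close> into a remainder, and the attitude must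
  already converge to one critical point before its invertible Hessian can recover \<open>b\<close>
  from the derivative of \<open>s\<close>.\<close>

lemma fsol_converges:
  assumes z: "fsol z" "z 0 \<in> X"
  obtains Q where "Q \<in> crit" "(z \<longlongrightarrow> (Q, 0, 0)) at_top"
proof -
  define q w b where "q = (\<lambda>t. fst (z t))" and "w = (\<lambda>t. fst (snd (z t)))" and "b = (\<lambda>t. snd (snd (z t)))"
  have zX: "z t \<in> X" if "0 \<le> t" for t using fsol_in_X[OF z that] .
  have q_rot: "rotation_matrix (q t)" if "0 \<le> t" for t using zX[OF that] by (auto simp: q_def)
  obtain r where r: "r > 0" "\<And>t. 0 \<le> t \<Longrightarrow> norm (z t) < r"
    using fsol_bounded[OF z] by blast
  have bb: "norm (b t) \<le> r" if "0 \<le> t" for t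
    using r(2)[OF that] norm_snd_le[where y = "snd (z t)" and x = "fst (z t)"]
      norm_snd_le[where y = "snd (snd (z t))" and x = "fst (snd (z t))"] by (simp add: b_def)
  obtain c where c: "c > 0" "\<And>x. c * (norm x)\<^sup>2 \<le> x \<bullet> (D *v x)"
    using posdef_lower_bound[OF D] by blast
  have wD: "((\<lambda>t. - (w t \<bullet> (D *v w t))) \<longlongrightarrow> 0) at_top"
  proof -
    obtain l where l: "((\<lambda>t. V (z t)) \<longlongrightarrow> l) at_top"
      by (rule antimono_bounded_below_convergent[of "\<lambda>t. V (z t)" 0])
        (use fsol_V_antimono[OF z] V_nonneg[OF zX] in auto)
    show ?thesis
    proof (rule barbalat[OF l, where r = "\<lambda>t. 0"])
      fix t :: real assume t: "0 \<le> t"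
      show "((\<lambda>t. V (z t)) has_vector_derivative - (w t \<bullet> (D *v w t)) + 0) (at t within {0..})"
        using V_has_derivative[OF z(1), of t] t zX
        by (simp add: has_real_derivative_iff_has_vector_derivative w_def)
    next
      have "continuous_on UNIV (\<lambda>x :: (real^3^3) \<times> state. - (fst (snd (snd x)) \<bullet> (D *v fst (snd (snd x)))))"
        by (intro continuous_intros matrix_vector_mult.continuous_on)
      from uniformly_continuous_along_fsol[OF z this]
      show "uniformly_continuous_on {0..} (\<lambda>t. - (w t \<bullet> (D *v w t)))" by (simp add: w_def)
    qed simp
  qed
  have w0: "(w \<longlongrightarrow> 0) at_top"
  proof -
    have "((\<lambda>t. (norm (w t))\<^sup>2) \<longlongrightarrow> 0) at_top"
    proof (rule Lim_null_comparison)
      show "\<forall>\<^sub>F t in at_top. norm ((norm (w t))\<^sup>2) \<le> - (- (w t \<bullet> (D *v w t))) * (1 / c)"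
        using c by (intro always_eventually) (auto simp: field_simps)
      show "((\<lambda>t. - (- (w t \<bullet> (D *v w t))) * (1 / c)) \<longlongrightarrow> 0) at_top"
        using tendsto_mult_right[OF tendsto_minus[OF wD], of "1 / c"] by simp
    qed
    then have "((\<lambda>t. sqrt ((norm (w t))\<^sup>2)) \<longlongrightarrow> sqrt 0) at_top" by (rule tendsto_real_sqrt)
    then show ?thesis by (simp add: tendsto_norm_zero_iff)
  qed
  have h0: "((\<lambda>t. h (q t)) \<longlongrightarrow> 0) at_top"
  proof -
    obtain Bx where Bx: "Bx > 0" "\<And>x y. norm (cross3 x y) \<le> norm x * norm y * Bx"
      using cross3.pos_bounded by blast
    obtain BO where BO: "\<And>t. 0 \<le> t \<Longrightarrow> norm (\<Omega> t) \<le> BO"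
      using \<Omega>_bounded by (auto simp: bounded_iff)
    have "((\<lambda>t. (1 / m) *\<^sub>R (transpose (R t) *v h (q t))) \<longlongrightarrow> 0) at_top"
    \<comment> \<open>The gyroscopic term contains \<open>\<Omega>\<close> but tends to 0 with
      \<open>w\<close>, so it joins the remainder; what is left is a continuous function of
      \<open>R\<close> and \<open>z\<close>.\<close>
    proof (rule barbalat[OF w0, where r = "\<lambda>t. - cross3 (\<Omega> t + b t) (w t) - (1 / m) *\<^sub>R (D *v w t)"])
      fix t :: real assume t: "0 \<le> t"
      show "(w has_vector_derivative (1 / m) *\<^sub>R (transpose (R t) *v h (q t)) + (- cross3 (\<Omega> t + b t) (w t) - (1 / m) *\<^sub>R (D *v w t))) (at t within {0..})"
        using sol_components(2)[OF z(1), of t] t by (simp add: f_snd q_def w_def b_def scaleR_diff_right algebra_simps)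
    next
      have "continuous_on UNIV (\<lambda>x :: (real^3^3) \<times> state. (1 / m) *\<^sub>R (transpose (fst x) *v h (fst (snd x))))"
        by (intro continuous_intros matrix_vector_mult.continuous_on transpose_continuous_on
            continuous_on_compose2[OF h_cont[of UNIV]]) auto
      from uniformly_continuous_along_fsol[OF z this]
      show "uniformly_continuous_on {0..} (\<lambda>t. (1 / m) *\<^sub>R (transpose (R t) *v h (q t)))" by (simp add: q_def)
    next
      have "((\<lambda>t. cross3 (\<Omega> t + b t) (w t)) \<longlongrightarrow> 0) at_top"
      proof (rule Lim_null_comparison)
        have "norm (cross3 (\<Omega> t + b t) (w t)) \<le> (BO + r) * norm (w t) * Bx" if "t \<ge> 0" for t
          using Bx(1) BO[OF that] bb[OF that] norm_triangle_ineq[of "\<Omega> t" "b t"]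
          by (intro order_trans[OF Bx(2)] mult_right_mono) auto
        then show "\<forall>\<^sub>F t in at_top. norm (cross3 (\<Omega> t + b t) (w t)) \<le> (BO + r) * norm (w t) * Bx"
          unfolding eventually_at_top_linorder by blast
        show "((\<lambda>t. (BO + r) * norm (w t) * Bx) \<longlongrightarrow> 0) at_top"
          by (intro tendsto_mult_left_zero tendsto_mult_right_zero tendsto_norm_zero w0)
      qed
      moreover have "((\<lambda>t. (1 / m) *\<^sub>R (D *v w t)) \<longlongrightarrow> (1 / m) *\<^sub>R (D *v 0)) at_top"
        by (intro tendsto_intros bounded_linear.tendsto[OF matrix_vector_mult.bounded_linear_right] w0)
      ultimately show "((\<lambda>t. - cross3 (\<Omega> t + b t) (w t) - (1 / m) *\<^sub>R (D *v w t)) \<longlongrightarrow> 0) at_top"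
        using tendsto_diff[OF tendsto_minus] by fastforce
    qed
    then have "((\<lambda>t. m * norm ((1 / m) *\<^sub>R (transpose (R t) *v h (q t)))) \<longlongrightarrow> 0) at_top"
      by (intro tendsto_mult_right_zero tendsto_norm_zero)
    then have "((\<lambda>t. norm (h (q t))) \<longlongrightarrow> 0) at_top"
    proof (rule Lim_transform_eventually)
      show "\<forall>\<^sub>F t in at_top. m * norm ((1 / m) *\<^sub>R (transpose (R t) *v h (q t))) = norm (h (q t))"
        unfolding eventually_at_top_linorder using m norm_rotation_mult(2)[OF R_rot]
        by (intro exI[of _ 0]) auto
    qed
    then show ?thesis by (simp add: tendsto_norm_zero_iff)
  qed
  \<comment> \<open>On the compact set of rotations outside \<open>W\<close> the norm of
    \<open>h\<close> has a positive lower bound, so \<open>h (q t)\<close> tending to 0 forces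
    \<open>q t\<close> into \<open>W\<close>.\<close>
  have near_crit: "\<forall>\<^sub>F t in at_top. q t \<in> W" if W: "open W" "crit \<subseteq> W" for W
  proof -
    have "compact ({Q. rotation_matrix Q} - W)"
      by (intro compact_diff compact_rotations W)
    then obtain \<mu> where \<mu>: "\<mu> > 0" "\<And>Q. Q \<in> {Q. rotation_matrix Q} - W \<Longrightarrow> \<mu> \<le> norm (h Q)"
      by (rule compact_positive_lower_bound[of _ "\<lambda>Q. norm (h Q)"])
        (use W h_eq_0_iff in \<open>auto intro!: continuous_intros h_cont simp: crit_def\<close>)
    have "\<forall>\<^sub>F t in at_top. dist (h (q t)) 0 < \<mu>" by (rule tendstoD[OF h0 \<mu>(1)])
    then show ?thesis using eventually_ge_at_top[of 0]
    proof eventually_elim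
      case (elim t)
      then show ?case using \<mu>(2)[of "q t"] q_rot[of t] by force
    qed
  qed
  have qc: "continuous_on {0..} q"
    unfolding q_def by (intro continuous_on_fst sol_continuous[OF z(1)])
  obtain Q where Q: "Q \<in> crit" "(q \<longlongrightarrow> Q) at_top"
  proof (rule tendsto_finite_set[OF finite_crit qc])
    fix e :: real assume e: "e > 0"
    have "\<forall>\<^sub>F t in at_top. q t \<in> (\<Union>c\<in>crit. ball c e)"
      by (rule near_crit) (use e in auto)
    then show "\<forall>\<^sub>F t in at_top. \<exists>c\<in>crit. dist (q t) c < e"
      by eventually_elim (auto simp: dist_commute)
  qed
  have s0: "((\<lambda>t. s (q t)) \<longlongrightarrow> 0) at_top"
    using s_tendsto[OF Q(2)] Q(1) by (simp add: crit_def)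
  \<comment> \<open>The velocity of the attitude splits into a part driven by \<open>w\<close>,
    which vanishes in the limit, and a part driven by \<open>b\<close>, to which Barbalat's lemma
    applies.\<close>
  have sb: "((\<lambda>t. s (skew (- (R t *v b t)) ** q t)) \<longlongrightarrow> 0) at_top"
  proof (rule barbalat[OF s0, where r = "\<lambda>t. s (skew (R t *v w t) ** q t)"])
    fix t :: real assume t: "0 \<le> t"
    have "(q has_vector_derivative skew (R t *v (w t - b t)) ** q t) (at t within {0..})"
      using sol_components(1)[OF z(1), of t] t by (simp add: f_fst q_def w_def b_def)
    from s_has_vector_derivative[OF this]
    show "((\<lambda>t. s (q t)) has_vector_derivative s (skew (- (R t *v b t)) ** q t) + s (skew (R t *v w t) ** q t)) (at t within {0..})"
      by (simp add: matrix_vector_mult.diff_right skew_diff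
          skew_neg
          s_diff s_neg
          matrix_mult.diff_left matrix_mult.minus_left)
  next
    have "continuous_on UNIV (\<lambda>x :: (real^3^3) \<times> state. s (skew (- (fst x *v snd (snd (snd x)))) ** fst (snd x)))"
      by (intro continuous_intros matrix_vector_mult.continuous_on matrix_mult.continuous_on
          skew_continuous_on s_continuous_on)
    from uniformly_continuous_along_fsol[OF z this]
    show "uniformly_continuous_on {0..} (\<lambda>t. s (skew (- (R t *v b t)) ** q t))" by (simp add: q_def b_def)
  next
    have "((\<lambda>t. R t *v w t) \<longlongrightarrow> 0) at_top"
    proof (rule Lim_null_comparison)
      show "\<forall>\<^sub>F t in at_top. norm (R t *v w t) \<le> norm (w t)"
        unfolding eventually_at_top_linorder using norm_rotation_mult(1)[OF R_rot] by (intro exI[of _ 0]) auto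
    qed (rule tendsto_norm_zero[OF w0])
    from matrix_mult.tendsto[OF skew_tendsto[OF this] Q(2)]
    show "((\<lambda>t. s (skew (R t *v w t) ** q t)) \<longlongrightarrow> 0) at_top"
      by (auto dest!: s_tendsto
          simp: s_zero skew_zero matrix_mult.zero_left)
  qed
  obtain H G where HG: "\<And>a. s (skew a ** Q) = - (H *v a)" "G ** H = mat 1"
    using crit_inverse[OF Q(1)] by blast
  have b0: "(b \<longlongrightarrow> 0) at_top"
  proof -
    obtain Bs where Bs: "Bs > 0" "\<And>a M. norm (s (skew a ** M)) \<le> norm a * norm M * Bs"
    proof -
      obtain B1 where B1: "B1 > 0" "\<And>M. norm (s M) \<le> norm M * B1" using s_pos_bounded by blast
      obtain B2 where B2: "B2 > 0" "\<And>a (M :: real^3^3). norm (skew a ** M) \<le> norm a * norm M * B2"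
        using bounded_bilinear.pos_bounded[OF matrix_mult.comp1[OF bounded_linear_skew]] by blast
      have "norm (s (skew a ** M)) \<le> norm a * norm M * (B2 * B1)" for a M
        using mult_right_mono[OF B2(2)[of a M], of B1] B1 order_trans[OF B1(2)] by (simp add: mult.assoc)
      then show ?thesis using that[of "B2 * B1"] B1(1) B2(1) by simp
    qed
    \<comment> \<open>As \<open>b\<close> is bounded, \<open>q t\<close> may be replaced by its
      limit \<open>Q\<close>, where \<open>s (skew a ** Q)\<close> depends invertibly on
      \<open>a\<close>.\<close>
    have sQ: "((\<lambda>t. s (skew (- (R t *v b t)) ** Q)) \<longlongrightarrow> 0) at_top"
    proof -
      have "((\<lambda>t. s (skew (- (R t *v b t)) ** (Q - q t))) \<longlongrightarrow> 0) at_top"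
      proof (rule Lim_null_comparison)
        have "norm (s (skew (- (R t *v b t)) ** (Q - q t))) \<le> r * norm (Q - q t) * Bs" if "t \<ge> 0" for t
          using Bs(1) bb[OF that] norm_rotation_mult(1)[OF R_rot[OF that], of "b t"]
          by (intro order_trans[OF Bs(2)] mult_right_mono) auto
        then show "\<forall>\<^sub>F t in at_top. norm (s (skew (- (R t *v b t)) ** (Q - q t))) \<le> r * norm (Q - q t) * Bs"
          unfolding eventually_at_top_linorder by blast
        have "((\<lambda>t. Q - q t) \<longlongrightarrow> Q - Q) at_top" by (intro tendsto_intros Q)
        then show "((\<lambda>t. r * norm (Q - q t) * Bs) \<longlongrightarrow> 0) at_top"
          by (intro tendsto_mult_left_zero tendsto_mult_right_zero tendsto_norm_zero) simp
      qed
      from tendsto_add[OF this sb] show ?thesis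
        by (simp add: s_add[symmetric] flip: matrix_mult.add_right)
    qed
    have "((\<lambda>t. G *v (s (skew (- (R t *v b t)) ** Q))) \<longlongrightarrow> G *v 0) at_top"
      by (rule bounded_linear.tendsto[OF matrix_vector_mult.bounded_linear_right sQ])
    moreover have GH: "G *v (H *v x) = x" for x by (simp add: matrix_vector_mul_assoc HG)
    ultimately have "((\<lambda>t. R t *v b t) \<longlongrightarrow> 0) at_top"
      by (simp add: HG(1) matrix_vector_mult.minus_right GH)
    then have "((\<lambda>t. norm (R t *v b t)) \<longlongrightarrow> 0) at_top" by (rule tendsto_norm_zero)
    then have "((\<lambda>t. norm (b t)) \<longlongrightarrow> 0) at_top"
    proof (rule Lim_transform_eventually)
      show "\<forall>\<^sub>F t in at_top. norm (R t *v b t) = norm (b t)"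
        unfolding eventually_at_top_linorder using norm_rotation_mult(1)[OF R_rot] by (intro exI[of _ 0]) auto
    qed
    then show ?thesis by (simp add: tendsto_norm_zero_iff)
  qed
  have "((\<lambda>t. (q t, w t, b t)) \<longlongrightarrow> (Q, 0, 0)) at_top"
    by (intro tendsto_Pair Q w0 b0)
  then show ?thesis using Q(1) that by (simp add: q_def w_def b_def)
qed


subsection \<open>The basin of the identity\<close>

lemma V_cont: "continuous_on X V"
proof -
  have \<Phi>c: "continuous_on {0..} \<Phi>"
    using \<Phi>_deriv by (intro DERIV_continuous_on) auto
  have Uc: "continuous_on X (\<lambda>x. \<Phi> (U (fst x)))"
    by (rule continuous_on_compose2[OF \<Phi>c])
      (auto intro!: continuous_on_compose2[OF U_cont[of UNIV]] continuous_intros U_nonneg)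
  have "continuous_on X (\<lambda>x. \<Phi> (U (fst x)) + m / 2 * (norm (fst (snd x)))\<^sup>2 + (snd (snd x) \<bullet> (P *v snd (snd x))) / 2)"
    by (intro continuous_intros Uc matrix_vector_mult.continuous_on) auto
  then show ?thesis by (simp add: V_def case_prod_beta')
qed

lemma V_near:
  assumes "x \<in> X" "0 < e"
  obtains \<delta> where "\<delta> > 0" "\<And>y. y \<in> X \<Longrightarrow> dist y x < \<delta> \<Longrightarrow> dist (V y) (V x) < e"
  using V_cont[unfolded continuous_on_iff, rule_format, OF assms] by (metis (no_types))

lemma V_crit: "V (Q, 0, 0) = \<Phi> (U Q)"
  by (simp add: V_def)

lemma e0_in_X: "e0 \<in> X"
  using mat_1_crit by (simp add: crit_def)

lemma V_e0: "V e0 = 0"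
  using U_eq_0_iff[of "mat 1"] mat_1_crit by (simp add: V_crit \<Phi>_0 crit_def)

lemma fsol_V_lim:
  assumes "fsol z" "z 0 \<in> X" "(z \<longlongrightarrow> x) at_top" "x \<in> X"
  shows "((\<lambda>t. V (z t)) \<longlongrightarrow> V x) at_top"
  by (rule continuous_on_tendsto_compose[OF V_cont assms(3,4)])
    (use fsol_in_X[OF assms(1,2)] in \<open>auto simp: eventually_at_top_linorder\<close>)

text \<open>Compactness bounds \<open>\<Phi> (U Q)\<close> from below off a ball about the identity,
  and the quadratic parts of \<open>V\<close> control \<open>w\<close> and \<open>b\<close>; each of
  the three components is allotted \<open>e / 3\<close>.\<close>

lemma V_small_near_e0:
  assumes "e > 0"
  obtains \<mu> where "\<mu> > 0" "\<And>x. x \<in> X \<Longrightarrow> V x < \<mu> \<Longrightarrow> dist x e0 < e"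
proof -
  obtain p where p: "p > 0" "\<And>z. z \<in> X \<Longrightarrow> \<Phi> (U (fst z)) + m / 2 * (norm (fst (snd z)))\<^sup>2 + p * (norm (snd (snd z)))\<^sup>2 \<le> V z"
    "\<And>z. z \<in> X \<Longrightarrow> 0 \<le> \<Phi> (U (fst z))" by (rule V_lower) blast
  have \<Phi>c: "continuous_on {0..} \<Phi>"
    using \<Phi>_deriv by (intro DERIV_continuous_on) auto
  have "compact ({Q. rotation_matrix Q} - ball (mat 1 :: real^3^3) (e / 3))"
    by (intro compact_diff compact_rotations) auto
  then obtain \<nu> where \<nu>: "\<nu> > 0" "\<And>Q. Q \<in> {Q. rotation_matrix Q} - ball (mat 1) (e / 3) \<Longrightarrow> \<nu> \<le> \<Phi> (U Q)"
  proof (rule compact_positive_lower_bound[of _ "\<lambda>Q. \<Phi> (U Q)"])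
    show "continuous_on ({Q. rotation_matrix Q} - ball (mat 1) (e / 3)) (\<lambda>Q. \<Phi> (U Q))"
      by (intro continuous_on_compose2[OF \<Phi>c U_cont]) (auto intro: U_nonneg)
    fix Q assume Q: "Q \<in> {Q. rotation_matrix Q} - ball (mat 1 :: real^3^3) (e / 3)"
    then have "Q \<noteq> mat 1" using assms by auto
    then have "U Q > 0" using Q U_nonneg[of Q] U_eq_0_iff[of Q] by force
    then show "0 < \<Phi> (U Q)" by (rule \<Phi>_pos)
  qed blast
  define \<mu> where "\<mu> = min \<nu> (min (m / 2 * (e / 3)\<^sup>2) (p * (e / 3)\<^sup>2))"
  show ?thesis
  proof (rule that[of \<mu>])
    show "\<mu> > 0" using \<nu>(1) m p(1) assms by (simp add: \<mu>_def)
    fix x assume x: "x \<in> X" and Vx: "V x < \<mu>"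
    have nn: "m / 2 * (norm (fst (snd x)))\<^sup>2 \<ge> 0" "p * (norm (snd (snd x)))\<^sup>2 \<ge> 0" using m p(1) by auto
    have "\<Phi> (U (fst x)) < \<nu>" "m / 2 * (norm (fst (snd x)))\<^sup>2 < m / 2 * (e / 3)\<^sup>2" "p * (norm (snd (snd x)))\<^sup>2 < p * (e / 3)\<^sup>2"
      using p(2,3)[OF x] Vx nn by (auto simp: \<mu>_def)
    then have "dist (mat 1) (fst x) < e / 3" "(norm (fst (snd x)))\<^sup>2 < (e / 3)\<^sup>2" "(norm (snd (snd x)))\<^sup>2 < (e / 3)\<^sup>2"
      using \<nu>(2)[of "fst x"] x m p(1) by force+
    then have "norm (fst x - mat 1) < e / 3" "norm (fst (snd x)) < e / 3" "norm (snd (snd x)) < e / 3"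
      using assms power_less_imp_less_base[of "norm (fst (snd x))" 2 "e / 3"] power_less_imp_less_base[of "norm (snd (snd x))" 2 "e / 3"]
      by (auto simp: dist_norm norm_minus_commute)
    moreover have "norm (x - e0) \<le> norm (fst x - mat 1) + (norm (fst (snd x)) + norm (snd (snd x)))"
      using norm_Pair_le[of "fst x - mat 1" "snd x"] norm_Pair_le[of "fst (snd x)" "snd (snd x)"]
      by (cases x) simp
    ultimately show "dist x e0 < e" by (simp add: dist_norm)
  qed
qed

lemma fsol_stable:
  assumes "e > 0"
  obtains \<delta> where "\<delta> > 0" "\<And>z t. \<lbrakk>fsol z; z 0 \<in> X; dist (z 0) e0 < \<delta>; 0 \<le> t\<rbrakk> \<Longrightarrow> dist (z t) e0 < e"
proof -
  obtain \<mu> where \<mu>: "\<mu> > 0" "\<And>x. x \<in> X \<Longrightarrow> V x < \<mu> \<Longrightarrow> dist x e0 < e"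
    by (rule V_small_near_e0[OF assms]) blast
  obtain \<delta> where \<delta>: "\<delta> > 0" "\<And>x. x \<in> X \<Longrightarrow> dist x e0 < \<delta> \<Longrightarrow> dist (V x) (V e0) < \<mu>"
    by (rule V_near[OF e0_in_X \<mu>(1)]) blast
  show ?thesis
  proof (rule that[OF \<delta>(1)], rule \<mu>(2))
    fix z and t :: real assume z: "fsol z" "z 0 \<in> X" and d: "dist (z 0) e0 < \<delta>" and t: "0 \<le> t"
    show "z t \<in> X" by (rule fsol_in_X[OF z t])
    show "V (z t) < \<mu>"
      using \<delta>(2)[OF z(2) d] fsol_V_antimono[OF z order_refl t] by (simp add: V_e0 dist_real_def)
  qed
qed

text \<open>\<open>v\<close> bounds the values of \<open>V\<close> at the other critical points from
  below. As \<open>V\<close> does not increase, its value at the limit stays below \<open>v\<close>,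
  which leaves only the identity.\<close>

lemma fsol_attracted:
  obtains v where "v > 0" "\<And>z t. \<lbrakk>fsol z; z 0 \<in> X; 0 \<le> t; V (z t) < v\<rbrakk> \<Longrightarrow> (z \<longlongrightarrow> e0) at_top"
proof -
  have "\<exists>v>0. \<forall>x \<in> (\<lambda>Q. \<Phi> (U Q)) ` (crit - {mat 1}). v \<le> x"
  proof (rule finite_positive_lower_bound)
    fix x assume "x \<in> (\<lambda>Q. \<Phi> (U Q)) ` (crit - {mat 1})"
    then obtain Q where Q: "rotation_matrix Q" "Q \<noteq> mat 1" "x = \<Phi> (U Q)" by (auto simp: crit_def)
    then show "0 < x" using U_nonneg[of Q] U_eq_0_iff[of Q] by (auto intro!: \<Phi>_pos)
  qed (use finite_crit in simp)
  then obtain v where v: "v > 0" "\<And>Q. Q \<in> crit \<Longrightarrow> Q \<noteq> mat 1 \<Longrightarrow> v \<le> \<Phi> (U Q)" by auto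
  show ?thesis
  proof (rule that[OF v(1)])
    fix z and t :: real assume z: "fsol z" "z 0 \<in> X" and t: "0 \<le> t" and Vt: "V (z t) < v"
    obtain Q where Q: "Q \<in> crit" "(z \<longlongrightarrow> (Q, 0, 0)) at_top"
      using fsol_converges[OF z] by blast
    have "((\<lambda>t. V (z t)) \<longlongrightarrow> \<Phi> (U Q)) at_top"
      using fsol_V_lim[OF z Q(2)] Q(1) by (simp add: V_crit crit_def)
    then have "\<Phi> (U Q) \<le> V (z t)"
      by (rule tendsto_upperbound)
        (use fsol_V_antimono[OF z t] in \<open>auto simp: eventually_at_top_linorder\<close>)
    then show "(z \<longlongrightarrow> e0) at_top" using v(2)[OF Q(1)] Vt Q(2) by (cases "Q = mat 1") auto
  qed
qed

lemma fsol_flow_continuous: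
  assumes z: "fsol z" "z 0 \<in> X" and T: "0 \<le> T" and e: "e > 0"
  obtains \<delta> where "\<delta> > 0" "\<And>y. \<lbrakk>fsol y; y 0 \<in> X; dist (y 0) (z 0) < \<delta>\<rbrakk> \<Longrightarrow> dist (y T) (z T) < e"
proof -
  obtain \<delta>1 where \<delta>1: "\<delta>1 > 0" "\<And>x. x \<in> X \<Longrightarrow> dist x (z 0) < \<delta>1 \<Longrightarrow> dist (V x) (V (z 0)) < 1"
    by (rule V_near[OF z(2) zero_less_one]) blast
  obtain r where r: "r > 0" "\<And>x. x \<in> X \<Longrightarrow> V x \<le> V (z 0) + 1 \<Longrightarrow> norm x < r"
    by (rule V_sublevel_bounded) blast
  obtain L where L: "L > 0" "\<And>y. \<lbrakk>sol 1 (\<lambda>t. t) {0..T} y; \<And>t. t \<in> {0..T} \<Longrightarrow> y t \<in> ball 0 r \<and> z t \<in> ball 0 r\<rbrakk>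
      \<Longrightarrow> norm (y T - z T) \<le> exp (L * T) * norm (y 0 - z 0)"
  proof (rule sol_dependence[of "ball 0 r"])
    fix L assume "L > 0" and L: "\<And>sg \<theta> T y z. \<lbrakk>\<bar>sg\<bar> = 1; sol sg \<theta> {0..T} y; sol sg \<theta> {0..T} z; 0 \<le> T;
      \<And>t. t \<in> {0..T} \<Longrightarrow> 0 \<le> \<theta> t \<and> y t \<in> ball 0 r \<and> z t \<in> ball 0 r\<rbrakk>
    \<Longrightarrow> norm (y T - z T) \<le> exp (L * T) * norm (y 0 - z 0)"
    show thesis
    proof (rule that[OF \<open>L > 0\<close>])
      fix y assume y: "sol 1 (\<lambda>t. t) {0..T} y" "\<And>t. t \<in> {0..T} \<Longrightarrow> y t \<in> ball 0 r \<and> z t \<in> ball 0 r"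
      show "norm (y T - z T) \<le> exp (L * T) * norm (y 0 - z 0)"
        by (rule L[of 1 "\<lambda>t. t"]) (use y T sol_subset[OF z(1), of "{0..T}"] in auto)
    qed
  qed simp
  show ?thesis
  proof (rule that[of "min \<delta>1 (e / exp (L * T))"])
    show "min \<delta>1 (e / exp (L * T)) > 0" using \<delta>1 e by simp
    fix y assume y: "fsol y" "y 0 \<in> X" and d: "dist (y 0) (z 0) < min \<delta>1 (e / exp (L * T))"
    have Vy: "V (y 0) \<le> V (z 0) + 1" using \<delta>1(2)[OF y(2)] d by (auto simp: dist_real_def)
    have "norm (y T - z T) \<le> exp (L * T) * norm (y 0 - z 0)"
    proof (rule L(2))
      show "sol 1 (\<lambda>t. t) {0..T} y" by (rule sol_subset[OF y(1)]) auto
      fix t assume t: "t \<in> {0..T}"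
      have "norm (y t) < r"
        by (rule r(2)) (use fsol_in_X[OF y, of t] fsol_V_antimono[OF y, of 0 t] Vy t in auto)
      moreover have "norm (z t) < r"
        by (rule r(2)) (use fsol_in_X[OF z, of t] fsol_V_antimono[OF z, of 0 t] t in auto)
      ultimately show "y t \<in> ball 0 r \<and> z t \<in> ball 0 r" by simp
    qed
    also have "\<dots> < exp (L * T) * (e / exp (L * T))"
      using d by (intro mult_strict_left_mono) (auto simp: dist_norm)
    finally show "dist (y T) (z T) < e" by (simp add: dist_norm)
  qed
qed

section \<open>Time reversal and openness of the flow map\<close>

lemma sol_time_reversal:
  assumes "sol sg \<theta> {0..T} z"
  shows "sol (- sg) (\<lambda>t. \<theta> (T - t)) {0..T} (\<lambda>t. z (T - t))"
  unfolding sol_def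
proof
  fix t assume t: "t \<in> {0..T}"
  have img: "(\<lambda>t. T - t) ` {0..T} \<subseteq> {0..T}" by auto
  have "(z has_vector_derivative sg *\<^sub>R f (\<theta> (T - t)) (z (T - t))) (at (T - t) within {0..T})"
    using assms t by (simp add: sol_def)
  then have "(z has_vector_derivative sg *\<^sub>R f (\<theta> (T - t)) (z (T - t))) (at (T - t) within (\<lambda>t. T - t) ` {0..T})"
    by (rule has_vector_derivative_within_subset[OF _ img])
  moreover have "((\<lambda>t. T - t) has_vector_derivative - 1) (at t within {0..T})"
    by (auto intro!: derivative_eq_intros)
  ultimately have "(z \<circ> (\<lambda>t. T - t) has_vector_derivative (- 1) *\<^sub>R (sg *\<^sub>R f (\<theta> (T - t)) (z (T - t)))) (at t within {0..T})"
    by (intro vector_diff_chain_within)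
  then show "((\<lambda>t. z (T - t)) has_vector_derivative - sg *\<^sub>R f (\<theta> (T - t)) (z (T - t))) (at t within {0..T})"
    by (simp add: o_def)
qed

text \<open>Solving the reversed equation from \<open>x\<close> for time \<open>T\<close> yields the
  initial point of a trajectory through \<open>x\<close>, and its distance to \<open>z 0\<close> is
  controlled by dependence on data in reversed time. Perturbations may thus be made at time
  \<open>T\<close> instead of time 0.\<close>

lemma fsol_flow_open:
  assumes z: "fsol z" "z 0 \<in> X" and T: "0 \<le> T" and e: "e > 0"
  obtains \<delta> where "\<delta> > 0" "\<And>x. \<lbrakk>x \<in> X; dist x (z T) < \<delta>\<rbrakk> \<Longrightarrow> \<exists>y. fsol y \<and> y 0 \<in> X \<and> dist (y 0) (z 0) < e \<and> y T = x"
proof -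
  have zT: "z T \<in> X" by (rule fsol_in_X[OF z T])
  obtain k where k: "k > 0" "\<And>sg \<theta> T z. \<lbrakk>\<bar>sg\<bar> = 1; sol sg \<theta> {0..T} z; 0 \<le> T; z 0 \<in> X; \<And>t. t \<in> {0..T} \<Longrightarrow> 0 \<le> \<theta> t\<rbrakk>
    \<Longrightarrow> V (z T) \<le> exp (k * T) * V (z 0)"
    using V_growth by blast
  obtain \<delta>1 where \<delta>1: "\<delta>1 > 0" "\<And>x. x \<in> X \<Longrightarrow> dist x (z T) < \<delta>1 \<Longrightarrow> dist (V x) (V (z T)) < 1"
    by (rule V_near[OF zT zero_less_one]) blast
  obtain r where r: "r > 0" "\<And>x. x \<in> X \<Longrightarrow> V x \<le> exp (k * T) * (V (z T) + 1) \<Longrightarrow> norm x < r"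
    by (rule V_sublevel_bounded) blast
  obtain L where L: "L > 0" "\<And>sg \<theta> T y z. \<lbrakk>\<bar>sg\<bar> = 1; sol sg \<theta> {0..T} y; sol sg \<theta> {0..T} z; 0 \<le> T;
      \<And>t. t \<in> {0..T} \<Longrightarrow> 0 \<le> \<theta> t \<and> y t \<in> ball 0 r \<and> z t \<in> ball 0 r\<rbrakk>
    \<Longrightarrow> norm (y T - z T) \<le> exp (L * T) * norm (y 0 - z 0)"
    by (rule sol_dependence[OF bounded_ball]) blast
  have bound: "norm (u t) < r"
    if u: "sol (- 1) (\<lambda>t. T - t) {0..T} u" "u 0 \<in> X" "V (u 0) \<le> V (z T) + 1" and t: "t \<in> {0..T}" for u t
  proof (rule r(2))
    have ut: "sol (- 1) (\<lambda>t. T - t) {0..t} u" by (rule sol_subset[OF u(1)]) (use t in auto)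
    show "u t \<in> X" by (rule sol_in_X[OF u(1,2) t])
    have "V (u t) \<le> exp (k * t) * V (u 0)"
      by (rule k(2)[OF _ ut _ u(2)]) (use t in auto)
    also have "\<dots> \<le> exp (k * T) * (V (z T) + 1)"
      using t k(1) V_nonneg[OF u(2)] u(3) by (intro mult_mono) auto
    finally show "V (u t) \<le> exp (k * T) * (V (z T) + 1)" .
  qed
  have zb: "sol (- 1) (\<lambda>t. T - t) {0..T} (\<lambda>t. z (T - t))"
    by (rule sol_time_reversal[of 1 "\<lambda>t. t"]) (rule sol_subset[OF z(1)], auto)
  show ?thesis
  proof (rule that[of "min \<delta>1 (e / exp (L * T))"])
    show "min \<delta>1 (e / exp (L * T)) > 0" using \<delta>1 e by simp
    fix x assume x: "x \<in> X" and d: "dist x (z T) < min \<delta>1 (e / exp (L * T))"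
    obtain u where u: "u 0 = x" "sol (- 1) (\<lambda>t. T - t) {0..T} u"
      by (rule sol_exists[of "- 1" T x "\<lambda>t. T - t"]) (use T x in \<open>auto intro!: continuous_intros\<close>)
    have uT: "u T \<in> X" by (rule sol_in_X[OF u(2)]) (use u x T in auto)
    have "norm (u T - z (T - T)) \<le> exp (L * T) * norm (u 0 - z (T - 0))"
    proof (rule L(2)[OF _ u(2) zb T])
      fix t assume t: "t \<in> {0..T}"
      have "norm (u t) < r"
        by (rule bound[OF u(2) _ _ t]) (use u(1) x \<delta>1(2)[OF x] d in \<open>auto simp: dist_real_def\<close>)
      moreover have "norm (z (T - t)) < r"
        by (rule bound[OF zb _ _ t]) (use zT in auto)
      ultimately show "0 \<le> T - t \<and> u t \<in> ball 0 r \<and> z (T - t) \<in> ball 0 r" using t by simp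
    qed simp
    also have "\<dots> < exp (L * T) * (e / exp (L * T))"
      using d u(1) by (intro mult_strict_left_mono) (auto simp: dist_norm)
    finally have close: "dist (u T) (z 0) < e" by (simp add: dist_norm)
    obtain y where y: "y 0 = u T" "fsol y"
      using fsol_exists[OF uT] by blast
    have us: "sol 1 (\<lambda>t. t) {0..T} (\<lambda>t. u (T - t))"
      using sol_time_reversal[OF u(2)] by simp
    have ys: "sol 1 (\<lambda>t. t) {0..T} y" by (rule sol_subset[OF y(2)]) auto
    have "y T = u (T - T)"
      by (rule sol_unique[OF _ ys us T]) (simp_all add: y(1))
    then show "\<exists>y. fsol y \<and> y 0 \<in> X \<and> dist (y 0) (z 0) < e \<and> y T = x"
      using y uT close u(1) by auto
  qed
qed

definition basin :: "state set" where
  "basin = {x \<in> X. \<exists>z. fsol z \<and> z 0 = x \<and> (z \<longlongrightarrow> e0) at_top}"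

text \<open>A trajectory in the basin reaches the region \<open>V < v\<close>, from which attraction
  is certain; continuous dependence up to that time takes its neighbours there as well.\<close>

lemma openin_basin: "openin (top_of_set X) basin"
  unfolding openin_euclidean_subtopology_iff
proof (intro conjI ballI)
  show "basin \<subseteq> X" by (auto simp: basin_def)
  obtain v where v: "v > 0" "\<And>z t. \<lbrakk>fsol z; z 0 \<in> X; 0 \<le> t; V (z t) < v\<rbrakk> \<Longrightarrow> (z \<longlongrightarrow> e0) at_top"
    using fsol_attracted by blast
  fix x assume "x \<in> basin"
  then obtain z where z: "fsol z" "z 0 \<in> X" "z 0 = x" "(z \<longlongrightarrow> e0) at_top" by (auto simp: basin_def)
  have "((\<lambda>t. V (z t)) \<longlongrightarrow> 0) at_top"
    using fsol_V_lim[OF z(1,2,4) e0_in_X] by (simp add: V_e0)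
  then have "\<forall>\<^sub>F t in at_top. V (z t) < v \<and> t \<ge> 0"
    by (intro eventually_conj order_tendstoD(2)[OF _ v(1)] eventually_ge_at_top)
  then obtain T where T: "0 \<le> T" "V (z T) < v"
    using eventually_happens'[OF trivial_limit_at_top_linorder] by blast
  have zT: "z T \<in> X" by (rule fsol_in_X[OF z(1,2) T(1)])
  obtain \<delta> where \<delta>: "\<delta> > 0" "\<And>y. y \<in> X \<Longrightarrow> dist y (z T) < \<delta> \<Longrightarrow> dist (V y) (V (z T)) < v - V (z T)"
    by (rule V_near[OF zT, of "v - V (z T)"]) (use T(2) in auto)
  obtain e where e: "e > 0" "\<And>y. \<lbrakk>fsol y; y 0 \<in> X; dist (y 0) (z 0) < e\<rbrakk> \<Longrightarrow> dist (y T) (z T) < \<delta>"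
    by (rule fsol_flow_continuous[OF z(1,2) T(1) \<delta>(1)]) blast
  show "\<exists>e>0. \<forall>x'\<in>X. dist x' x < e \<longrightarrow> x' \<in> basin"
  proof (intro exI[of _ e] conjI ballI impI e(1))
    fix x' assume x': "x' \<in> X" "dist x' x < e"
    obtain y where y: "y 0 = x'" "fsol y" using fsol_exists[OF x'(1)] by blast
    have yX: "y 0 \<in> X" using x' y by simp
    have "dist (y T) (z T) < \<delta>" by (rule e(2)) (use y x' z in auto)
    then have "dist (V (y T)) (V (z T)) < v - V (z T)"
      by (intro \<delta>(2) fsol_in_X[OF y(2) yX T(1)])
    then have "V (y T) < v" by (auto simp: dist_real_def)
    then have "(y \<longlongrightarrow> e0) at_top" by (rule v(2)[OF y(2) yX T(1)])
    then show "x' \<in> basin" using x' y by (auto simp: basin_def)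
  qed
qed

lemma basin_nbhd: "\<exists>\<delta>>0. \<forall>x\<in>X. dist x e0 < \<delta> \<longrightarrow> x \<in> basin"
proof -
  obtain z where z: "z 0 = e0" "fsol z" using fsol_exists[OF e0_in_X] by blast
  obtain v where v: "v > 0" "\<And>z t. \<lbrakk>fsol z; z 0 \<in> X; 0 \<le> t; V (z t) < v\<rbrakk> \<Longrightarrow> (z \<longlongrightarrow> e0) at_top"
    using fsol_attracted by blast
  have "(z \<longlongrightarrow> e0) at_top" using v(2)[OF z(2), of 0] z(1) V_e0 v(1) e0_in_X by simp
  then have "e0 \<in> basin" using z e0_in_X by (auto simp: basin_def)
  then show ?thesis
    using openin_basin unfolding openin_euclidean_subtopology_iff by blast
qed

end

subsection \<open>Instability of the saddles\<close>

lemma young: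
  fixes x y :: real
  assumes "0 < a"
  shows "x * y \<le> a * x\<^sup>2 + y\<^sup>2 / (4 * a)"
proof -
  have "0 \<le> (2 * a * x - y)\<^sup>2 / (4 * a)" using assms by simp
  also have "\<dots> = a * x\<^sup>2 - x * y + y\<^sup>2 / (4 * a)"
    using assms by (simp add: power2_eq_square field_simps)
  finally show ?thesis by simp
qed

text \<open>\<open>v\<close>, \<open>y\<close> and \<open>c\<close> stand for the norms of the
  differences in \<open>w\<close>, \<open>y\<close> and \<open>b\<close>. The brackets with
  \<open>\<epsilon>\<close> and \<open>\<zeta>\<close> supply \<open>- k * y\<^sup>2\<close> and
  \<open>- c\<^sup>2\<close>; the other terms they bring are absorbed by Young's inequality if
  \<open>\<zeta>\<close> is small against \<open>\<epsilon>\<close>, and \<open>\<epsilon>\<close>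
  against \<open>d\<close>.\<close>

lemma cross_term_constants:
  fixes d k M :: real
  assumes d: "0 < d" and k: "0 < k" and M: "0 < M"
  obtains \<epsilon> \<zeta> \<kappa> where "0 < \<epsilon>" "\<epsilon> \<le> 1" "0 < \<zeta>" "\<zeta> \<le> 1" "0 < \<kappa>"
    "\<And>v y c. - d * v\<^sup>2 + \<epsilon> * (- k * y\<^sup>2 + M * (v * y) + M * v\<^sup>2 + M * (v * c))
       + \<zeta> * (M * (v * c) - c\<^sup>2 + M * (y * c) + M * y\<^sup>2) \<le> - \<kappa> * (v\<^sup>2 + y\<^sup>2 + c\<^sup>2)"
proof -
  \<comment> \<open>\<open>\<tau>\<close> is the ratio of \<open>\<zeta>\<close> to
    \<open>\<epsilon>\<close>, so small that the \<open>y\<^sup>2\<close> terms from the second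
    bracket cost at most a quarter of \<open>k\<close>.\<close>
  define \<tau> where "\<tau> = min 1 (k / (4 * (M\<^sup>2 / 2 + M)))"
  have M': "0 < M\<^sup>2 / 2 + M" using M by (simp add: add_nonneg_pos)
  have \<tau>: "0 < \<tau>" "\<tau> \<le> 1" using k M' by (auto simp: \<tau>_def)
  have "\<tau> * (M\<^sup>2 / 2 + M) \<le> k / (4 * (M\<^sup>2 / 2 + M)) * (M\<^sup>2 / 2 + M)"
    using M' by (intro mult_right_mono) (auto simp: \<tau>_def)
  also have "k / (4 * (M\<^sup>2 / 2 + M)) * (M\<^sup>2 / 2 + M) = k / 4"
    using M' by (subst times_divide_eq_left, subst mult_divide_mult_cancel_right) auto
  finally have \<tau>k: "\<tau> * (M\<^sup>2 / 2 + M) \<le> k / 4" .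
  \<comment> \<open>\<open>E\<close> collects the coefficients of \<open>v\<^sup>2\<close> from both
    brackets, per unit of \<open>\<epsilon>\<close>; half of the damping \<open>d\<close> is to pay
    for them.\<close>
  define E where "E = M\<^sup>2 / k + M + 2 * M\<^sup>2 / \<tau> + 2 * M\<^sup>2 * \<tau>"
  have E: "0 < E" using M k \<tau> by (auto simp: E_def intro!: add_pos_pos)
  define \<epsilon> where "\<epsilon> = min 1 (d / (2 * E))"
  have \<epsilon>: "0 < \<epsilon>" "\<epsilon> \<le> 1" using d E by (auto simp: \<epsilon>_def)
  have "\<epsilon> * E \<le> d / (2 * E) * E" using E by (intro mult_right_mono) (auto simp: \<epsilon>_def)
  then have \<epsilon>E: "\<epsilon> * E \<le> d / 2" using E by simp
  define \<kappa> where "\<kappa> = min (d / 2) (min (\<epsilon> * (k / 2)) (\<epsilon> * (\<tau> / 4)))"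
  have \<kappa>: "0 < \<kappa>" "\<kappa> \<le> d / 2" "\<kappa> \<le> \<epsilon> * (k / 2)" "\<kappa> \<le> \<epsilon> * (\<tau> / 4)"
    using d k \<epsilon> \<tau> by (auto simp: \<kappa>_def)
  show ?thesis
  proof (rule that[of \<epsilon> "\<epsilon> * \<tau>" \<kappa>])
    fix v y c :: real
    have 1: "M * (v * y) \<le> k / 4 * y\<^sup>2 + M\<^sup>2 / k * v\<^sup>2"
      using young[of "k / 4" y "M * v"] k by (simp add: power_mult_distrib mult_ac)
    have 2: "M * (v * c) \<le> \<tau> / 8 * c\<^sup>2 + 2 * M\<^sup>2 / \<tau> * v\<^sup>2"
      using young[of "\<tau> / 8" c "M * v"] \<tau> by (simp add: power_mult_distrib mult_ac)
    have 3: "M * (v * c) \<le> 1 / 8 * c\<^sup>2 + 2 * M\<^sup>2 * v\<^sup>2"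
      using young[of "1 / 8" c "M * v"] by (simp add: power_mult_distrib mult_ac)
    have 4: "M * (y * c) \<le> 1 / 2 * c\<^sup>2 + M\<^sup>2 / 2 * y\<^sup>2"
      using young[of "1 / 2" c "M * y"] by (simp add: power_mult_distrib mult_ac)
    have A: "- k * y\<^sup>2 + M * (v * y) + M * v\<^sup>2 + M * (v * c)
        \<le> - k * y\<^sup>2 + k / 4 * y\<^sup>2 + \<tau> / 8 * c\<^sup>2 + (M\<^sup>2 / k + M + 2 * M\<^sup>2 / \<tau>) * v\<^sup>2"
      using 1 2 by (simp add: distrib_right)
    have B: "\<tau> * (M * (v * c) - c\<^sup>2 + M * (y * c) + M * y\<^sup>2)
        \<le> \<tau> * (2 * M\<^sup>2 * v\<^sup>2 - 3 / 8 * c\<^sup>2 + (M\<^sup>2 / 2 + M) * y\<^sup>2)"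
      using 3 4 \<tau>(1) by (intro mult_left_mono) (auto simp: algebra_simps)
    have C: "\<tau> * (2 * M\<^sup>2 * v\<^sup>2 - 3 / 8 * c\<^sup>2 + (M\<^sup>2 / 2 + M) * y\<^sup>2)
        \<le> 2 * M\<^sup>2 * \<tau> * v\<^sup>2 - \<tau> * (3 / 8) * c\<^sup>2 + k / 4 * y\<^sup>2"
      using mult_right_mono[OF \<tau>k, of "y\<^sup>2"] by (simp add: algebra_simps)
    have "\<epsilon> * (- k * y\<^sup>2 + M * (v * y) + M * v\<^sup>2 + M * (v * c)) + \<epsilon> * (\<tau> * (M * (v * c) - c\<^sup>2 + M * (y * c) + M * y\<^sup>2))
        \<le> \<epsilon> * ((- k * y\<^sup>2 + k / 4 * y\<^sup>2 + \<tau> / 8 * c\<^sup>2 + (M\<^sup>2 / k + M + 2 * M\<^sup>2 / \<tau>) * v\<^sup>2)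
          + (2 * M\<^sup>2 * \<tau> * v\<^sup>2 - \<tau> * (3 / 8) * c\<^sup>2 + k / 4 * y\<^sup>2))"
      unfolding distrib_left[symmetric] using A B C \<epsilon>(1) by (intro mult_left_mono) linarith+
    also have "\<dots> = \<epsilon> * E * v\<^sup>2 - \<epsilon> * (k / 2) * y\<^sup>2 - \<epsilon> * (\<tau> / 4) * c\<^sup>2"
      by (simp add: E_def algebra_simps)
    also have "\<dots> \<le> d / 2 * v\<^sup>2 - \<epsilon> * (k / 2) * y\<^sup>2 - \<epsilon> * (\<tau> / 4) * c\<^sup>2"
      using mult_right_mono[OF \<epsilon>E, of "v\<^sup>2"] by simp
    finally have "- d * v\<^sup>2 + \<epsilon> * (- k * y\<^sup>2 + M * (v * y) + M * v\<^sup>2 + M * (v * c)) + \<epsilon> * (\<tau> * (M * (v * c) - c\<^sup>2 + M * (y * c) + M * y\<^sup>2))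
        \<le> - (d / 2) * v\<^sup>2 - \<epsilon> * (k / 2) * y\<^sup>2 - \<epsilon> * (\<tau> / 4) * c\<^sup>2" by simp
    also have "\<dots> \<le> - \<kappa> * v\<^sup>2 - \<kappa> * y\<^sup>2 - \<kappa> * c\<^sup>2"
      using mult_right_mono[OF \<kappa>(2), of "v\<^sup>2"] mult_right_mono[OF \<kappa>(3), of "y\<^sup>2"] mult_right_mono[OF \<kappa>(4), of "c\<^sup>2"]
      by simp
    finally show "- d * v\<^sup>2 + \<epsilon> * (- k * y\<^sup>2 + M * (v * y) + M * v\<^sup>2 + M * (v * c))
       + \<epsilon> * \<tau> * (M * (v * c) - c\<^sup>2 + M * (y * c) + M * y\<^sup>2) \<le> - \<kappa> * (v\<^sup>2 + y\<^sup>2 + c\<^sup>2)"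
      by (simp add: algebra_simps)
  qed (use \<epsilon> \<tau> \<kappa> in \<open>auto intro: mult_le_one\<close>)
qed

lemma inner_le_norms: "norm x \<le> a \<Longrightarrow> norm y \<le> b \<Longrightarrow> \<bar>x \<bullet> y\<bar> \<le> a * b"
  by (rule order_trans[OF Cauchy_Schwarz_ineq2]) (auto intro: mult_mono order_trans[OF norm_ge_zero])

lemma mult_abs_mono:
  fixes a x :: real
  assumes "0 \<le> a" "a \<le> M" "\<bar>x\<bar> \<le> b"
  shows "a * x \<le> M * b"
proof -
  have "a * x \<le> a * b" using assms by (intro mult_left_mono) auto
  also have "\<dots> \<le> M * b" using assms by (intro mult_right_mono) auto
  finally show ?thesis .
qed

text \<open>Validity for every \<open>M\<close> beyond \<open>B\<close> lets several maps share one
  constant, formed as a sum.\<close>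

lemma bounded_linear_const: "bounded_linear F \<Longrightarrow> \<exists>B\<ge>1. \<forall>M\<ge>B. \<forall>x. norm (F x) \<le> M * norm x"
proof -
  assume "bounded_linear F"
  then obtain B where B: "\<And>x. norm (F x) \<le> norm x * B" using bounded_linear.bounded by blast
  have "norm (F x) \<le> M * norm x" if "max 1 B \<le> M" for M x
    using B[of x] mult_left_mono[of B M "norm x"] that by (simp add: mult.commute)
  then show ?thesis by (intro exI[of _ "max 1 B"]) auto
qed

lemma bounded_bilinear_const: "bounded_bilinear F \<Longrightarrow> \<exists>B\<ge>1. \<forall>M\<ge>B. \<forall>x y. norm (F x y) \<le> M * norm x * norm y"
proof -
  assume "bounded_bilinear F"
  then obtain B where B: "\<And>x y. norm (F x y) \<le> norm x * norm y * B" using bounded_bilinear.bounded by blast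
  have "norm (F x y) \<le> M * norm x * norm y" if "max 1 B \<le> M" for M x y
    using B[of x y] mult_left_mono[of B M "norm x * norm y"] that by (simp add: mult_ac)
  then show ?thesis by (intro exI[of _ "max 1 B"]) auto
qed

context attitude_error
begin

text \<open>
  The derivative, along the difference of two trajectories near a critical point, of the quadratic form
  \<open>c0/2 y \<bullet> G y + m/2 |w|\<^sup>2 + 1/2 b \<bullet> P b - \<epsilon> R w \<bullet> y - \<zeta> G y \<bullet> R b\<close>, the cross terms of which
  turn the semidefinite dissipation \<open>- w \<bullet> D w\<close> into a definite one.
\<close>
definition form_rate :: "real \<Rightarrow> real^3^3 \<Rightarrow> real \<Rightarrow> real \<Rightarrow> real^3^3 \<Rightarrow> real^3 \<Rightarrow>
    real^3 \<Rightarrow> real^3 \<Rightarrow> real^3 \<Rightarrow> real^3 \<Rightarrow> real^3 \<Rightarrow> real^3 \<Rightarrow> real" where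
  "form_rate c0 G \<epsilon> \<zeta> A o' y w b y' w' b' =
     c0 * ((G *v y) \<bullet> y') + m * (w \<bullet> w') + b \<bullet> (P *v b')
     - \<epsilon> * ((A *v cross3 o' w + A *v w') \<bullet> y + (A *v w) \<bullet> y')
     - \<zeta> * ((G *v y') \<bullet> (A *v b) + (G *v y) \<bullet> (A *v cross3 o' b + A *v b'))"

text \<open>The derivatives inserted are the linearised equations with errors: \<open>e1\<close> in
  the attitude, \<open>e2\<close> in the gyroscopic product, \<open>e3\<close> in the gradient
  force. Without errors the leading terms cancel as in the derivative of \<open>V\<close>. In the
  \<open>\<epsilon>\<close> part the rotation of \<open>A\<close> cancels the gyroscopic term, so
  \<open>o'\<close> survives only in the \<open>\<zeta>\<close> part, where \<open>BO\<close> bounds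
  it.\<close>

lemma form_rate_bound:
  assumes c0: "c0 > 0" and G: "transpose G = G" and GH: "G ** H = mat 1"
  obtains \<epsilon> \<zeta> \<kappa> C where "0 < \<epsilon>" "0 < \<zeta>" "0 < \<kappa>" "0 < C"
    "\<And>A o' y w b e1 e2 e3. \<lbrakk>rotation_matrix A; norm o' \<le> BO\<rbrakk> \<Longrightarrow>
      form_rate c0 G \<epsilon> \<zeta> A o' y w b (- (H *v (A *v w - A *v b)) + e1)
        (- cross3 o' w - e2 + (1 / m) *\<^sub>R (transpose A *v (c0 *\<^sub>R y + e3) - D *v w))
        (- (matrix_inv P *v (transpose A *v (c0 *\<^sub>R y + e3))))
      \<le> - \<kappa> * ((norm w)\<^sup>2 + (norm y)\<^sup>2 + (norm b)\<^sup>2)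
        + C * (norm w + norm y + norm b) * (norm e1 + norm e2 + norm e3)"
proof -
  obtain \<mu> where \<mu>: "\<mu> > 0" "\<And>x. \<mu> * (norm x)\<^sup>2 \<le> x \<bullet> (D *v x)"
    using posdef_lower_bound[OF D] by blast
  obtain B1 where B1: "B1 \<ge> 1" "\<forall>M\<ge>B1. \<forall>x. norm (G *v x) \<le> M * norm x"
    using bounded_linear_const[OF matrix_vector_mult.bounded_linear_right] by blast
  obtain B2 where B2: "B2 \<ge> 1" "\<forall>M\<ge>B2. \<forall>x. norm (H *v x) \<le> M * norm x"
    using bounded_linear_const[OF matrix_vector_mult.bounded_linear_right] by blast
  obtain B3 where B3: "B3 \<ge> 1" "\<forall>M\<ge>B3. \<forall>x. norm (D *v x) \<le> M * norm x"
    using bounded_linear_const[OF matrix_vector_mult.bounded_linear_right] by blast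
  obtain B4 where B4: "B4 \<ge> 1" "\<forall>M\<ge>B4. \<forall>x. norm (matrix_inv P *v x) \<le> M * norm x"
    using bounded_linear_const[OF matrix_vector_mult.bounded_linear_right] by blast
  obtain B5 where B5: "B5 \<ge> 1" "\<forall>M\<ge>B5. \<forall>x y. norm (cross3 x y) \<le> M * norm x * norm y"
    using bounded_bilinear_const[OF bounded_bilinear_cross3] by blast
  \<comment> \<open>\<open>M\<close> is at least 1 and dominates all norms and scalars involved, so
    \<open>M ^ 3\<close> covers products of up to three of them; \<open>max 1 BO\<close> keeps this
    true when \<open>BO\<close> is small.\<close>
  define M where "M = B1 + B2 + B3 + B4 + B5 * max 1 BO + c0 + m + 1 / m"
  have pos: "B5 * max 1 BO \<ge> 1" using B5(1) mult_mono[of 1 B5 1 "max 1 BO"] by auto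
  have im: "1 / m > 0" using m by simp
  have M: "M \<ge> 1" "M \<ge> c0" "M \<ge> m" "M \<ge> 1 / m"
    using B1(1) B2(1) B3(1) B4(1) pos c0 m im unfolding M_def by linarith+
  have MB: "B1 \<le> M" "B2 \<le> M" "B3 \<le> M" "B4 \<le> M"
    using B1(1) B2(1) B3(1) B4(1) pos c0 m im unfolding M_def by linarith+
  have bG: "norm (G *v x) \<le> M * norm x" for x using B1(2) MB by blast
  have bH: "norm (H *v x) \<le> M * norm x" for x using B2(2) MB by blast
  have bD: "norm (D *v x) \<le> M * norm x" for x using B3(2) MB by blast
  have bP: "norm (matrix_inv P *v x) \<le> M * norm x" for x using B4(2) MB by blast
  have bx: "norm (cross3 o' x) \<le> M * norm x" if "norm o' \<le> BO" for o' x
  proof -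
    have "norm (cross3 o' x) \<le> B5 * norm o' * norm x" using B5(2) by blast
    also have "\<dots> \<le> (B5 * max 1 BO) * norm x"
      using that B5(1) by (intro mult_right_mono mult_left_mono) auto
    also have "\<dots> \<le> M * norm x"
      using B1(1) B2(1) B3(1) B4(1) c0 m im unfolding M_def by (intro mult_right_mono) auto
    finally show ?thesis .
  qed
  have M0: "0 \<le> M" using M(1) by simp
  have M2: "M \<le> M\<^sup>2" using M(1) by (simp add: power2_eq_square)
  have M3: "M\<^sup>2 \<le> M ^ 3" using M(1) by (simp add: power_increasing)
  have k: "0 < c0 / m" using c0 m by simp
  have Mp: "0 < M ^ 3" using M(1) by simp
  obtain \<epsilon> \<zeta> \<kappa> where \<epsilon>: "0 < \<epsilon>" "\<epsilon> \<le> 1" and \<zeta>: "0 < \<zeta>" "\<zeta> \<le> 1" and \<kappa>: "0 < \<kappa>"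
    and main: "\<And>v y c. - \<mu> * v\<^sup>2 + \<epsilon> * (- (c0 / m) * y\<^sup>2 + M ^ 3 * (v * y) + M ^ 3 * v\<^sup>2 + M ^ 3 * (v * c))
       + \<zeta> * (M ^ 3 * (v * c) - c\<^sup>2 + M ^ 3 * (y * c) + M ^ 3 * y\<^sup>2) \<le> - \<kappa> * (v\<^sup>2 + y\<^sup>2 + c\<^sup>2)"
    using cross_term_constants[OF \<mu>(1) k Mp] by blast
  show ?thesis
  \<comment> \<open>There are nine error terms: four from the uncorrected form, three with factor
    \<open>\<epsilon>\<close> and two with factor \<open>\<zeta>\<close>. Each is at most
    \<open>M ^ 3\<close> times the product of the two sums of norms.\<close>
  proof (rule that[OF \<epsilon>(1) \<zeta>(1) \<kappa>, of "M ^ 3 * 9"])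
    show "0 < M ^ 3 * 9" using Mp by simp
    fix A :: "real^3^3" and o' y w b e1 e2 e3 :: "real^3"
    assume A: "rotation_matrix A" and o': "norm o' \<le> BO"
    define v c g where "v = A *v w" and "c = A *v b" and "g = c0 *\<^sub>R y + e3"
    have nv: "norm v = norm w" and nc: "norm c = norm b"
      using norm_rotation_mult[OF A] by (auto simp: v_def c_def)
    have bA: "norm (A *v x) = norm x" "norm (transpose A *v x) = norm x" for x
      using norm_rotation_mult[OF A] by auto
    have AA: "A *v (transpose A *v x) = x" for x
      using A by (simp add: matrix_vector_mul_assoc rotation_matrix_def orthogonal_matrix_def)
    have Gs: "(G *v x) \<bullet> z = x \<bullet> (G *v z)" for x z
      using dot_lmul_matrix[of x "transpose G" z] G by (metis transpose_matrix_vector transpose_transpose)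
    have GH': "G *v (H *v x) = x" for x by (simp add: matrix_vector_mul_assoc GH)
    have At: "x \<bullet> (transpose A *v z) = (A *v x) \<bullet> z" for x z
      using dot_lmul_matrix[of z A x] by (simp add: transpose_matrix_vector inner_commute)
    have PP: "P *v (matrix_inv P *v x) = x" for x
      by (simp add: matrix_vector_mul_assoc posdef_inverse[OF P])
    define R1 where "R1 = (G *v y) \<bullet> (A *v (matrix_inv P *v (transpose A *v y)))"
    define R2 where "R2 = (G *v y) \<bullet> (A *v (matrix_inv P *v (transpose A *v e3)))"
    have eq: "form_rate c0 G \<epsilon> \<zeta> A o' y w b (- (H *v (A *v w - A *v b)) + e1)
        (- cross3 o' w - e2 + (1 / m) *\<^sub>R (transpose A *v (c0 *\<^sub>R y + e3) - D *v w))
        (- (matrix_inv P *v (transpose A *v (c0 *\<^sub>R y + e3))))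
      = (- (w \<bullet> (D *v w)) + \<epsilon> * (- (c0 / m) * (norm y)\<^sup>2 + (A *v (D *v w)) \<bullet> y / m + v \<bullet> (H *v v) - v \<bullet> (H *v c))
         + \<zeta> * (v \<bullet> c - (norm c)\<^sup>2 - (G *v y) \<bullet> (A *v cross3 o' b) + c0 * R1))
        + (c0 * ((G *v y) \<bullet> e1) - m * (w \<bullet> e2) + v \<bullet> e3 - c \<bullet> e3
           + \<epsilon> * ((A *v e2) \<bullet> y - e3 \<bullet> y / m - v \<bullet> e1) + \<zeta> * (R2 - (G *v e1) \<bullet> c))"
    proof -
      have t1: "(G *v y) \<bullet> (- (H *v (v - c)) + e1) = - (y \<bullet> v) + y \<bullet> c + (G *v y) \<bullet> e1"
        by (simp add: inner_add_right Gs GH' inner_diff_right)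
      have t2: "m * (w \<bullet> (- cross3 o' w - e2 + (1 / m) *\<^sub>R (transpose A *v g - D *v w)))
          = - m * (w \<bullet> e2) + v \<bullet> g - w \<bullet> (D *v w)"
        using m by (simp add: inner_add_right inner_diff_right dot_cross_self At v_def field_simps)
      have t3: "b \<bullet> (P *v (- (matrix_inv P *v (transpose A *v g)))) = - (c \<bullet> g)"
        by (simp add: matrix_vector_mult.minus_right PP At c_def)
      have t4: "(A *v cross3 o' w + A *v (- cross3 o' w - e2 + (1 / m) *\<^sub>R (transpose A *v g - D *v w))) \<bullet> y
          = - ((A *v e2) \<bullet> y) + (g \<bullet> y) / m - ((A *v (D *v w)) \<bullet> y) / m"
        by (simp add: matrix_vector_mult.add_right matrix_vector_mult.diff_right matrix_vector_mult.minus_right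
            matrix_vector_mult.scaleR_right AA inner_add_left inner_diff_left diff_divide_distrib)
      have t5: "v \<bullet> (- (H *v (v - c)) + e1) = - (v \<bullet> (H *v v)) + v \<bullet> (H *v c) + v \<bullet> e1"
        by (simp add: inner_add_right inner_diff_right matrix_vector_mult.diff_right)
      have t6: "(G *v (- (H *v (v - c)) + e1)) \<bullet> c = - (v \<bullet> c) + (norm c)\<^sup>2 + (G *v e1) \<bullet> c"
        by (simp add: matrix_vector_mult.add_right matrix_vector_mult.minus_right matrix_vector_mult.diff_right GH'
            inner_add_left inner_diff_left power2_norm_eq_inner)
      have t7: "(G *v y) \<bullet> (A *v cross3 o' b + A *v (- (matrix_inv P *v (transpose A *v g))))
          = (G *v y) \<bullet> (A *v cross3 o' b) - c0 * R1 - R2"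
        by (simp add: g_def R1_def R2_def matrix_vector_mult.add_right matrix_vector_mult.minus_right
            matrix_vector_mult.diff_right matrix_vector_mult.scaleR_right inner_add_right inner_diff_right)
      have vg: "v \<bullet> g = c0 * (v \<bullet> y) + v \<bullet> e3" and cg: "c \<bullet> g = c0 * (c \<bullet> y) + c \<bullet> e3"
        and gy: "g \<bullet> y = c0 * (norm y)\<^sup>2 + e3 \<bullet> y" and yv: "y \<bullet> v = v \<bullet> y" and yc: "y \<bullet> c = c \<bullet> y"
        by (simp_all add: g_def inner_add_left inner_add_right power2_norm_eq_inner inner_commute)
      show ?thesis
        unfolding form_rate_def v_def[symmetric] c_def[symmetric] g_def[symmetric] t1 t2 t3 t4 t5 t6 t7 vg cg gy yv yc
        by (simp only: distrib_left distrib_right ring_distribs add_divide_distrib mult_minus_left mult_minus_right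
            minus_add_distrib minus_diff_eq) (simp add: algebra_simps)
    qed
    note nn = norm_ge_zero[of w] norm_ge_zero[of y] norm_ge_zero[of b] norm_ge_zero[of e1] norm_ge_zero[of e2] norm_ge_zero[of e3]
    have le: "M * x \<le> M ^ 3 * x" "M\<^sup>2 * x \<le> M ^ 3 * x" "x \<le> M ^ 3 * x" if "0 \<le> x" for x
      using that M2 M3 M(1) by (auto intro!: mult_right_mono) (metis mult_right_mono mult_1 order_trans)
    have p1: "(A *v (D *v w)) \<bullet> y / m \<le> M ^ 3 * (norm w * norm y)"
    proof -
      have "\<bar>(A *v (D *v w)) \<bullet> y\<bar> \<le> (M * norm w) * norm y"
        by (rule inner_le_norms) (auto simp: bA bD)
      then have "(A *v (D *v w)) \<bullet> y * (1 / m) \<le> (M * norm w * norm y) * M"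
        using M(4) im nn M0 by (intro mult_mono) auto
      also have "\<dots> = M\<^sup>2 * (norm w * norm y)" by (simp add: power2_eq_square mult_ac)
      also have "\<dots> \<le> M ^ 3 * (norm w * norm y)" by (rule le) simp
      finally show ?thesis by simp
    qed
    have p2: "v \<bullet> (H *v v) \<le> M ^ 3 * (norm w)\<^sup>2"
    proof -
      have "\<bar>v \<bullet> (H *v v)\<bar> \<le> norm w * (M * norm w)"
        by (rule inner_le_norms) (use bH[of v] in \<open>auto simp: nv\<close>)
      also have "\<dots> = M * (norm w)\<^sup>2" by (simp add: power2_eq_square)
      also have "\<dots> \<le> M ^ 3 * (norm w)\<^sup>2" by (rule le) simp
      finally show ?thesis by simp
    qed
    have p3: "- (v \<bullet> (H *v c)) \<le> M ^ 3 * (norm w * norm b)"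
    proof -
      have "\<bar>v \<bullet> (H *v c)\<bar> \<le> norm w * (M * norm b)"
        by (rule inner_le_norms) (use bH[of c] in \<open>auto simp: nv nc\<close>)
      also have "\<dots> = M * (norm w * norm b)" by simp
      also have "\<dots> \<le> M ^ 3 * (norm w * norm b)" by (rule le) simp
      finally show ?thesis by simp
    qed
    have p4: "v \<bullet> c \<le> M ^ 3 * (norm w * norm b)"
    proof -
      have "\<bar>v \<bullet> c\<bar> \<le> norm w * norm b" by (rule inner_le_norms) (auto simp: nv nc)
      also have "\<dots> \<le> M ^ 3 * (norm w * norm b)" by (rule le) simp
      finally show ?thesis by simp
    qed
    have p5: "- ((G *v y) \<bullet> (A *v cross3 o' b)) \<le> M ^ 3 * (norm y * norm b)"
    proof -
      have "\<bar>(G *v y) \<bullet> (A *v cross3 o' b)\<bar> \<le> (M * norm y) * (M * norm b)"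
        by (rule inner_le_norms) (auto simp: bA bG bx[OF o'])
      also have "\<dots> = M\<^sup>2 * (norm y * norm b)" by (simp add: power2_eq_square)
      also have "\<dots> \<le> M ^ 3 * (norm y * norm b)" by (rule le) simp
      finally show ?thesis by simp
    qed
    have bR: "\<bar>(G *v y) \<bullet> (A *v (matrix_inv P *v (transpose A *v x)))\<bar> \<le> M\<^sup>2 * (norm y * norm x)" for x
    proof -
      have "\<bar>(G *v y) \<bullet> (A *v (matrix_inv P *v (transpose A *v x)))\<bar> \<le> (M * norm y) * (M * norm x)"
        by (rule inner_le_norms) (use bP[of "transpose A *v x"] in \<open>auto simp: bA bG\<close>)
      then show ?thesis by (simp add: power2_eq_square mult_ac)
    qed
    have p6: "c0 * R1 \<le> M ^ 3 * (norm y)\<^sup>2"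
    proof -
      have "c0 * R1 \<le> M * (M\<^sup>2 * (norm y * norm y))"
        using bR[of y] c0 M unfolding R1_def by (intro mult_abs_mono) auto
      then show ?thesis by (simp add: power2_eq_square power3_eq_cube mult_ac)
    qed
    have mainle: "- (w \<bullet> (D *v w)) + \<epsilon> * (- (c0 / m) * (norm y)\<^sup>2 + (A *v (D *v w)) \<bullet> y / m + v \<bullet> (H *v v) - v \<bullet> (H *v c))
         + \<zeta> * (v \<bullet> c - (norm c)\<^sup>2 - (G *v y) \<bullet> (A *v cross3 o' b) + c0 * R1)
       \<le> - \<kappa> * ((norm w)\<^sup>2 + (norm y)\<^sup>2 + (norm b)\<^sup>2)"
    proof -
      have 1: "- (w \<bullet> (D *v w)) \<le> - \<mu> * (norm w)\<^sup>2" using \<mu>(2)[of w] by simp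
      have 2: "- (c0 / m) * (norm y)\<^sup>2 + (A *v (D *v w)) \<bullet> y / m + v \<bullet> (H *v v) - v \<bullet> (H *v c)
          \<le> - (c0 / m) * (norm y)\<^sup>2 + M ^ 3 * (norm w * norm y) + M ^ 3 * (norm w)\<^sup>2 + M ^ 3 * (norm w * norm b)"
        using p1 p2 p3 by linarith
      have 3: "v \<bullet> c - (norm c)\<^sup>2 - (G *v y) \<bullet> (A *v cross3 o' b) + c0 * R1
          \<le> M ^ 3 * (norm w * norm b) - (norm b)\<^sup>2 + M ^ 3 * (norm y * norm b) + M ^ 3 * (norm y)\<^sup>2"
        using p4 p5 p6 unfolding nc by linarith
      show ?thesis
        using add_mono[OF add_mono[OF 1 mult_left_mono[OF 2]] mult_left_mono[OF 3], of \<epsilon> \<zeta>] \<epsilon>(1) \<zeta>(1)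
          main[of "norm w" "norm y" "norm b"]
        by linarith
    qed
    define N e where "N = norm w + norm y + norm b" and "e = norm e1 + norm e2 + norm e3"
    have N: "norm w \<le> N" "norm y \<le> N" "norm b \<le> N" "0 \<le> N" and e: "norm e1 \<le> e" "norm e2 \<le> e" "norm e3 \<le> e" "0 \<le> e"
      using nn by (auto simp: N_def e_def)
    have Ne: "0 \<le> N * e" using N e by simp
    have ne: "\<bar>x \<bullet> z\<bar> \<le> M ^ 3 * (N * e)" if "norm x \<le> N" "norm z \<le> e" for x z :: "real^3"
      using inner_le_norms[OF that] le(3)[OF Ne] by linarith
    have q1: "c0 * ((G *v y) \<bullet> e1) \<le> M ^ 3 * (N * e)"
    proof -
      have "\<bar>(G *v y) \<bullet> e1\<bar> \<le> (M * N) * e"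
        by (rule inner_le_norms[OF order_trans[OF bG] e(1)]) (intro mult_left_mono N M0)
      then have "c0 * ((G *v y) \<bullet> e1) \<le> M * ((M * N) * e)"
        using c0 M by (intro mult_abs_mono) auto
      also have "\<dots> = M\<^sup>2 * (N * e)" by (simp add: power2_eq_square mult_ac)
      also have "\<dots> \<le> M ^ 3 * (N * e)" by (rule le) (rule Ne)
      finally show ?thesis .
    qed
    have q2: "- (m * (w \<bullet> e2)) \<le> M ^ 3 * (N * e)"
    proof -
      have "m * (- (w \<bullet> e2)) \<le> M * (N * e)"
        using inner_le_norms[OF N(1) e(2)] m M by (intro mult_abs_mono) auto
      also have "\<dots> \<le> M ^ 3 * (N * e)" by (rule le) (rule Ne)
      finally show ?thesis by simp
    qed
    have q3: "v \<bullet> e3 \<le> M ^ 3 * (N * e)" using ne[of v e3] N e by (simp add: nv)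
    have q4: "- (c \<bullet> e3) \<le> M ^ 3 * (N * e)" using ne[of c e3] N e by (simp add: nc)
    have q5: "(A *v e2) \<bullet> y \<le> M ^ 3 * (N * e)" using ne[of y "A *v e2"] N e by (simp add: bA inner_commute)
    have q6: "- (e3 \<bullet> y / m) \<le> M ^ 3 * (N * e)"
    proof -
      have "(1 / m) * (- (e3 \<bullet> y)) \<le> M * (N * e)"
        using inner_le_norms[OF N(2) e(3)] im M by (intro mult_abs_mono) (auto simp: inner_commute)
      also have "\<dots> \<le> M ^ 3 * (N * e)" by (rule le) (rule Ne)
      finally show ?thesis by simp
    qed
    have q7: "- (v \<bullet> e1) \<le> M ^ 3 * (N * e)" using ne[of v e1] N e by (simp add: nv)
    have q8: "R2 \<le> M ^ 3 * (N * e)"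
    proof -
      have "R2 \<le> M\<^sup>2 * (norm y * norm e3)" using bR[of e3] unfolding R2_def by linarith
      also have "\<dots> \<le> M\<^sup>2 * (N * e)" by (intro mult_left_mono mult_mono N e) auto
      also have "\<dots> \<le> M ^ 3 * (N * e)" by (rule le) (rule Ne)
      finally show ?thesis .
    qed
    have q9: "- ((G *v e1) \<bullet> c) \<le> M ^ 3 * (N * e)"
    proof -
      have "\<bar>(G *v e1) \<bullet> c\<bar> \<le> (M * e) * N"
        by (rule inner_le_norms[OF order_trans[OF bG]]) (use e N M0 in \<open>auto simp: nc intro: mult_left_mono\<close>)
      also have "\<dots> = M * (N * e)" by simp
      also have "\<dots> \<le> M ^ 3 * (N * e)" by (rule le) (rule Ne)
      finally show ?thesis by simp
    qed
    have r1: "\<epsilon> * ((A *v e2) \<bullet> y - e3 \<bullet> y / m - v \<bullet> e1) \<le> 1 * (3 * (M ^ 3 * (N * e)))"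
      using q5 q6 q7 \<epsilon> le(3)[OF Ne] Ne by (intro order_trans[OF mult_left_mono[of _ "3 * (M ^ 3 * (N * e))"] mult_right_mono]) auto
    have r2: "\<zeta> * (R2 - (G *v e1) \<bullet> c) \<le> 1 * (2 * (M ^ 3 * (N * e)))"
      using q8 q9 \<zeta> le(3)[OF Ne] Ne by (intro order_trans[OF mult_left_mono[of _ "2 * (M ^ 3 * (N * e))"] mult_right_mono]) auto
    have "M ^ 3 * 9 * (norm w + norm y + norm b) * (norm e1 + norm e2 + norm e3) = 9 * (M ^ 3 * (N * e))"
      by (simp add: N_def e_def)
    then show "form_rate c0 G \<epsilon> \<zeta> A o' y w b (- (H *v (A *v w - A *v b)) + e1)
        (- cross3 o' w - e2 + (1 / m) *\<^sub>R (transpose A *v (c0 *\<^sub>R y + e3) - D *v w))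
        (- (matrix_inv P *v (transpose A *v (c0 *\<^sub>R y + e3))))
      \<le> - \<kappa> * ((norm w)\<^sup>2 + (norm y)\<^sup>2 + (norm b)\<^sup>2)
        + M ^ 3 * 9 * (norm w + norm y + norm b) * (norm e1 + norm e2 + norm e3)"
      unfolding eq using mainle q1 q2 q3 q4 r1 r2 by linarith
  qed
qed

end

context attitude_error
begin

section \<open>Differences of two trajectories near a critical point\<close>

lemma norm_constants:
  obtains B where "2 \<le> B"
    "\<And>(X :: real^3^3) (Y :: real^3^3). norm (X ** Y) \<le> B * norm X * norm Y"
    "\<And>X :: real^3^3. norm (transpose X) \<le> B * norm X"
    "\<And>a. norm (skew a) \<le> B * norm a" "\<And>X. norm (axl X) \<le> B * norm X"
    "\<And>X. norm (s X) \<le> B * norm X" "\<And>x. norm (G *v x) \<le> B * norm (x :: real^3)"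
    "\<And>x y. norm (cross3 x y) \<le> B * norm x * norm y"
    "\<And>Q Q'. rotation_matrix Q \<Longrightarrow> rotation_matrix Q' \<Longrightarrow> \<bar>\<phi> (U Q) - \<phi> (U Q')\<bar> \<le> B * norm (Q - Q')"
proof -
  obtain B1 where B1: "B1 \<ge> 1" "\<forall>M\<ge>B1. \<forall>(X :: real^3^3) (Y :: real^3^3). norm (X ** Y) \<le> M * norm X * norm Y"
    using bounded_bilinear_const[OF bounded_bilinear_matrix_mult] by blast
  obtain B2 where B2: "B2 \<ge> 1" "\<forall>M\<ge>B2. \<forall>X :: real^3^3. norm (transpose X) \<le> M * norm X"
    using bounded_linear_const[OF bounded_linear_transpose] by blast
  obtain B3 where B3: "B3 \<ge> 1" "\<forall>M\<ge>B3. \<forall>x. norm (skew x) \<le> M * norm x"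
    using bounded_linear_const[OF bounded_linear_skew] by blast
  obtain B4 where B4: "B4 \<ge> 1" "\<forall>M\<ge>B4. \<forall>x. norm (axl x) \<le> M * norm x"
    using bounded_linear_const[OF bounded_linear_axl] by blast
  obtain B5 where B5: "B5 \<ge> 1" "\<forall>M\<ge>B5. \<forall>x. norm (s x) \<le> M * norm x"
    using bounded_linear_const[OF bounded_linear_s] by blast
  obtain B6 where B6: "B6 \<ge> 1" "\<forall>M\<ge>B6. \<forall>x. norm (G *v x) \<le> M * norm x"
    using bounded_linear_const[OF matrix_vector_mult.bounded_linear_right] by blast
  obtain B7 where B7: "B7 \<ge> 1" "\<forall>M\<ge>B7. \<forall>x y. norm (cross3 x y) \<le> M * norm x * norm y"
    using bounded_bilinear_const[OF bounded_bilinear_cross3] by blast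
  have "ulip {()} {Q. rotation_matrix Q} (\<lambda>_ Q. \<phi> \<bar>U Q\<bar>)"
    unfolding U_def
    by (intro ulip_compose[OF \<phi>_lip] ulip_diff ulip_const ulip_linear[OF bounded_linear_trace]
        ulip_bilinear[OF bounded_bilinear_matrix_mult] ulip_id compact_imp_bounded compact_rotations)
  then obtain B8 where B8: "B8 > 0" "\<And>Q Q'. rotation_matrix Q \<Longrightarrow> rotation_matrix Q' \<Longrightarrow> \<bar>\<phi> \<bar>U Q\<bar> - \<phi> \<bar>U Q'\<bar>\<bar> \<le> B8 * norm (Q - Q')"
    by (rule ulipE) auto
  define B where "B = B1 + B2 + B3 + B4 + B5 + B6 + B7 + B8"
  have le: "B1 \<le> B" "B2 \<le> B" "B3 \<le> B" "B4 \<le> B" "B5 \<le> B" "B6 \<le> B" "B7 \<le> B" "B8 \<le> B" "2 \<le> B"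
    using B1(1) B2(1) B3(1) B4(1) B5(1) B6(1) B7(1) B8(1) by (auto simp: B_def)
  show ?thesis
  proof (rule that[OF le(9)])
    fix Q Q' :: "real^3^3" assume Q: "rotation_matrix Q" "rotation_matrix Q'"
    have "\<bar>\<phi> (U Q) - \<phi> (U Q')\<bar> \<le> B8 * norm (Q - Q')"
      using B8(2)[OF Q] U_nonneg[OF Q(1)] U_nonneg[OF Q(2)] by simp
    also have "\<dots> \<le> B * norm (Q - Q')" by (intro mult_right_mono le) simp
    finally show "\<bar>\<phi> (U Q) - \<phi> (U Q')\<bar> \<le> B * norm (Q - Q')" .
  qed (rule B1(2)[rule_format, OF le(1)] B2(2)[rule_format, OF le(2)] B3(2)[rule_format, OF le(3)]
      B4(2)[rule_format, OF le(4)] B5(2)[rule_format, OF le(5)] B6(2)[rule_format, OF le(6)] B7(2)[rule_format, OF le(7)])+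
qed

text \<open>These are the errors \<open>e1\<close>, \<open>e2\<close>, \<open>e3\<close> of
  \<open>form_rate_bound\<close>. As differences of linearisation remainders at two states within
  \<open>\<eta>\<close> of the critical point, they carry a factor \<open>\<eta>\<close>.
  Invertibility of the Hessian is what allows the attitude difference to be measured by
  \<open>s (Q1 - Q2)\<close>.\<close>

lemma difference_estimates:
  assumes Qc: "Qc \<in> crit" and sH: "\<And>a. s (skew a ** Qc) = - (H *v a)" and GH: "G ** H = mat 1"
  obtains C \<eta>0 where "0 < C" "0 < \<eta>0"
    "\<And>\<eta> A Q1 w1 b1 Q2 w2 b2. \<lbrakk>0 < \<eta>; \<eta> \<le> \<eta>0; rotation_matrix A; rotation_matrix Q1; rotation_matrix Q2;
      norm (Q1 - Qc) \<le> \<eta>; norm (Q2 - Qc) \<le> \<eta>; norm w1 \<le> \<eta>; norm w2 \<le> \<eta>; norm b1 \<le> \<eta>; norm b2 \<le> \<eta>\<rbrakk> \<Longrightarrow>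
      norm (s (skew (A *v (w1 - b1)) ** Q1) - s (skew (A *v (w2 - b2)) ** Q2) + H *v (A *v (w1 - w2) - A *v (b1 - b2)))
        \<le> C * \<eta> * (norm (w1 - w2) + norm (s (Q1 - Q2)) + norm (b1 - b2)) \<and>
      norm (cross3 b1 w1 - cross3 b2 w2) \<le> C * \<eta> * (norm (w1 - w2) + norm (s (Q1 - Q2)) + norm (b1 - b2)) \<and>
      norm (h Q1 - h Q2 - \<phi> (U Qc) *\<^sub>R s (Q1 - Q2)) \<le> C * \<eta> * (norm (w1 - w2) + norm (s (Q1 - Q2)) + norm (b1 - b2))"
proof -
  obtain B where B: "2 \<le> B"
    and mm: "\<And>(X :: real^3^3) (Y :: real^3^3). norm (X ** Y) \<le> B * norm X * norm Y"
    and tt: "\<And>X :: real^3^3. norm (transpose X) \<le> B * norm X"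
    and sk: "\<And>a. norm (skew a) \<le> B * norm a" and ax: "\<And>X. norm (axl X) \<le> B * norm X"
    and ss: "\<And>X. norm (s X) \<le> B * norm X" and gg: "\<And>x. norm (G *v x) \<le> B * norm (x :: real^3)"
    and cc: "\<And>x y. norm (cross3 x y) \<le> B * norm x * norm y"
    and pp: "\<And>Q Q'. rotation_matrix Q \<Longrightarrow> rotation_matrix Q' \<Longrightarrow> \<bar>\<phi> (U Q) - \<phi> (U Q')\<bar> \<le> B * norm (Q - Q')"
    using norm_constants[of G] by blast
  have B0: "0 \<le> B" "1 \<le> B" using B by auto
  have B1: "B ^ i \<le> B ^ j" if "i \<le> j" for i j by (rule power_increasing[OF that B0(2)])
  have mm': "norm (X ** Y) \<le> B * x * y" if "norm X \<le> x" "norm Y \<le> y" for X Y :: "real^3^3" and x y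
  proof -
    have "norm (X ** Y) \<le> B * norm X * norm Y" by (rule mm)
    also have "\<dots> \<le> B * x * y"
      by (intro mult_mono mult_left_mono) (use that B0 order_trans[OF norm_ge_zero that(1)] in auto)
    finally show ?thesis .
  qed
  have sk': "norm (skew a) \<le> B * x" if "norm a \<le> x" for a x
    by (rule order_trans[OF sk]) (use that B0 in \<open>auto intro!: mult_left_mono\<close>)
  have ss': "norm (s X) \<le> B * x" if "norm X \<le> x" for X x
    by (rule order_trans[OF ss]) (use that B0 in \<open>auto intro!: mult_left_mono\<close>)
  have rot: "norm Q \<le> B" if "rotation_matrix Q" for Q :: "real^3^3"
  proof -
    have "sqrt 3 \<le> 2" using real_sqrt_le_iff[of 3 4] real_sqrt_four by linarith
    then show ?thesis using norm_rotation[OF that] B by simp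
  qed
  have sQc: "s Qc = 0" and rQc: "rotation_matrix Qc" using Qc by (auto simp: crit_def)
  \<comment> \<open>Makes the second-order terms in \<open>key\<close>, which are at most
    \<open>4 * B ^ 13 * \<eta> * norm q\<close>, no larger than half of \<open>norm q\<close>, so
    that they can be absorbed.\<close>
  define \<eta>0 where "\<eta>0 = 1 / (8 * B ^ 13)"
  have \<eta>0: "0 < \<eta>0" using B by (simp add: \<eta>0_def)
  \<comment> \<open>\<open>s\<close> is an immersion of the rotations at \<open>Qc\<close>; the skew part \<open>a\<close> of \<open>(Q1 - Q2) Q2\<^sup>T\<close> determines \<open>Q1 - Q2\<close> up to second order.\<close>
  have key: "norm (Q1 - Q2) \<le> 2 * B ^ 4 * norm (s (Q1 - Q2))"
    if \<eta>: "0 < \<eta>" "\<eta> \<le> \<eta>0" and r: "rotation_matrix Q1" "rotation_matrix Q2"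
      and n: "norm (Q1 - Qc) \<le> \<eta>" "norm (Q2 - Qc) \<le> \<eta>" for \<eta> Q1 Q2
  proof -
    define q where "q = Q1 - Q2"
    define Z where "Z = q ** transpose Q2"
    define a where "a = (1/2) *\<^sub>R axl Z"
    have o1: "Q1 ** transpose Q1 = mat 1" "Q2 ** transpose Q2 = mat 1" "transpose Q2 ** Q2 = mat 1" "transpose Q1 ** Q1 = mat 1"
      using r by (auto simp: rotation_matrix_def orthogonal_matrix_def)
    have qZ: "q = Z ** Q2" by (simp add: Z_def o1 flip: matrix_mul_assoc)
    have Zf: "Z = Q1 ** transpose Q2 - mat 1" by (simp add: Z_def q_def matrix_mult.diff_left o1)
    have tZ: "transpose Z = Q2 ** transpose Q1 - mat 1"
      using transpose_diff[of "Q1 ** transpose Q2" "mat 1"]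
      by (simp add: Zf matrix_transpose_mul)
    \<comment> \<open>Orthogonality of \<open>mat 1 + Z = Q1 ** transpose Q2\<close>: the symmetric
      part of \<open>Z\<close> is quadratic in \<open>Z\<close>, so to first order \<open>Z\<close>
      is its skew part.\<close>
    have ZZ: "Z ** transpose Z = - Z - transpose Z"
    proof -
      have "(Q1 ** transpose Q2) ** (Q2 ** transpose Q1) = Q1 ** (transpose Q2 ** Q2) ** transpose Q1"
        by (simp add: matrix_mul_assoc)
      then have "(Q1 ** transpose Q2) ** (Q2 ** transpose Q1) = mat 1" by (simp add: o1)
      then show ?thesis
        unfolding tZ unfolding Zf by (simp add: matrix_mult.diff_left matrix_mult.diff_right)
    qed
    have ska: "skew a = (1/2) *\<^sub>R (Z - transpose Z)"
      by (simp add: a_def skew_scaleR skew_axl)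
    have Zs: "Z = skew a - (1/2) *\<^sub>R (Z ** transpose Z)"
      unfolding ZZ ska by (simp add: scaleR_diff_right scaleR_minus_right algebra_simps flip: scaleR_add_left scaleR_left_distrib)
    define \<rho> where "\<rho> = skew a ** (Q2 - Qc) - (1/2) *\<^sub>R ((Z ** transpose Z) ** Q2)"
    have q_split: "q = skew a ** Qc + \<rho>"
    proof -
      have "q = (skew a - (1/2) *\<^sub>R (Z ** transpose Z)) ** Q2" using qZ Zs by simp
      then show ?thesis by (simp add: \<rho>_def matrix_mult.diff_left matrix_mult.diff_right matrix_mult.scaleR_left)
    qed
    have nq: "norm q \<le> 2 * \<eta>"
      using n norm_triangle_ineq4[of "Q1 - Qc" "Q2 - Qc"] by (simp add: q_def)
    have nZ: "norm Z \<le> B ^ 2 * norm q"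
      using mm'[OF order_refl rot[OF rotation_matrix_transpose[OF r(2)]], of q]
      by (simp add: Z_def power2_eq_square mult_ac)
    have na: "norm a \<le> B ^ 3 * norm q"
    proof -
      have "norm a \<le> norm (axl Z)" by (simp add: a_def)
      also have "\<dots> \<le> B * norm Z" by (rule ax)
      also have "\<dots> \<le> B * (B ^ 2 * norm q)" by (intro mult_left_mono nZ B0)
      finally show ?thesis by (simp add: eval_nat_numeral mult_ac)
    qed
    have ntZ: "norm (transpose Z) \<le> B ^ 3 * norm q"
    proof -
      have "norm (transpose Z) \<le> B * norm Z" by (rule tt)
      also have "\<dots> \<le> B * (B ^ 2 * norm q)" by (intro mult_left_mono nZ B0)
      finally show ?thesis by (simp add: eval_nat_numeral mult_ac)
    qed
    have n\<rho>: "norm \<rho> \<le> 2 * B ^ 8 * \<eta> * norm q"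
    proof -
      have 1: "norm (skew a ** (Q2 - Qc)) \<le> B ^ 8 * \<eta> * norm q"
      proof -
        have "norm (skew a ** (Q2 - Qc)) \<le> B * (B * (B ^ 3 * norm q)) * \<eta>" by (intro mm' sk' na n)
        also have "\<dots> = B ^ 5 * (\<eta> * norm q)" by (simp add: eval_nat_numeral mult_ac)
        also have "\<dots> \<le> B ^ 8 * (\<eta> * norm q)" using \<eta> by (intro mult_right_mono B1) auto
        finally show ?thesis by (simp add: mult_ac)
      qed
      have 2: "norm ((1/2) *\<^sub>R ((Z ** transpose Z) ** Q2)) \<le> B ^ 8 * \<eta> * norm q"
      proof -
        have "norm ((Z ** transpose Z) ** Q2) \<le> B * (B * (B ^ 2 * norm q) * (B ^ 3 * norm q)) * B"
          by (intro mm' nZ ntZ rot r)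
        also have "\<dots> = B ^ 8 * norm q * norm q" by (simp add: eval_nat_numeral mult_ac)
        also have "\<dots> \<le> B ^ 8 * norm q * (2 * \<eta>)" using B0 by (intro mult_left_mono nq) auto
        finally show ?thesis by (simp add: mult_ac)
      qed
      show ?thesis unfolding \<rho>_def using norm_triangle_le_diff[OF add_mono[OF 1 2]] by (simp add: mult_ac)
    qed
    have na': "norm a \<le> B * norm (s q) + 2 * B ^ 10 * \<eta> * norm q"
    proof -
      have "s q = - (H *v a) + s \<rho>" using q_split by (simp add: s_add sH)
      \<comment> \<open>The inverse Hessian recovers \<open>a\<close> from \<open>s q\<close>, up to
        the image of the remainder \<open>\<rho>\<close>.\<close>
      then have "G *v (s \<rho> - s q) = a" by (simp add: matrix_vector_mul_assoc GH)
      then have "norm a \<le> B * norm (s \<rho> - s q)" using gg[of "s \<rho> - s q"] by simp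
      also have "\<dots> \<le> B * (norm (s q) + B * (2 * B ^ 8 * \<eta> * norm q))"
        using norm_triangle_ineq4[of "s \<rho>" "s q"] ss'[OF n\<rho>] B0 by (intro mult_left_mono) auto
      also have "\<dots> = B * norm (s q) + 2 * B ^ 10 * \<eta> * norm q"
        by (simp add: eval_nat_numeral algebra_simps)
      finally show ?thesis .
    qed
    have "norm q \<le> norm (skew a ** Qc) + norm \<rho>" unfolding q_split by (rule norm_triangle_ineq)
    also have "\<dots> \<le> B * (B * (B * norm (s q) + 2 * B ^ 10 * \<eta> * norm q)) * B + 2 * B ^ 8 * \<eta> * norm q"
      by (intro add_mono n\<rho> mm' sk' na' rot rQc)
    also have "\<dots> = B ^ 4 * norm (s q) + 2 * B ^ 13 * (\<eta> * norm q) + 2 * (B ^ 8 * (\<eta> * norm q))"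
      by (simp add: eval_nat_numeral algebra_simps)
    also have "\<dots> \<le> B ^ 4 * norm (s q) + 2 * B ^ 13 * (\<eta> * norm q) + 2 * (B ^ 13 * (\<eta> * norm q))"
      using \<eta> by (intro add_mono mult_left_mono mult_right_mono B1) auto
    also have "\<dots> = B ^ 4 * norm (s q) + (4 * B ^ 13 * \<eta>) * norm q" by simp
    also have "\<dots> \<le> B ^ 4 * norm (s q) + (1 / 2) * norm q"
    proof -
      have "4 * B ^ 13 * \<eta> \<le> 4 * B ^ 13 * \<eta>0" using \<eta> B0 by (intro mult_left_mono) auto
      also have "\<dots> = 1 / 2" using B by (simp add: \<eta>0_def)
      finally show ?thesis by (intro add_left_mono mult_right_mono) auto
    qed
    finally show ?thesis by (simp add: q_def)
  qed
  show ?thesis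
  proof (rule that[of "5 * B ^ 7" \<eta>0])
    show "0 < 5 * B ^ 7" using B by simp
    fix \<eta> :: real and A Q1 Q2 :: "real^3^3" and w1 b1 w2 b2 :: "real^3"
    assume \<eta>: "0 < \<eta>" "\<eta> \<le> \<eta>0" and A: "rotation_matrix A" and r: "rotation_matrix Q1" "rotation_matrix Q2"
      and n: "norm (Q1 - Qc) \<le> \<eta>" "norm (Q2 - Qc) \<le> \<eta>"
      and nw: "norm w1 \<le> \<eta>" "norm w2 \<le> \<eta>" and nb: "norm b1 \<le> \<eta>" "norm b2 \<le> \<eta>"
    define q y N where "q = Q1 - Q2" and "y = s q" and "N = norm (w1 - w2) + norm y + norm (b1 - b2)"
    have kq: "norm q \<le> 2 * B ^ 4 * norm y" using key[OF \<eta> r n] by (simp add: q_def y_def)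
    have N: "norm (w1 - w2) + norm (b1 - b2) \<le> N" "norm y \<le> N" "0 \<le> N" by (auto simp: N_def)
    have N\<eta>: "0 \<le> \<eta> * N" using N \<eta> by simp
    have kq': "norm q \<le> 2 * B ^ 4 * N"
      by (rule order_trans[OF kq]) (use B0 N in \<open>auto intro: mult_left_mono\<close>)
    define \<delta> v2 where "\<delta> = A *v (w1 - w2) - A *v (b1 - b2)" and "v2 = A *v (w2 - b2)"
    have v1: "A *v (w1 - b1) = \<delta> + v2"
      by (simp add: \<delta>_def v2_def flip: matrix_vector_mult.diff_right matrix_vector_mult.add_right)
    have n\<delta>: "norm \<delta> \<le> N"
      using norm_triangle_ineq4[of "A *v (w1 - w2)" "A *v (b1 - b2)"] norm_rotation_mult(1)[OF A] N(1)
      by (simp add: \<delta>_def)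
    have nv2: "norm v2 \<le> 2 * \<eta>"
      using norm_triangle_ineq4[of w2 b2] nw nb norm_rotation_mult(1)[OF A] by (simp add: v2_def)
    \<comment> \<open>The linear parts cancel exactly, because \<open>H *v \<delta>\<close> is
      \<open>- s (skew \<delta> ** Qc)\<close>. In each remaining product one factor is of order
      \<open>\<eta>\<close>.\<close>
    have "s (skew (\<delta> + v2) ** Q1) - s (skew v2 ** Q2) + H *v \<delta> = s (skew \<delta> ** (Q1 - Qc) + skew v2 ** q)"
      using sH[of \<delta>] skew_add[of \<delta> v2]
      by (simp add: q_def s_add s_diff matrix_mult.diff_right matrix_mult.add_left)
    also have "norm \<dots> \<le> B * (B * (B * N) * \<eta> + B * (B * (2 * \<eta>)) * (2 * B ^ 4 * N))"
      by (intro ss' norm_triangle_mono mm' sk' n\<delta> nv2 n kq')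
    also have "\<dots> = B ^ 3 * (\<eta> * N) + 4 * (B ^ 7 * (\<eta> * N))" by (simp add: eval_nat_numeral algebra_simps)
    also have "\<dots> \<le> B ^ 7 * (\<eta> * N) + 4 * (B ^ 7 * (\<eta> * N))" by (intro add_right_mono mult_right_mono B1 N\<eta>) simp
    finally have g1: "norm (s (skew (A *v (w1 - b1)) ** Q1) - s (skew (A *v (w2 - b2)) ** Q2) + H *v (A *v (w1 - w2) - A *v (b1 - b2)))
        \<le> 5 * B ^ 7 * \<eta> * N" unfolding v1 by (simp add: \<delta>_def v2_def mult_ac)
    have "cross3 b1 w1 - cross3 b2 w2 = cross3 (b1 - b2) w1 + cross3 b2 (w1 - w2)"
      by (simp add: cross3.diff_left cross3.diff_right)
    also have "norm \<dots> \<le> B * norm (b1 - b2) * \<eta> + B * \<eta> * norm (w1 - w2)"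
      using B0 \<eta> nw nb by (intro norm_triangle_mono order_trans[OF cc] mult_mono) auto
    also have "\<dots> = B ^ 1 * (\<eta> * (norm (w1 - w2) + norm (b1 - b2)))" by (simp add: algebra_simps)
    also have "\<dots> \<le> B ^ 7 * (\<eta> * N)" using N \<eta> B0 by (intro mult_mono B1) auto
    also have "\<dots> \<le> 5 * (B ^ 7 * (\<eta> * N))" using mult_nonneg_nonneg[OF zero_le_power[OF B0(1), of 7] N\<eta>] by linarith
    finally have g2: "norm (cross3 b1 w1 - cross3 b2 w2) \<le> 5 * B ^ 7 * \<eta> * N" by (simp add: mult_ac)
    \<comment> \<open>The first product has a weight difference of order \<open>\<eta>\<close>. In
      the second the weight differs by the order of \<open>q\<close>, and \<open>s (Q2 - Qc)\<close>
      is of order \<open>\<eta>\<close>.\<close>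
    have "h Q1 - h Q2 - \<phi> (U Qc) *\<^sub>R s (Q1 - Q2) = (\<phi> (U Q1) - \<phi> (U Qc)) *\<^sub>R y + (\<phi> (U Q1) - \<phi> (U Q2)) *\<^sub>R s (Q2 - Qc)"
      using U_nonneg r by (simp add: h_def y_def q_def s_diff sQc algebra_simps)
    also have "norm \<dots> \<le> B * \<eta> * N + (B * (2 * B ^ 4 * N)) * (B * \<eta>)"
    proof (rule norm_triangle_mono)
      show "norm ((\<phi> (U Q1) - \<phi> (U Qc)) *\<^sub>R y) \<le> B * \<eta> * N"
        unfolding norm_scaleR using n N B0 \<eta>
        by (intro mult_mono order_trans[OF pp[OF r(1) rQc]] mult_left_mono) auto
      have "\<bar>\<phi> (U Q1) - \<phi> (U Q2)\<bar> \<le> B * (2 * B ^ 4 * N)"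
        using kq' B0 unfolding q_def by (intro order_trans[OF pp[OF r]] mult_left_mono)
      then show "norm ((\<phi> (U Q1) - \<phi> (U Q2)) *\<^sub>R s (Q2 - Qc)) \<le> B * (2 * B ^ 4 * N) * (B * \<eta>)"
        unfolding norm_scaleR using B0 N by (intro mult_mono ss' n) auto
    qed
    also have "\<dots> = B ^ 1 * (\<eta> * N) + 2 * (B ^ 6 * (\<eta> * N))" by (simp add: eval_nat_numeral algebra_simps)
    also have "\<dots> \<le> B ^ 7 * (\<eta> * N) + 2 * (B ^ 7 * (\<eta> * N))" by (intro add_mono mult_left_mono mult_right_mono B1 N\<eta>) auto
    also have "\<dots> \<le> 5 * (B ^ 7 * (\<eta> * N))" using mult_nonneg_nonneg[OF zero_le_power[OF B0(1), of 7] N\<eta>] by linarith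
    finally have g3: "norm (h Q1 - h Q2 - \<phi> (U Qc) *\<^sub>R s (Q1 - Q2)) \<le> 5 * B ^ 7 * \<eta> * N" by (simp add: mult_ac)
    show "norm (s (skew (A *v (w1 - b1)) ** Q1) - s (skew (A *v (w2 - b2)) ** Q2) + H *v (A *v (w1 - w2) - A *v (b1 - b2)))
        \<le> 5 * B ^ 7 * \<eta> * (norm (w1 - w2) + norm (s (Q1 - Q2)) + norm (b1 - b2)) \<and>
      norm (cross3 b1 w1 - cross3 b2 w2) \<le> 5 * B ^ 7 * \<eta> * (norm (w1 - w2) + norm (s (Q1 - Q2)) + norm (b1 - b2)) \<and>
      norm (h Q1 - h Q2 - \<phi> (U Qc) *\<^sub>R s (Q1 - Q2)) \<le> 5 * B ^ 7 * \<eta> * (norm (w1 - w2) + norm (s (Q1 - Q2)) + norm (b1 - b2))"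
      using g1 g2 g3 unfolding N_def y_def q_def by blast
  qed (rule \<eta>0)
qed


text \<open>Equal \<open>w\<close> and \<open>b\<close> at time \<open>T\<close> reduce the
  corrected form there to its attitude part. Its sign thus becomes a statement about two attitudes
  alone, which a suitable small rotation violates.\<close>

lemma saddle_form_nonneg:
  assumes Qc: "Qc \<in> crit" "Qc \<noteq> mat 1"
    and sH: "\<And>a. s (skew a ** Qc) = - (H *v a)" and G: "transpose G = G" "G ** H = mat 1"
  obtains \<eta> where "0 < \<eta>"
    "\<And>T z1 z2. \<lbrakk>0 \<le> T; fsol z1; fsol z2; z1 0 \<in> X; z2 0 \<in> X;
        \<And>t. T \<le> t \<Longrightarrow> z1 t \<in> cball (Qc, 0, 0) \<eta> \<and> z2 t \<in> cball (Qc, 0, 0) \<eta>; snd (z1 T) = snd (z2 T)\<rbrakk> \<Longrightarrow>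
      0 \<le> s (fst (z1 T) - fst (z2 T)) \<bullet> (G *v s (fst (z1 T) - fst (z2 T)))"
proof -
  define c0 where "c0 = \<phi> (U Qc)"
  have c0: "0 < c0"
    using Qc U_nonneg[of Qc] U_eq_0_iff[of Qc] unfolding c0_def crit_def by (intro \<phi>_pos) auto
  obtain BO where BO: "\<And>t. 0 \<le> t \<Longrightarrow> norm (\<Omega> t) \<le> BO"
    using \<Omega>_bounded by (auto simp: bounded_iff)
  obtain \<epsilon> \<zeta> \<kappa> C where c: "0 < \<epsilon>" "0 < \<zeta>" "0 < \<kappa>" "0 < C"
    and rate: "\<And>A o' y w b e1 e2 e3. \<lbrakk>rotation_matrix A; norm o' \<le> BO\<rbrakk> \<Longrightarrow>
      form_rate c0 G \<epsilon> \<zeta> A o' y w b (- (H *v (A *v w - A *v b)) + e1)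
        (- cross3 o' w - e2 + (1 / m) *\<^sub>R (transpose A *v (c0 *\<^sub>R y + e3) - D *v w))
        (- (matrix_inv P *v (transpose A *v (c0 *\<^sub>R y + e3))))
      \<le> - \<kappa> * ((norm w)\<^sup>2 + (norm y)\<^sup>2 + (norm b)\<^sup>2)
        + C * (norm w + norm y + norm b) * (norm e1 + norm e2 + norm e3)"
    using form_rate_bound[OF c0 G, of BO] by blast
  obtain C' \<eta>0 where C': "0 < C'" "0 < \<eta>0"
    and est: "\<And>\<eta> A Q1 w1 b1 Q2 w2 b2. \<lbrakk>0 < \<eta>; \<eta> \<le> \<eta>0; rotation_matrix A; rotation_matrix Q1; rotation_matrix Q2;
      norm (Q1 - Qc) \<le> \<eta>; norm (Q2 - Qc) \<le> \<eta>; norm w1 \<le> \<eta>; norm w2 \<le> \<eta>; norm b1 \<le> \<eta>; norm b2 \<le> \<eta>\<rbrakk> \<Longrightarrow>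
      norm (s (skew (A *v (w1 - b1)) ** Q1) - s (skew (A *v (w2 - b2)) ** Q2) + H *v (A *v (w1 - w2) - A *v (b1 - b2)))
        \<le> C' * \<eta> * (norm (w1 - w2) + norm (s (Q1 - Q2)) + norm (b1 - b2)) \<and>
      norm (cross3 b1 w1 - cross3 b2 w2) \<le> C' * \<eta> * (norm (w1 - w2) + norm (s (Q1 - Q2)) + norm (b1 - b2)) \<and>
      norm (h Q1 - h Q2 - c0 *\<^sub>R s (Q1 - Q2)) \<le> C' * \<eta> * (norm (w1 - w2) + norm (s (Q1 - Q2)) + norm (b1 - b2))"
    unfolding c0_def using difference_estimates[OF Qc(1) sH G(2)] by blast
  obtain M where M: "2 \<le> M" "\<And>X. norm (s X) \<le> M * norm X" "\<And>x. norm (G *v x) \<le> M * norm x"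
    by (rule norm_constants[of G]) (rule that; assumption)
  \<comment> \<open>In 18 = 3 * 3 * 2 one 3 counts the errors, the other comes from
    \<open>N\<^sup>2 \<le> 3 * N2\<close>, and the 2 leaves half of \<open>\<kappa>\<close> for the
    decay.\<close>
  define \<eta> where "\<eta> = min \<eta>0 (\<kappa> / (18 * C * C'))"
  have \<eta>: "0 < \<eta>" "\<eta> \<le> \<eta>0" "18 * C * C' * \<eta> \<le> \<kappa>"
  proof -
    show "0 < \<eta>" "\<eta> \<le> \<eta>0" using c C' by (auto simp: \<eta>_def)
    have "18 * C * C' * \<eta> \<le> 18 * C * C' * (\<kappa> / (18 * C * C'))"
      using c C' by (intro mult_left_mono) (auto simp: \<eta>_def)
    then show "18 * C * C' * \<eta> \<le> \<kappa>" using c C' by simp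
  qed
  \<comment> \<open>Serves in \<open>- F t \<le> CF * N2 t\<close>: the kinetic and bias parts of
    \<open>F\<close> are nonnegative, so only the attitude part and the two cross terms
    count.\<close>
  define CF where "CF = c0 / 2 * M + \<epsilon> + \<zeta> * M"
  have CF: "0 < CF" using c0 c M(1) unfolding CF_def by (intro add_pos_pos) auto
  \<comment> \<open>Together with the bound on \<open>- F\<close>, this makes the rate
    \<open>- (\<kappa> / 2) * N2\<close> at most \<open>lm * F\<close>, whatever the sign of
    \<open>F\<close>.\<close>
  define lm where "lm = \<kappa> / (2 * CF)"
  have lm: "0 < lm" "lm * CF = \<kappa> / 2" using c CF by (simp_all add: lm_def)
  show ?thesis
  proof (rule that[OF \<eta>(1)])
    fix T :: real and z1 z2 :: "real \<Rightarrow> state"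
    assume T: "0 \<le> T" and z1: "fsol z1" "z1 0 \<in> X" and z2: "fsol z2" "z2 0 \<in> X"
      and near: "\<And>t. T \<le> t \<Longrightarrow> z1 t \<in> cball (Qc, 0, 0) \<eta> \<and> z2 t \<in> cball (Qc, 0, 0) \<eta>"
      and snd_eq: "snd (z1 T) = snd (z2 T)"
    define y w b where "y = (\<lambda>t. s (fst (z1 t) - fst (z2 t)))" and "w = (\<lambda>t. fst (snd (z1 t)) - fst (snd (z2 t)))"
      and "b = (\<lambda>t. snd (snd (z1 t)) - snd (snd (z2 t)))"
    define F where "F = (\<lambda>t. c0 / 2 * (y t \<bullet> (G *v y t)) + m / 2 * (w t \<bullet> w t) + (1 / 2) * (b t \<bullet> (P *v b t))
      - \<epsilon> * ((R t *v w t) \<bullet> y t) - \<zeta> * ((G *v y t) \<bullet> (R t *v b t)))"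
    define y' w' b' where "y' = (\<lambda>t. s (fst (f t (z1 t)) - fst (f t (z2 t))))"
      and "w' = (\<lambda>t. fst (snd (f t (z1 t))) - fst (snd (f t (z2 t))))"
      and "b' = (\<lambda>t. snd (snd (f t (z1 t))) - snd (snd (f t (z2 t))))"
    define N2 where "N2 = (\<lambda>t. (norm (w t))\<^sup>2 + (norm (y t))\<^sup>2 + (norm (b t))\<^sup>2)"
    have Gs: "(G *v x) \<bullet> z = x \<bullet> (G *v z)" for x z
      using dot_lmul_matrix[of x "transpose G" z] G by (metis transpose_matrix_vector transpose_transpose)
    have Ps: "(P *v x) \<bullet> z = x \<bullet> (P *v z)" for x z
      using dot_lmul_matrix[of x "transpose P" z] P by (metis posdef_def transpose_matrix_vector transpose_transpose)
    have dF: "(F has_real_derivative form_rate c0 G \<epsilon> \<zeta> (R t) (\<Omega> t) (y t) (w t) (b t) (y' t) (w' t) (b' t)) (at t within {T..u})"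
      if t: "t \<in> {T..u}" for t u
    proof -
      have sub: "{T..u} \<subseteq> {0..}" using T by auto
      note s1 = sol_components[OF sol_subset[OF z1(1) sub] t]
      note s2 = sol_components[OF sol_subset[OF z2(1) sub] t]
      have dy: "(y has_vector_derivative y' t) (at t within {T..u})"
        unfolding y_def y'_def
        using s_has_vector_derivative[OF has_vector_derivative_diff[OF s1(1) s2(1)]] by simp
      have dw: "(w has_vector_derivative w' t) (at t within {T..u})"
        unfolding w_def w'_def using has_vector_derivative_diff[OF s1(2) s2(2)] by simp
      have db: "(b has_vector_derivative b' t) (at t within {T..u})"
        unfolding b_def b'_def using has_vector_derivative_diff[OF s1(3) s2(3)] by simp
      have dR: "(R has_vector_derivative R t ** skew (\<Omega> t)) (at t within {T..u})"
        by (rule has_vector_derivative_within_subset[OF R_kin sub]) (use t T in auto)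
      note inn = bounded_bilinear.has_vector_derivative[OF bounded_bilinear_inner]
      note mv = bounded_bilinear.has_vector_derivative[OF bounded_bilinear_matrix_vector_mult]
      note lin = bounded_linear.has_vector_derivative[OF matrix_vector_mult.bounded_linear_right]
      have "(F has_vector_derivative
          c0 / 2 * (y t \<bullet> (G *v y' t) + y' t \<bullet> (G *v y t)) + m / 2 * (w t \<bullet> w' t + w' t \<bullet> w t)
          + (1 / 2) * (b t \<bullet> (P *v b' t) + b' t \<bullet> (P *v b t))
          - \<epsilon> * ((R t *v w t) \<bullet> y' t + (R t *v w' t + (R t ** skew (\<Omega> t)) *v w t) \<bullet> y t)
          - \<zeta> * ((G *v y t) \<bullet> (R t *v b' t + (R t ** skew (\<Omega> t)) *v b t) + (G *v y' t) \<bullet> (R t *v b t))) (at t within {T..u})"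
        unfolding F_def
        by (intro has_vector_derivative_diff has_vector_derivative_add has_vector_derivative_mult_right inn mv lin dy dw db dR)
      also have "c0 / 2 * (y t \<bullet> (G *v y' t) + y' t \<bullet> (G *v y t)) + m / 2 * (w t \<bullet> w' t + w' t \<bullet> w t)
          + (1 / 2) * (b t \<bullet> (P *v b' t) + b' t \<bullet> (P *v b t))
          - \<epsilon> * ((R t *v w t) \<bullet> y' t + (R t *v w' t + (R t ** skew (\<Omega> t)) *v w t) \<bullet> y t)
          - \<zeta> * ((G *v y t) \<bullet> (R t *v b' t + (R t ** skew (\<Omega> t)) *v b t) + (G *v y' t) \<bullet> (R t *v b t))
        = form_rate c0 G \<epsilon> \<zeta> (R t) (\<Omega> t) (y t) (w t) (b t) (y' t) (w' t) (b' t)"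
      proof -
        have 1: "y t \<bullet> (G *v y' t) = (G *v y t) \<bullet> y' t" "y' t \<bullet> (G *v y t) = (G *v y t) \<bullet> y' t"
          using Gs[of "y t" "y' t"] by (simp_all add: inner_commute)
        have 2: "b' t \<bullet> (P *v b t) = b t \<bullet> (P *v b' t)" using Ps[of "b t" "b' t"] by (simp add: inner_commute)
        have 3: "(R t ** skew (\<Omega> t)) *v x = R t *v cross3 (\<Omega> t) x" for x
          by (simp flip: matrix_vector_mul_assoc)
        have 4: "w' t \<bullet> w t = w t \<bullet> w' t" by (rule inner_commute)
        show ?thesis unfolding form_rate_def 1 2 3 4 by (simp add: add.commute)
      qed
      finally show ?thesis by (simp add: has_real_derivative_iff_has_vector_derivative)
    qed
    have nb: "norm (fst z - Qc) \<le> \<eta>" "norm (fst (snd z)) \<le> \<eta>" "norm (snd (snd z)) \<le> \<eta>"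
      if "z \<in> cball (Qc, 0, 0) \<eta>" for z :: state
    proof -
      have z: "norm (z - (Qc, 0, 0)) \<le> \<eta>" using that by (simp add: dist_norm norm_minus_commute)
      have "norm (fst (z - (Qc, 0, 0))) \<le> norm (z - (Qc, 0, 0))" "norm (snd (z - (Qc, 0, 0))) \<le> norm (z - (Qc, 0, 0))"
        by (metis norm_fst_le prod.collapse, metis norm_snd_le prod.collapse)
      moreover have "norm (fst (snd z)) \<le> norm (snd z)" "norm (snd (snd z)) \<le> norm (snd z)"
        by (metis norm_fst_le prod.collapse, metis norm_snd_le prod.collapse)
      ultimately show "norm (fst z - Qc) \<le> \<eta>" "norm (fst (snd z)) \<le> \<eta>" "norm (snd (snd z)) \<le> \<eta>"
        using z by (auto simp: minus_prod_def)
    qed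
    have N2: "0 \<le> N2 t" "2 * (norm (w t) * norm (y t)) \<le> N2 t" "2 * (norm (y t) * norm (b t)) \<le> N2 t"
      "2 * (norm (w t) * norm (b t)) \<le> N2 t" "(norm (y t))\<^sup>2 \<le> N2 t" for t
      using sum_squares_bound[of "norm (w t)" "norm (y t)"] sum_squares_bound[of "norm (y t)" "norm (b t)"]
        sum_squares_bound[of "norm (w t)" "norm (b t)"] zero_le_power2[of "norm (w t)"] zero_le_power2[of "norm (y t)"] zero_le_power2[of "norm (b t)"]
      unfolding N2_def mult.assoc by linarith+
    have Fle: "- F t \<le> CF * N2 t" if t: "T \<le> t" for t
    proof -
      have Rn: "norm (R t *v x) = norm x" for x using norm_rotation_mult(1)[OF R_rot] T t by simp
      have 1: "\<bar>y t \<bullet> (G *v y t)\<bar> \<le> M * N2 t"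
      proof -
        have "\<bar>y t \<bullet> (G *v y t)\<bar> \<le> norm (y t) * (M * norm (y t))" by (rule inner_le_norms) (use M in auto)
        also have "\<dots> = M * (norm (y t))\<^sup>2" by (simp add: power2_eq_square)
        also have "\<dots> \<le> M * N2 t" using M N2 by (intro mult_left_mono) auto
        finally show ?thesis .
      qed
      have 2: "\<bar>(R t *v w t) \<bullet> y t\<bar> \<le> N2 t"
        using inner_le_norms[of "R t *v w t" "norm (w t)" "y t" "norm (y t)"] N2(1,2)[of t] mult_nonneg_nonneg[of "norm (w t)" "norm (y t)"]
        by (simp add: Rn)
      have 3: "\<bar>(G *v y t) \<bullet> (R t *v b t)\<bar> \<le> M * N2 t"
      proof -
        have "\<bar>(G *v y t) \<bullet> (R t *v b t)\<bar> \<le> (M * norm (y t)) * norm (b t)" by (rule inner_le_norms) (use M Rn in auto)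
        also have "\<dots> = M * (norm (y t) * norm (b t))" by simp
        also have "\<dots> \<le> M * N2 t"
          using M N2(1,3)[of t] mult_nonneg_nonneg[of "norm (y t)" "norm (b t)"] by (intro mult_left_mono) auto
        finally show ?thesis .
      qed
      have 4: "0 \<le> b t \<bullet> (P *v b t)" using P by (cases "b t = 0") (auto simp: posdef_def less_imp_le)
      have 5: "0 \<le> m / 2 * (w t \<bullet> w t)" using m by simp
      have "c0 / 2 * (- (y t \<bullet> (G *v y t))) \<le> c0 / 2 * (M * N2 t)" using 1 c0 by (intro mult_left_mono) auto
      moreover have "\<epsilon> * ((R t *v w t) \<bullet> y t) \<le> \<epsilon> * N2 t" using 2 c by (intro mult_left_mono) auto
      moreover have "\<zeta> * ((G *v y t) \<bullet> (R t *v b t)) \<le> \<zeta> * (M * N2 t)" using 3 c by (intro mult_left_mono) auto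
      ultimately show ?thesis
        using 4 5 by (simp add: F_def CF_def distrib_right)
    qed
    have rate_le: "form_rate c0 G \<epsilon> \<zeta> (R t) (\<Omega> t) (y t) (w t) (b t) (y' t) (w' t) (b' t) \<le> lm * F t" if t: "T \<le> t" for t
    proof -
      have t0: "0 \<le> t" using t T by simp
      define Q1 w1 b1 Q2 w2 b2 where "Q1 = fst (z1 t)" and "w1 = fst (snd (z1 t))" and "b1 = snd (snd (z1 t))"
        and "Q2 = fst (z2 t)" and "w2 = fst (snd (z2 t))" and "b2 = snd (snd (z2 t))"
      note zdefs = Q1_def w1_def b1_def Q2_def w2_def b2_def
      have ywb: "y t = s (Q1 - Q2)" "w t = w1 - w2" "b t = b1 - b2" by (simp_all add: y_def w_def b_def zdefs)
      have rot: "rotation_matrix Q1" "rotation_matrix Q2"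
        using fsol_in_X[OF z1 t0] fsol_in_X[OF z2 t0] by (auto simp: zdefs)
      define e1 e2 e3 where "e1 = s (skew (R t *v (w1 - b1)) ** Q1) - s (skew (R t *v (w2 - b2)) ** Q2) + H *v (R t *v (w1 - w2) - R t *v (b1 - b2))"
        and "e2 = cross3 b1 w1 - cross3 b2 w2" and "e3 = h Q1 - h Q2 - c0 *\<^sub>R s (Q1 - Q2)"
      define N where "N = norm (w t) + norm (y t) + norm (b t)"
      have N0: "0 \<le> N" by (simp add: N_def)
      have e: "norm e1 \<le> C' * \<eta> * N" "norm e2 \<le> C' * \<eta> * N" "norm e3 \<le> C' * \<eta> * N"
        using est[OF \<eta>(1,2) R_rot[OF t0] rot, of w1 w2 b1 b2] nb[OF conjunct1[OF near[OF t]]] nb[OF conjunct2[OF near[OF t]]]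
        by (auto simp: e1_def e2_def e3_def N_def ywb zdefs)
      have hh: "c0 *\<^sub>R y t + e3 = h Q1 - h Q2" by (simp add: e3_def ywb)
      have y'e: "y' t = - (H *v (R t *v w t - R t *v b t)) + e1"
        using s_diff
        by (simp add: y'_def f_fst e1_def ywb zdefs)
      have w'e: "w' t = - cross3 (\<Omega> t) (w t) - e2 + (1 / m) *\<^sub>R (transpose (R t) *v (c0 *\<^sub>R y t + e3) - D *v w t)"
        unfolding hh by (simp add: w'_def f_snd e2_def ywb zdefs cross3.add_left cross3.diff_right matrix_vector_mult.diff_right
            scaleR_diff_right algebra_simps)
      have b'e: "b' t = - (matrix_inv P *v (transpose (R t) *v (c0 *\<^sub>R y t + e3)))"
        unfolding hh by (simp add: b'_def f_thd zdefs matrix_vector_mult.diff_right)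
      have "form_rate c0 G \<epsilon> \<zeta> (R t) (\<Omega> t) (y t) (w t) (b t) (y' t) (w' t) (b' t)
          \<le> - \<kappa> * N2 t + C * N * (norm e1 + norm e2 + norm e3)"
        unfolding y'e w'e b'e N2_def N_def by (rule rate[OF R_rot[OF t0] BO[OF t0]])
      also have "C * N * (norm e1 + norm e2 + norm e3) \<le> C * N * (3 * (C' * \<eta> * N))"
        using e c N0 by (intro mult_left_mono) auto
      also have "\<dots> = 3 * (C * C' * \<eta>) * N\<^sup>2" by (simp add: power2_eq_square)
      also have "\<dots> \<le> 3 * (C * C' * \<eta>) * (3 * N2 t)"
      proof (rule mult_left_mono)
        have "N\<^sup>2 = N2 t + 2 * (norm (w t) * norm (y t)) + 2 * (norm (y t) * norm (b t)) + 2 * (norm (w t) * norm (b t))"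
          by (simp add: N_def N2_def power2_eq_square algebra_simps)
        then show "N\<^sup>2 \<le> 3 * N2 t"
          using sum_squares_bound[of "norm (w t)" "norm (y t)"] sum_squares_bound[of "norm (y t)" "norm (b t)"]
            sum_squares_bound[of "norm (w t)" "norm (b t)"] unfolding N2_def by (simp add: mult.assoc)
      qed (use c C' \<eta> in simp)
      also have "\<dots> \<le> \<kappa> / 2 * N2 t"
        using mult_right_mono[OF \<eta>(3) N2(1)[of t]] by (simp add: algebra_simps)
      finally have "form_rate c0 G \<epsilon> \<zeta> (R t) (\<Omega> t) (y t) (w t) (b t) (y' t) (w' t) (b' t) \<le> - (\<kappa> / 2) * N2 t"
        by (simp add: algebra_simps)
      also have "\<dots> = - (lm * (CF * N2 t))" using lm(2) by (simp add: mult.assoc[symmetric])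
      also have "\<dots> \<le> lm * F t" using mult_left_mono[OF Fle[OF t], of lm] lm(1) by simp
      finally show ?thesis .
    qed
    have grow: "F u \<le> exp (lm * (u - T)) * F T" if u: "T \<le> u" for u
      by (rule exp_upper_bound[OF u dF rate_le]) auto
    have N2b: "N2 u \<le> 12 * (M * \<eta>)\<^sup>2" if u: "T \<le> u" for u
    proof -
      note n1 = nb[OF conjunct1[OF near[OF u]]] and n2 = nb[OF conjunct2[OF near[OF u]]]
      have M\<eta>: "2 * \<eta> \<le> 2 * (M * \<eta>)" using M(1) \<eta>(1) by simp
      have a1: "norm (w u) \<le> 2 * (M * \<eta>)"
        using norm_triangle_ineq4[of "fst (snd (z1 u))" "fst (snd (z2 u))"] n1 n2 M\<eta> unfolding w_def by linarith
      have a2: "norm (b u) \<le> 2 * (M * \<eta>)"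
        using norm_triangle_ineq4[of "snd (snd (z1 u))" "snd (snd (z2 u))"] n1 n2 M\<eta> unfolding b_def by linarith
      have "norm (fst (z1 u) - fst (z2 u)) \<le> 2 * \<eta>"
        using norm_triangle_ineq4[of "fst (z1 u) - Qc" "fst (z2 u) - Qc"] n1 n2 by simp
      then have "M * norm (fst (z1 u) - fst (z2 u)) \<le> M * (2 * \<eta>)" using M(1) by (intro mult_left_mono) auto
      then have a3: "norm (y u) \<le> 2 * (M * \<eta>)"
        using M(2)[of "fst (z1 u) - fst (z2 u)"] unfolding y_def by simp
      have "(norm (w u))\<^sup>2 \<le> (2 * (M * \<eta>))\<^sup>2" "(norm (b u))\<^sup>2 \<le> (2 * (M * \<eta>))\<^sup>2" "(norm (y u))\<^sup>2 \<le> (2 * (M * \<eta>))\<^sup>2"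
        by (intro power_mono a1 a2 a3 norm_ge_zero)+
      then show ?thesis unfolding N2_def by (simp add: power_mult_distrib)
    qed
    have "0 \<le> F T"
    proof (rule ccontr)
      assume "\<not> 0 \<le> F T"
      then have neg: "0 < - F T" by simp
      define K' where "K' = CF * (12 * (M * \<eta>)\<^sup>2)"
      have K': "0 \<le> K'" using CF by (simp add: K'_def)
      \<comment> \<open>At this time the estimate \<open>exp x \<ge> 1 + x\<close> already pushes
        \<open>- F\<close> past its bound \<open>K'\<close>.\<close>
      define u where "u = T + K' / (- F T) / lm"
      have "0 \<le> K' / (- F T) / lm" by (intro divide_nonneg_pos K' neg lm(1))
      then have u: "T \<le> u" by (simp add: u_def)
      have "(1 + K' / (- F T)) * (- F T) \<le> exp (lm * (u - T)) * (- F T)"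
        using neg lm(1) exp_ge_add_one_self[of "K' / (- F T)"] by (intro mult_right_mono) (auto simp: u_def)
      also have "\<dots> \<le> - F u" using grow[OF u] by simp
      also have "\<dots> \<le> CF * N2 u" by (rule Fle[OF u])
      also have "\<dots> \<le> K'" unfolding K'_def using CF by (intro mult_left_mono N2b u) auto
      finally have "(1 + K' / (- F T)) * (- F T) \<le> K'" .
      moreover have "(1 + K' / (- F T)) * (- F T) = - F T + K'" using neg by (simp add: field_simps)
      ultimately show False using neg by linarith
    qed
    moreover have "w T = 0" "b T = 0" using snd_eq by (auto simp: w_def b_def)
    ultimately have "0 \<le> c0 / 2 * (y T \<bullet> (G *v y T))" by (simp add: F_def)
    then show "0 \<le> s (fst (z1 T) - fst (z2 T)) \<bullet> (G *v s (fst (z1 T) - fst (z2 T)))"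
      using c0 by (simp add: y_def zero_le_mult_iff)
  qed
qed

section \<open>Category argument for the density of the basin\<close>

definition stay :: "real^3^3 \<Rightarrow> real \<Rightarrow> real \<Rightarrow> state set" where
  "stay Q \<eta> T = {x \<in> X. \<exists>z. fsol z \<and> z 0 = x \<and> (\<forall>t\<ge>T. z t \<in> cball (Q, 0, 0) \<eta>)}"

lemma stay_iff:
  assumes "fsol z" "z 0 \<in> X" "0 \<le> T"
  shows "z 0 \<in> stay Q \<eta> T \<longleftrightarrow> (\<forall>t\<ge>T. z t \<in> cball (Q, 0, 0) \<eta>)"
proof
  assume "z 0 \<in> stay Q \<eta> T"
  then obtain z' where z': "fsol z'" "z' 0 = z 0" "\<forall>t\<ge>T. z' t \<in> cball (Q, 0, 0) \<eta>" by (auto simp: stay_def)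
  show "\<forall>t\<ge>T. z t \<in> cball (Q, 0, 0) \<eta>"
  proof (intro allI impI)
    fix t assume t: "T \<le> t"
    have "z' t = z t" by (rule fsol_unique[OF z'(1) assms(1) z'(2)]) (use t assms(3) in simp)
    then show "z t \<in> cball (Q, 0, 0) \<eta>" using z'(3) t by metis
  qed
qed (use assms in \<open>auto simp: stay_def\<close>)

text \<open>Being outside the closed ball at a single time from \<open>T\<close> on survives small
  changes of the initial state.\<close>

lemma openin_not_stay:
  assumes T: "0 \<le> T"
  shows "openin (top_of_set X) (X - stay Q \<eta> T)"
  unfolding openin_euclidean_subtopology_iff
proof (intro conjI ballI)
  fix x assume x: "x \<in> X - stay Q \<eta> T"
  obtain z where z: "z 0 = x" "fsol z" using fsol_exists[of x] x by blast
  have zX: "z 0 \<in> X" using x z by simp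
  obtain t where t: "t \<ge> T" "z t \<notin> cball (Q, 0, 0) \<eta>"
    using stay_iff[OF z(2) zX T, of Q \<eta>] x z(1) by auto
  define e where "e = dist (Q, 0, 0) (z t) - \<eta>"
  have e: "0 < e" using t by (simp add: e_def)
  obtain \<delta> where \<delta>: "\<delta> > 0" "\<And>y. \<lbrakk>fsol y; y 0 \<in> X; dist (y 0) (z 0) < \<delta>\<rbrakk> \<Longrightarrow> dist (y t) (z t) < e"
    by (rule fsol_flow_continuous[OF z(2) zX _ e, of t]) (use T t in auto)
  show "\<exists>e>0. \<forall>x'\<in>X. dist x' x < e \<longrightarrow> x' \<in> X - stay Q \<eta> T"
  proof (intro exI[of _ \<delta>] conjI ballI impI \<delta>(1))
    fix x' assume x': "x' \<in> X" "dist x' x < \<delta>"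
    obtain y where y: "y 0 = x'" "fsol y" using fsol_exists[OF x'(1)] by blast
    have yX: "y 0 \<in> X" using x' y by simp
    have "dist (y t) (z t) < e" by (rule \<delta>(2)) (use y x' z in auto)
    then have "y t \<notin> cball (Q, 0, 0) \<eta>"
      using dist_triangle[of "(Q, 0, 0)" "z t" "y t"] by (auto simp: e_def)
    then show "x' \<in> X - stay Q \<eta> T"
      using stay_iff[OF y(2) yX T] t(1) y(1) x'(1) by auto
  qed
qed auto

text \<open>First-order expansion of the rotation about \<open>a\<close>. Dividing by
  \<open>\<sigma>\<close> does not affect the sign of a quadratic form, so a negative value at the
  limit gives negative values for small positive angles.\<close>

lemma rodrigues_quotient:
  "((\<lambda>\<sigma>. s (Q - rodrigues a \<sigma> ** Q) /\<^sub>R \<sigma>) \<longlongrightarrow> - s (skew a ** Q)) (at_right 0)"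
proof -
  have 1: "((\<lambda>\<sigma>. sin \<sigma> / \<sigma>) \<longlongrightarrow> 1) (at_right (0::real))"
    using DERIV_sin[of "0::real"] unfolding DERIV_def by (auto intro: tendsto_within_subset)
  have 2: "((\<lambda>\<sigma>. (cos \<sigma> - 1) / \<sigma>) \<longlongrightarrow> 0) (at_right (0::real))"
    using DERIV_cos[of "0::real"] unfolding DERIV_def by (auto intro: tendsto_within_subset)
  have "((\<lambda>\<sigma>. - (sin \<sigma> / \<sigma>) *\<^sub>R s (skew a ** Q) + ((cos \<sigma> - 1) / \<sigma>) *\<^sub>R s (skew a ** skew a ** Q))
      \<longlongrightarrow> - 1 *\<^sub>R s (skew a ** Q) + 0 *\<^sub>R s (skew a ** skew a ** Q)) (at_right 0)"
    by (intro tendsto_intros 1 2)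
  moreover have "s (Q - rodrigues a \<sigma> ** Q) /\<^sub>R \<sigma>
      = - (sin \<sigma> / \<sigma>) *\<^sub>R s (skew a ** Q) + ((cos \<sigma> - 1) / \<sigma>) *\<^sub>R s (skew a ** skew a ** Q)" for \<sigma>
  proof -
    have "Q - rodrigues a \<sigma> ** Q = (- sin \<sigma>) *\<^sub>R (skew a ** Q) + (cos \<sigma> - 1) *\<^sub>R (skew a ** skew a ** Q)"
      by (simp add: rodrigues_def matrix_mult.add_left matrix_mult.diff_left matrix_mult.scaleR_left algebra_simps)
    then have "s (Q - rodrigues a \<sigma> ** Q) = (- sin \<sigma>) *\<^sub>R s (skew a ** Q) + (cos \<sigma> - 1) *\<^sub>R s (skew a ** skew a ** Q)"
      by (simp only: s_add s_scaleR)
    then show ?thesis by (simp add: scaleR_add_right scaleR_diff_right divide_inverse mult.commute)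
  qed
  ultimately show ?thesis by simp
qed

text \<open>The perturbation is made at time \<open>T\<close>, where it changes the attitude only,
  and is carried back to time 0 by openness of the flow map. If the perturbed trajectory stayed as
  well, \<open>saddle_form_nonneg\<close> would contradict the negative direction.\<close>

lemma saddle_not_stay_dense:
  assumes Qc: "Qc \<in> crit" "Qc \<noteq> mat 1"
  obtains \<eta> where "0 < \<eta>" "\<And>T. 0 \<le> T \<Longrightarrow> X \<subseteq> closure (X - stay Qc \<eta> T)"
proof -
  obtain H G where sH: "\<And>a. s (skew a ** Qc) = - (H *v a)" and G: "transpose G = G" "G ** H = mat 1"
    and \<theta>': "\<exists>\<theta>. norm \<theta> = 1 \<and> \<theta> \<bullet> (H *v \<theta>) < 0"
    using crit_inverse[OF Qc(1)] Qc(2) by metis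
  obtain \<theta> where \<theta>: "norm \<theta> = 1" "\<theta> \<bullet> (H *v \<theta>) < 0" using \<theta>' by blast
  define g where "g = (\<lambda>y. y \<bullet> (G *v y))"
  have gc: "continuous_on S g" for S
    unfolding g_def by (intro continuous_intros matrix_vector_mult.continuous_on)
  \<comment> \<open>At \<open>Qc\<close> the value is
    \<open>\<theta> \<bullet> (H *v \<theta>)\<close>, because \<open>G\<close> inverts
    \<open>H\<close>. Continuity extends the negativity to the attitudes near \<open>Qc\<close>
    among which \<open>Q\<close> at time \<open>T\<close> lies.\<close>
  have gQc: "g (s (skew \<theta> ** Qc)) < 0"
    using \<theta>(2) by (simp add: g_def sH matrix_vector_mult.minus_right matrix_vector_mul_assoc G inner_commute)
  have "continuous_on UNIV (\<lambda>Q. g (s (skew \<theta> ** Q)))"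
    by (intro continuous_on_compose2[OF gc] s_continuous_on matrix_mult.continuous_on
        continuous_on_const continuous_on_id) auto
  then have "open {Q. g (s (skew \<theta> ** Q)) < 0}"
    by (intro open_Collect_less continuous_on_const)
  then obtain \<eta>2 where \<eta>2: "0 < \<eta>2" "\<And>Q. dist Q Qc < \<eta>2 \<Longrightarrow> g (s (skew \<theta> ** Q)) < 0"
    using gQc unfolding open_dist by blast
  obtain \<eta>1 where \<eta>1: "0 < \<eta>1"
    "\<And>T z1 z2. \<lbrakk>0 \<le> T; fsol z1; fsol z2; z1 0 \<in> X; z2 0 \<in> X;
        \<And>t. T \<le> t \<Longrightarrow> z1 t \<in> cball (Qc, 0, 0) \<eta>1 \<and> z2 t \<in> cball (Qc, 0, 0) \<eta>1; snd (z1 T) = snd (z2 T)\<rbrakk> \<Longrightarrow>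
      0 \<le> g (s (fst (z1 T) - fst (z2 T)))"
    unfolding g_def using saddle_form_nonneg[OF Qc sH G] by blast
  define \<eta> where "\<eta> = min \<eta>1 (\<eta>2 / 2)"
  have \<eta>: "0 < \<eta>" "\<eta> \<le> \<eta>1" "\<eta> < \<eta>2" using \<eta>1 \<eta>2 by (auto simp: \<eta>_def)
  show ?thesis
  proof (rule that[OF \<eta>(1)])
    fix T :: real assume T: "0 \<le> T"
    show "X \<subseteq> closure (X - stay Qc \<eta> T)"
    proof
      fix x assume x: "x \<in> X"
      show "x \<in> closure (X - stay Qc \<eta> T)"
      proof (cases "x \<in> stay Qc \<eta> T")
        case False
        then show ?thesis using x closure_subset[of "X - stay Qc \<eta> T"] by blast
      next
        case True
        obtain z where z: "z 0 = x" "fsol z" using fsol_exists[OF x] by blast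
        have zX: "z 0 \<in> X" using x z by simp
        have zst: "z t \<in> cball (Qc, 0, 0) \<eta>" if "T \<le> t" for t
          using stay_iff[OF z(2) zX T] True z(1) that by blast
        define Q where "Q = fst (z T)"
        have Qrot: "rotation_matrix Q" using fsol_in_X[OF z(2) zX T] by (auto simp: Q_def)
        have "dist Q Qc \<le> dist (z T) (Qc, 0, 0)"
          using dist_fst_le[of "z T" "(Qc, 0, 0)"] by (simp add: Q_def)
        then have "dist Q Qc < \<eta>2" using zst[of T] \<eta>(3) by (simp add: dist_commute)
        then have gQ: "g (s (skew \<theta> ** Q)) < 0" by (rule \<eta>2(2))
        show ?thesis
          unfolding closure_approachable
        proof (intro allI impI)
          fix e :: real assume e: "e > 0"
          obtain \<delta> where \<delta>: "\<delta> > 0" "\<And>x. \<lbrakk>x \<in> X; dist x (z T) < \<delta>\<rbrakk> \<Longrightarrow> \<exists>y. fsol y \<and> y 0 \<in> X \<and> dist (y 0) (z 0) < e \<and> y T = x"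
            by (rule fsol_flow_open[OF z(2) zX T e]) blast
          have "((\<lambda>\<sigma>. g (s (Q - rodrigues \<theta> \<sigma> ** Q) /\<^sub>R \<sigma>)) \<longlongrightarrow> g (- s (skew \<theta> ** Q))) (at_right 0)"
            by (rule continuous_on_tendsto_compose[OF gc[of UNIV] rodrigues_quotient]) auto
          moreover have "g (- s (skew \<theta> ** Q)) < 0"
            using gQ by (simp add: g_def matrix_vector_mult.minus_right)
          ultimately have ev1: "\<forall>\<^sub>F \<sigma> in at_right 0. g (s (Q - rodrigues \<theta> \<sigma> ** Q) /\<^sub>R \<sigma>) < 0"
            by (rule order_tendstoD(2))
          have "((\<lambda>\<sigma>. rodrigues \<theta> \<sigma> ** Q) \<longlongrightarrow> (mat 1 + sin 0 *\<^sub>R skew \<theta> + (1 - cos 0) *\<^sub>R (skew \<theta> ** skew \<theta>)) ** Q) (at_right 0)"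
            unfolding rodrigues_def by (intro matrix_mult.tendsto tendsto_intros)
          then have "((\<lambda>\<sigma>. rodrigues \<theta> \<sigma> ** Q) \<longlongrightarrow> Q) (at_right 0)" by simp
          then have ev2: "\<forall>\<^sub>F \<sigma> in at_right 0. dist (rodrigues \<theta> \<sigma> ** Q) Q < \<delta>"
            by (rule tendstoD) (rule \<delta>(1))
          have "\<forall>\<^sub>F \<sigma> in at_right 0. 0 < \<sigma> \<and> g (s (Q - rodrigues \<theta> \<sigma> ** Q) /\<^sub>R \<sigma>) < 0 \<and> dist (rodrigues \<theta> \<sigma> ** Q) Q < \<delta>"
            using ev1 ev2 by (intro eventually_conj eventually_at_right_less)
          then obtain \<sigma> where \<sigma>: "0 < \<sigma>" "g (s (Q - rodrigues \<theta> \<sigma> ** Q) /\<^sub>R \<sigma>) < 0" "dist (rodrigues \<theta> \<sigma> ** Q) Q < \<delta>"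
            using eventually_happens'[OF trivial_limit_at_right_real] by blast
          define Q' where "Q' = rodrigues \<theta> \<sigma> ** Q"
          have pX: "(Q', snd (z T)) \<in> X"
            using rotation_matrix_mult[OF rotation_rodrigues[OF \<theta>(1)] Qrot] by (simp add: Q'_def)
          have "dist (Q', snd (z T)) (z T) = dist Q' Q"
            by (cases "z T") (simp add: Q_def dist_Pair_Pair)
          then obtain y where y: "fsol y" "y 0 \<in> X" "dist (y 0) (z 0) < e" "y T = (Q', snd (z T))"
            using \<delta>(2)[OF pX] \<sigma>(3) by (auto simp: Q'_def)
          have gneg: "g (s (Q - Q')) < 0"
            using \<sigma>(1,2) by (simp add: Q'_def g_def matrix_vector_mult.scaleR_right zero_less_mult_iff mult_less_0_iff)
          have "y 0 \<notin> stay Qc \<eta> T"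
          proof
            assume "y 0 \<in> stay Qc \<eta> T"
            then have yst: "y t \<in> cball (Qc, 0, 0) \<eta>" if "T \<le> t" for t
              using stay_iff[OF y(1,2) T] that by blast
            have "0 \<le> g (s (fst (z T) - fst (y T)))"
            proof (rule \<eta>1(2)[OF T z(2) y(1) zX y(2)])
              fix t assume t: "T \<le> t"
              show "z t \<in> cball (Qc, 0, 0) \<eta>1 \<and> y t \<in> cball (Qc, 0, 0) \<eta>1"
                using zst[OF t] yst[OF t] \<eta>(2) by auto
            qed (simp add: y(4))
            then show False using gneg by (simp add: y(4) Q_def)
          qed
          then show "\<exists>y\<in>X - stay Qc \<eta> T. dist y x < e"
            using y z(1) by (intro bexI[of _ "y 0"]) auto
        qed
      qed
    qed
  qed
qed

lemma basin_dense: "X \<subseteq> closure basin"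
proof -
  have "\<forall>Q \<in> crit - {mat 1}. \<exists>\<eta>. 0 < \<eta> \<and> (\<forall>T\<ge>0. X \<subseteq> closure (X - stay Q \<eta> T))"
    using saddle_not_stay_dense by (metis DiffE singletonI)
  then obtain \<eta> where \<eta>: "\<And>Q. Q \<in> crit - {mat 1} \<Longrightarrow> 0 < \<eta> Q"
    "\<And>Q T. Q \<in> crit - {mat 1} \<Longrightarrow> 0 \<le> T \<Longrightarrow> X \<subseteq> closure (X - stay Q (\<eta> Q) T)"
    by metis
  \<comment> \<open>\<open>X\<close> is inserted so that the intersection lies in \<open>X\<close>
    without exhibiting a saddle. Integer times suffice, since staying from \<open>T\<close> on
    implies staying from every later time on.\<close>
  define \<G> where "\<G> = insert X ((\<lambda>(Q, n). X - stay Q (\<eta> Q) (real n)) ` ((crit - {mat 1}) \<times> (UNIV :: nat set)))"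
  have "X \<subseteq> closure (\<Inter>\<G>)"
  proof (rule Baire[OF closed_X])
    show "countable \<G>"
      unfolding \<G>_def
      by (intro countable_insert countable_image countable_SIGMA countable_finite[OF finite_Diff[OF finite_crit]]) auto
    fix S assume "S \<in> \<G>"
    then consider "S = X" | Q n where "Q \<in> crit - {mat 1}" "S = X - stay Q (\<eta> Q) (real n)"
      unfolding \<G>_def by auto
    then show "openin (top_of_set X) S \<and> X \<subseteq> closure S"
    proof cases
      case 1
      then show ?thesis using closure_subset[of X] by simp
    next
      case 2
      then show ?thesis using \<eta>(2)[OF 2(1), of "real n"] openin_not_stay[of "real n"] by simp
    qed
  qed
  moreover have "\<Inter>\<G> \<subseteq> basin"
  proof
    fix x assume x: "x \<in> \<Inter>\<G>"
    then have xX: "x \<in> X" by (auto simp: \<G>_def)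
    obtain z where z: "z 0 = x" "fsol z" using fsol_exists[OF xX] by blast
    have zX: "z 0 \<in> X" using xX z by simp
    obtain Q where Q: "Q \<in> crit" "(z \<longlongrightarrow> (Q, 0, 0)) at_top"
      using fsol_converges[OF z(2) zX] by blast
    have "Q = mat 1"
    proof (rule ccontr)
      assume ne: "Q \<noteq> mat 1"
      then have Qs: "Q \<in> crit - {mat 1}" using Q by simp
      have "\<forall>\<^sub>F t in at_top. dist (z t) (Q, 0, 0) < \<eta> Q" by (rule tendstoD[OF Q(2) \<eta>(1)[OF Qs]])
      then obtain T where T: "\<And>t. t \<ge> T \<Longrightarrow> dist (z t) (Q, 0, 0) < \<eta> Q"
        by (auto simp: eventually_at_top_linorder)
      obtain n where n: "T \<le> real n" using real_arch_simple by blast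
      have "z 0 \<in> stay Q (\<eta> Q) (real n)"
        using stay_iff[OF z(2) zX, of "real n"] T n by (force simp: dist_commute intro: less_imp_le)
      moreover have "X - stay Q (\<eta> Q) (real n) \<in> \<G>" using Qs by (force simp: \<G>_def)
      ultimately show False using x z(1) by blast
    qed
    then show "x \<in> basin" using z Q(2) xX by (auto simp: basin_def)
  qed
  ultimately show ?thesis using closure_mono by blast
qed

end

subsection \<open>The estimator\<close>

text \<open>\<open>VE\<close> cancels, and the weights \<open>d i / (\<sigma> i)\<^sup>2\<close>
  undo the squared singular values, so \<open>UE\<close> diagonalises the product with eigenvalues
  \<open>d i\<close>.\<close>

lemma svd_gram:
  assumes svd: "is_svd E UE SE VE \<iota> \<sigma>" and W0_diag: "\<And>i j. i \<noteq> j \<Longrightarrow> W0 $ i $ j = 0"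
    and W0_pos: "\<And>j. W0 $ j $ j > 0" and W0_first: "\<And>i. W0 $ \<iota> i $ \<iota> i = d i / (\<sigma> i)\<^sup>2"
  shows "E ** (VE ** W0 ** transpose VE) ** transpose E = UE ** diagm d ** transpose UE"
proof -
  have o: "orthogonal_matrix VE" and E: "E = UE ** SE ** transpose VE" and inj: "inj \<iota>"
    and SE: "\<And>i j. SE $ i $ j = (if j = \<iota> i then \<sigma> i else 0)"
    using svd by (auto simp: is_svd_def)
  \<comment> \<open>Division by 0 yields 0, so a vanishing singular value would contradict the
    positivity of its weight.\<close>
  have \<sigma>0: "\<sigma> i \<noteq> 0" for i using W0_pos[of "\<iota> i"] W0_first[of i] by auto
  have "(SE ** W0 ** transpose SE) $ i $ j = diagm d $ i $ j" for i j
  proof -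
    have 1: "(SE ** W0) $ i $ k = \<sigma> i * W0 $ \<iota> i $ k" for k
      by (simp add: matrix_matrix_mult_def SE if_distrib[of "\<lambda>x. x * _"] cong: if_cong)
    have "(SE ** W0 ** transpose SE) $ i $ j = (\<Sum>k\<in>UNIV. (SE ** W0) $ i $ k * SE $ j $ k)"
      by (simp add: matrix_matrix_mult_def[of "SE ** W0"] transpose_def)
    also have "\<dots> = \<sigma> i * W0 $ \<iota> i $ \<iota> j * \<sigma> j"
      by (simp add: 1 SE if_distrib[of "\<lambda>x. _ * x"] cong: if_cong)
    also have "\<dots> = diagm d $ i $ j"
    proof (cases "i = j")
      case True
      then show ?thesis using \<sigma>0[of j] W0_first[of j] by (simp add: diagm_def power2_eq_square)
    next
      case False
      then have "\<iota> i \<noteq> \<iota> j" using inj by (auto simp: inj_eq)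
      then show ?thesis using False W0_diag by (simp add: diagm_def)
    qed
    finally show ?thesis .
  qed
  then have S: "SE ** W0 ** transpose SE = diagm d" by (simp add: vec_eq_iff)
  have "E ** (VE ** W0 ** transpose VE) ** transpose E
      = UE ** (SE ** W0 ** transpose SE) ** transpose UE"
    by (simp add: E matrix_transpose_mul orthogonal_conj_simps[OF o] matrix_mul_assoc[symmetric])
  then show ?thesis by (simp add: S)
qed

lemma lipschitz_of_continuous_deriv:
  fixes g :: "real \<Rightarrow> real"
  assumes g: "\<And>x. x \<ge> 0 \<Longrightarrow> (g has_real_derivative g' x) (at x within {0..})" and g': "continuous_on {0..} g'"
  shows "\<exists>L. \<forall>x\<in>{0..M}. \<forall>y\<in>{0..M}. \<bar>g x - g y\<bar> \<le> L * \<bar>x - y\<bar>"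
proof -
  have "bounded (g' ` {0..M})"
    by (intro compact_imp_bounded compact_continuous_image continuous_on_subset[OF g']) auto
  then obtain L where "\<forall>x\<in>g' ` {0..M}. norm x \<le> L" unfolding bounded_iff by blast
  then have L: "norm (g' x) \<le> L" if "x \<in> {0..M}" for x using that by blast
  have "norm (g x - g y) \<le> L * norm (x - y)" if "x \<in> {0..M}" "y \<in> {0..M}" for x y
  proof (rule field_differentiable_bound[where S = "{0..M}" and f' = g'])
    fix z assume "z \<in> {0..M}"
    then show "(g has_field_derivative g' z) (at z within {0..M})"
      by (intro DERIV_subset[OF g]) auto
  qed (use that L in auto)
  then show ?thesis by (intro exI[of _ L]) simp
qed

section \<open>Translation between the estimator and the error dynamics\<close>

context attitude_error
begin

text \<open>With \<open>B = transpose Q ** A\<close>, the factor \<open>A\<close> comes out on both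
  sides and leaves \<open>K ** transpose Q\<close> minus its transpose, that is
  \<open>skew (s Q)\<close>; conjugation by a rotation rotates the axis.\<close>

lemma S_vec_eq:
  assumes A: "rotation_matrix A"
  shows "S_vec (K ** A) B = transpose A *v s (A ** transpose B)"
proof -
  define Q where "Q = A ** transpose B"
  have "transpose A ** A = mat 1" using A by (simp add: rotation_matrix_def orthogonal_matrix_def)
  then have B: "B = transpose Q ** A"
    by (simp add: Q_def matrix_transpose_mul flip: matrix_mul_assoc)
  have "transpose (K ** A) ** B - transpose B ** (K ** A) = transpose A ** (K ** transpose Q - transpose (K ** transpose Q)) ** A"
    by (simp add: B matrix_transpose_mul K_sym matrix_mult.diff_left matrix_mult.diff_right matrix_mul_assoc)
  also have "\<dots> = transpose A ** skew (s Q) ** transpose (transpose A)"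
    by (simp add: s_def skew_axl)
  also have "\<dots> = skew (transpose A *v s Q)"
    by (rule rotation_conj_skew[OF rotation_matrix_transpose[OF A]])
  finally show ?thesis by (simp add: S_vec_def Q_def)
qed

text \<open>The residual is \<open>N ** E\<close> with \<open>N = mat 1 - transpose Q\<close>, and
  orthogonality gives \<open>transpose N ** N = mat 1 + mat 1 - Q - transpose Q\<close>. Against the
  symmetric \<open>K\<close> both \<open>Q\<close> and its transpose have the same trace, which
  cancels the factor 1/2.\<close>

lemma U0_eq:
  assumes KE: "K = E ** W ** transpose E" and A: "rotation_matrix A" and B: "rotation_matrix B"
  shows "U0 E W B (transpose A ** E) = U (A ** transpose B)"
proof -
  define Q where "Q = A ** transpose B"
  have Q: "Q ** transpose Q = mat 1"
    using rotation_matrix_mult[OF A rotation_matrix_transpose[OF B]]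
    by (simp add: Q_def rotation_matrix_def orthogonal_matrix_def)
  define N where "N = mat 1 - transpose Q"
  have tN: "transpose N = mat 1 - Q"
    using transpose_diff[of "mat 1" "transpose Q"]
    by (simp add: N_def)
  have EN: "E - B ** (transpose A ** E) = N ** E"
    by (simp add: N_def Q_def matrix_transpose_mul matrix_mult.diff_left matrix_mul_assoc)
  have "trace (transpose (N ** E) ** (N ** E ** W)) = trace (transpose E ** (transpose N ** N ** E ** W))"
    by (simp add: matrix_transpose_mul matrix_mul_assoc)
  also have "\<dots> = trace (transpose N ** N ** E ** W ** transpose E)" by (rule trace_mul_sym)
  also have "\<dots> = trace (transpose N ** N ** K)" by (simp add: KE matrix_mul_assoc)
  also have "transpose N ** N = mat 1 + mat 1 - Q - transpose Q"
    unfolding tN unfolding N_def by (simp add: matrix_mult.diff_left matrix_mult.diff_right Q algebra_simps)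
  also have "trace ((mat 1 + mat 1 - Q - transpose Q) ** K) = 2 * U Q"
  proof -
    have "trace (transpose Q ** K) = trace (transpose (K ** Q))" by (simp add: matrix_transpose_mul K_sym)
    also have "\<dots> = trace (Q ** K)" unfolding trace_mul_sym[of Q K] by (simp add: trace_def transpose_def)
    finally show ?thesis
      by (simp only: U_def matrix_mult.diff_left matrix_mult.add_left matrix_mul_lid
          trace_diff trace_add) simp
  qed
  finally show ?thesis by (simp add: U0_def trace_inner_def EN Q_def)
qed

lemma rotation_skew_commute:
  "rotation_matrix A \<Longrightarrow> skew (A *v x) ** A = A ** skew x"
  using rotation_conj_skew[of A x] by (metis matrix_mul_assoc matrix_mul_rid orthogonal_matrix_def rotation_matrix_def)

context
  fixes E :: "real^'n^3" and W :: "real^'n^'n" and Um :: "real \<Rightarrow> real^'n^3" and \<Omega>m :: "real \<Rightarrow> real^3" and \<beta> :: "real^3"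
  assumes KE: "K = E ** W ** transpose E"
    and Um: "\<And>t. t \<ge> 0 \<Longrightarrow> Um t = transpose (R t) ** E"
    and \<Omega>m: "\<And>t. t \<ge> 0 \<Longrightarrow> \<Omega>m t = \<Omega> t + \<beta>"
begin

lemma measured_terms:
  assumes t: "0 \<le> t" and B: "rotation_matrix B"
  shows "S_vec (L_matrix E W (Um t)) B = transpose (R t) *v s (R t ** transpose B)"
    and "\<phi> (U0 E W B (Um t)) *\<^sub>R S_vec (L_matrix E W (Um t)) B = transpose (R t) *v h (R t ** transpose B)"
proof -
  have L: "L_matrix E W (Um t) = K ** R t"
    by (simp add: L_matrix_def Um[OF t] matrix_transpose_mul KE matrix_mul_assoc)
  show 1: "S_vec (L_matrix E W (Um t)) B = transpose (R t) *v s (R t ** transpose B)"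
    unfolding L by (rule S_vec_eq[OF R_rot[OF t]])
  have "U0 E W B (Um t) = U (R t ** transpose B)"
    unfolding Um[OF t] by (rule U0_eq[OF KE R_rot[OF t] B])
  then show "\<phi> (U0 E W B (Um t)) *\<^sub>R S_vec (L_matrix E W (Um t)) B = transpose (R t) *v h (R t ** transpose B)"
    using U_nonneg[OF rotation_matrix_mult[OF R_rot[OF t] rotation_matrix_transpose[OF B]]]
    by (simp add: 1 h_def matrix_vector_mult.scaleR_right)
qed

text \<open>The difference of the body rates, \<open>\<Omega> t - Oh = w t - b\<close>, drives
  \<open>Q\<close>; moving it through \<open>R t\<close> turns it into a left factor. By
  \<open>measured_terms\<close> the correction terms depend on \<open>Rh\<close> through
  \<open>Q\<close> alone.\<close>

lemma estimator_fsol: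
  assumes est: "estimator_solution E W \<phi> m D P Um \<Omega>m Rh w bh"
  defines "z \<equiv> \<lambda>t. (R t ** transpose (Rh t), w t, \<beta> - bh t)"
  shows "fsol z" "z 0 \<in> X"
proof -
  have rot: "rotation_matrix (Rh t)" if "0 \<le> t" for t
    using est that by (simp add: estimator_solution_def Let_def)
  show "z 0 \<in> X"
    using rotation_matrix_mult[OF R_rot[of 0] rotation_matrix_transpose[OF rot[of 0]]] by (simp add: z_def)
  show "fsol z" unfolding sol_def
  proof
    fix t :: real assume "t \<in> {0..}"
    then have t: "0 \<le> t" by simp
    define Oh b Q where "Oh = \<Omega>m t - w t - bh t" and "b = \<beta> - bh t" and "Q = R t ** transpose (Rh t)"
    have Oh: "Oh = \<Omega> t + b - w t" by (simp add: Oh_def b_def \<Omega>m[OF t])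
    note mt = measured_terms[OF t rot[OF t]]
    have dR: "(Rh has_vector_derivative Rh t ** skew Oh) (at t within {0..})"
      and db: "(bh has_vector_derivative \<phi> (U0 E W (Rh t) (Um t)) *\<^sub>R (matrix_inv P *v S_vec (L_matrix E W (Um t)) (Rh t))) (at t within {0..})"
      using est t by (simp_all add: estimator_solution_def Let_def Oh_def)
    obtain w' where w': "(w has_vector_derivative w') (at t within {0..})"
      and mw: "m *\<^sub>R w' = - (m *\<^sub>R cross3 Oh (w t)) + \<phi> (U0 E W (Rh t) (Um t)) *\<^sub>R S_vec (L_matrix E W (Um t)) (Rh t) - D *v w t"
      using est t unfolding estimator_solution_def Let_def Oh_def by blast
    have dQ: "((\<lambda>t. R t ** transpose (Rh t)) has_vector_derivative skew (R t *v (w t - b)) ** Q) (at t within {0..})"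
    proof -
      have "((\<lambda>t. R t ** transpose (Rh t)) has_vector_derivative
          R t ** transpose (Rh t ** skew Oh) + (R t ** skew (\<Omega> t)) ** transpose (Rh t)) (at t within {0..})"
        by (intro matrix_mult.has_vector_derivative R_kin t transpose_has_vector_derivative dR)
      also have "R t ** transpose (Rh t ** skew Oh) + (R t ** skew (\<Omega> t)) ** transpose (Rh t) = (R t ** skew (\<Omega> t - Oh)) ** transpose (Rh t)"
        by (simp add: matrix_transpose_mul transpose_skew skew_diff matrix_mult.diff_left matrix_mult.diff_right
            matrix_mult.minus_left matrix_mult.minus_right matrix_mul_assoc)
      also have "\<Omega> t - Oh = w t - b" by (simp add: Oh)
      also have "R t ** skew (w t - b) = skew (R t *v (w t - b)) ** R t"
        by (rule rotation_skew_commute[OF R_rot[OF t], symmetric])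
      finally show ?thesis by (simp add: Q_def matrix_mul_assoc)
    qed
    have "w' = (1 / m) *\<^sub>R (m *\<^sub>R w')" using m by simp
    also have "\<dots> = - cross3 (\<Omega> t + b) (w t) + (1 / m) *\<^sub>R (transpose (R t) *v h Q - D *v w t)"
      unfolding mw mt(2) Oh Q_def[symmetric] using m
      by (simp add: cross3.diff_left scaleR_diff_right scaleR_add_right)
    finally have w'e: "w' = - cross3 (\<Omega> t + b) (w t) + (1 / m) *\<^sub>R (transpose (R t) *v h Q - D *v w t)" .
    have dbb: "((\<lambda>t. \<beta> - bh t) has_vector_derivative - (matrix_inv P *v (transpose (R t) *v h Q))) (at t within {0..})"
    proof -
      have "((\<lambda>t. \<beta> - bh t) has_vector_derivative 0 - \<phi> (U0 E W (Rh t) (Um t)) *\<^sub>R (matrix_inv P *v S_vec (L_matrix E W (Um t)) (Rh t))) (at t within {0..})"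
        by (intro has_vector_derivative_diff has_vector_derivative_const db)
      also have "\<phi> (U0 E W (Rh t) (Um t)) *\<^sub>R (matrix_inv P *v S_vec (L_matrix E W (Um t)) (Rh t))
          = matrix_inv P *v (transpose (R t) *v h Q)"
        unfolding Q_def mt(2)[symmetric] by (simp add: matrix_vector_mult.scaleR_right)
      finally show ?thesis by simp
    qed
    have "(z has_vector_derivative (skew (R t *v (w t - b)) ** Q, w', - (matrix_inv P *v (transpose (R t) *v h Q)))) (at t within {0..})"
      unfolding z_def by (intro has_vector_derivative_Pair dQ w' dbb)
    then show "(z has_vector_derivative 1 *\<^sub>R f t (z t)) (at t within {0..})"
      by (simp add: f_def z_def w'e Q_def b_def)
  qed
qed

text \<open>The inverse change of variables is \<open>Rh = transpose Q ** R\<close>. It undoes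
  \<open>Q = R ** transpose Rh\<close> at nonnegative times, where \<open>R\<close> is known to be a
  rotation.\<close>

lemma fsol_estimator:
  assumes z: "fsol z" "z 0 \<in> X"
  defines "Rh \<equiv> \<lambda>t. transpose (fst (z t)) ** R t"
  shows "estimator_solution E W \<phi> m D P Um \<Omega>m Rh (\<lambda>t. fst (snd (z t))) (\<lambda>t. \<beta> - snd (snd (z t)))"
    and "0 \<le> t \<Longrightarrow> (R t ** transpose (Rh t), fst (snd (z t)), \<beta> - (\<beta> - snd (snd (z t)))) = z t"
proof -
  have RR: "R t ** transpose (Rh t) = fst (z t)" if t: "0 \<le> t" for t
  proof -
    have "R t ** transpose (R t) = mat 1" using R_rot[OF t] by (simp add: rotation_matrix_def orthogonal_matrix_def)
    then show ?thesis by (simp add: Rh_def matrix_transpose_mul matrix_mul_assoc)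
  qed
  then show "0 \<le> t \<Longrightarrow> (R t ** transpose (Rh t), fst (snd (z t)), \<beta> - (\<beta> - snd (snd (z t)))) = z t" by simp
  show "estimator_solution E W \<phi> m D P Um \<Omega>m Rh (\<lambda>t. fst (snd (z t))) (\<lambda>t. \<beta> - snd (snd (z t)))"
    unfolding estimator_solution_def Let_def
  proof (intro allI impI)
    fix t :: real assume t: "0 \<le> t"
    then have tS: "t \<in> {0..}" by simp
    define Q w b where "Q = fst (z t)" and "w = fst (snd (z t))" and "b = snd (snd (z t))"
    have Q: "rotation_matrix Q" using fsol_in_X[OF z t] by (auto simp: Q_def)
    have rot: "rotation_matrix (Rh t)"
      using rotation_matrix_mult[OF rotation_matrix_transpose[OF Q] R_rot[OF t]] by (simp add: Rh_def Q_def)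
    note sc = sol_components[OF z(1) tS]
    note mt = measured_terms[OF t rot, unfolded RR[OF t], folded Q_def]
    have Oh: "\<Omega>m t - fst (snd (z t)) - (\<beta> - snd (snd (z t))) = \<Omega> t - (w - b)" by (simp add: \<Omega>m[OF t] w_def b_def)
    have dR: "(Rh has_vector_derivative Rh t ** skew (\<Omega> t - (w - b))) (at t within {0..})"
    proof -
      have dQ: "((\<lambda>t. fst (z t)) has_vector_derivative skew (R t *v (w - b)) ** Q) (at t within {0..})"
        using sc(1) by (simp add: f_fst w_def b_def Q_def)
      have "(Rh has_vector_derivative transpose (fst (z t)) ** (R t ** skew (\<Omega> t)) + transpose (skew (R t *v (w - b)) ** Q) ** R t) (at t within {0..})"
        unfolding Rh_def
        by (intro matrix_mult.has_vector_derivative R_kin t transpose_has_vector_derivative dQ)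
      also have "transpose (skew (R t *v (w - b)) ** Q) ** R t = - (transpose Q ** (skew (R t *v (w - b)) ** R t))"
        by (simp add: matrix_transpose_mul transpose_skew matrix_mult.minus_left matrix_mult.minus_right matrix_mul_assoc)
      also have "transpose (fst (z t)) ** (R t ** skew (\<Omega> t)) + - (transpose Q ** (skew (R t *v (w - b)) ** R t)) = Rh t ** skew (\<Omega> t - (w - b))"
        unfolding rotation_skew_commute[OF R_rot[OF t]]
        by (simp add: Rh_def Q_def skew_diff matrix_mult.diff_right matrix_mul_assoc)
      finally show ?thesis .
    qed
    have dw: "((\<lambda>t. fst (snd (z t))) has_vector_derivative - cross3 (\<Omega> t + b) w + (1 / m) *\<^sub>R (transpose (R t) *v h Q - D *v w)) (at t within {0..})"
      using sc(2) by (simp add: f_snd w_def b_def Q_def)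
    have mw: "m *\<^sub>R (- cross3 (\<Omega> t + b) w + (1 / m) *\<^sub>R (transpose (R t) *v h Q - D *v w))
        = - (m *\<^sub>R cross3 (\<Omega> t - (w - b)) w) + transpose (R t) *v h Q - D *v w"
      using m by (simp add: cross3.diff_left cross3.add_left algebra_simps)
    have "((\<lambda>t. \<beta> - snd (snd (z t))) has_vector_derivative 0 - (- (matrix_inv P *v (transpose (R t) *v h Q)))) (at t within {0..})"
      using sc(3) by (intro has_vector_derivative_diff has_vector_derivative_const) (simp add: f_thd Q_def)
    then have db: "((\<lambda>t. \<beta> - snd (snd (z t))) has_vector_derivative matrix_inv P *v (transpose (R t) *v h Q)) (at t within {0..})"
      by simp
    show "rotation_matrix (Rh t) \<and>
       (Rh has_vector_derivative Rh t ** skew (\<Omega>m t - fst (snd (z t)) - (\<beta> - snd (snd (z t))))) (at t within {0..}) \<and>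
       (\<exists>\<omega>'. ((\<lambda>t. fst (snd (z t))) has_vector_derivative \<omega>') (at t within {0..}) \<and>
             m *\<^sub>R \<omega>' = - (m *\<^sub>R cross3 (\<Omega>m t - fst (snd (z t)) - (\<beta> - snd (snd (z t)))) (fst (snd (z t))))
               + \<phi> (U0 E W (Rh t) (Um t)) *\<^sub>R S_vec (L_matrix E W (Um t)) (Rh t) - D *v fst (snd (z t))) \<and>
       ((\<lambda>t. \<beta> - snd (snd (z t))) has_vector_derivative
          \<phi> (U0 E W (Rh t) (Um t)) *\<^sub>R (matrix_inv P *v S_vec (L_matrix E W (Um t)) (Rh t))) (at t within {0..})"
    proof (intro conjI exI)
      show "((\<lambda>t. fst (snd (z t))) has_vector_derivative - cross3 (\<Omega> t + b) w + (1 / m) *\<^sub>R (transpose (R t) *v h Q - D *v w)) (at t within {0..})"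
        by (rule dw)
      show "m *\<^sub>R (- cross3 (\<Omega> t + b) w + (1 / m) *\<^sub>R (transpose (R t) *v h Q - D *v w))
          = - (m *\<^sub>R cross3 (\<Omega>m t - fst (snd (z t)) - (\<beta> - snd (snd (z t)))) (fst (snd (z t))))
               + \<phi> (U0 E W (Rh t) (Um t)) *\<^sub>R S_vec (L_matrix E W (Um t)) (Rh t) - D *v fst (snd (z t))"
        unfolding Oh mt(2) unfolding w_def[symmetric] by (rule mw)
      show "((\<lambda>t. \<beta> - snd (snd (z t))) has_vector_derivative
          \<phi> (U0 E W (Rh t) (Um t)) *\<^sub>R (matrix_inv P *v S_vec (L_matrix E W (Um t)) (Rh t))) (at t within {0..})"
        unfolding matrix_vector_mult.scaleR_right[symmetric] mt(2) by (rule db)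
    qed (use rot dR in \<open>simp_all add: Oh\<close>)
  qed
qed

abbreviation "trajs \<equiv> error_trajectories E W \<phi> m D P Um \<Omega>m R \<beta>"

lemma trajs_fsol: "z \<in> trajs \<Longrightarrow> fsol z \<and> z 0 \<in> X"
  using estimator_fsol unfolding error_trajectories_def by blast

text \<open>Nothing is known about \<open>R\<close> at negative times, so the recovered curve is
  matched with \<open>z\<close> from 0 on; initial values and limits see no more.\<close>

lemma fsol_trajs:
  assumes z: "fsol z" "z 0 \<in> X"
  shows "\<exists>z'\<in>trajs. \<forall>t\<ge>0. z' t = z t"
proof -
  let ?z' = "\<lambda>t. (R t ** transpose (transpose (fst (z t)) ** R t), fst (snd (z t)), \<beta> - (\<beta> - snd (snd (z t))))"
  have 1: "?z' \<in> trajs"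
    unfolding error_trajectories_def mem_Collect_eq
    by (rule exI[of _ "\<lambda>t. transpose (fst (z t)) ** R t"], rule exI[of _ "\<lambda>t. fst (snd (z t))"],
        rule exI[of _ "\<lambda>t. \<beta> - snd (snd (z t))"]) (rule conjI[OF refl fsol_estimator(1)[OF z]])
  show ?thesis
    by (rule bexI[where x = ?z']) (use fsol_estimator(2)[OF z] 1 in blast)+
qed

lemma TSO3_R3_eq: "TSO3_R3 = X"
  by (auto simp: TSO3_R3_def)

text \<open>\<open>domain_of_attraction\<close> asks all trajectories from a point to converge,
  \<open>basin\<close> asks for one that does. Uniqueness makes these equivalent, and
  \<open>fsol_trajs\<close> provides the required trajectory.\<close>

lemma domain_eq_basin: "domain_of_attraction TSO3_R3 trajs e0 = basin"
proof (intro set_eqI iffI)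
  fix x assume "x \<in> domain_of_attraction TSO3_R3 trajs e0"
  then obtain z where z: "x \<in> X" "z \<in> trajs" "z 0 = x" "(z \<longlongrightarrow> e0) at_top"
    by (auto simp: domain_of_attraction_def TSO3_R3_eq)
  then show "x \<in> basin" using trajs_fsol[OF z(2)] by (auto simp: basin_def)
next
  fix x assume "x \<in> basin"
  then obtain y where y: "x \<in> X" "fsol y" "y 0 = x" "(y \<longlongrightarrow> e0) at_top" by (auto simp: basin_def)
  have yX: "y 0 \<in> X" using y by simp
  obtain z where z: "z \<in> trajs" "\<forall>t\<ge>0. z t = y t" using fsol_trajs[OF y(2) yX] by blast
  have "(z' \<longlongrightarrow> e0) at_top" if z': "z' \<in> trajs" "z' 0 = x" for z'
  proof (rule Lim_transform_eventually[OF y(4)])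
    have "y t = z' t" if "0 \<le> t" for t
      by (rule fsol_unique[OF y(2) conjunct1[OF trajs_fsol[OF z'(1)]] _ that]) (simp add: y(3) z'(2))
    then show "\<forall>\<^sub>F t in at_top. y t = z' t" unfolding eventually_at_top_linorder by blast
  qed
  then show "x \<in> domain_of_attraction TSO3_R3 trajs e0"
    using z y(1,3) unfolding domain_of_attraction_def TSO3_R3_eq by force
qed

lemma trajs_asymptotically_stable: "asymptotically_stable TSO3_R3 trajs e0"
  unfolding asymptotically_stable_def domain_eq_basin
proof (intro conjI allI impI)
  fix e :: real assume e: "e > 0"
  obtain \<delta> where \<delta>: "\<delta> > 0" "\<And>z t. \<lbrakk>fsol z; z 0 \<in> X; dist (z 0) e0 < \<delta>; 0 \<le> t\<rbrakk> \<Longrightarrow> dist (z t) e0 < e"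
    using fsol_stable[OF e] by blast
  then show "\<exists>\<delta>>0. \<forall>z\<in>trajs. dist (z 0) e0 < \<delta> \<longrightarrow> (\<forall>t\<ge>0. dist (z t) e0 < e)"
    using trajs_fsol by (intro exI[of _ \<delta>]) blast
qed (use basin_nbhd in \<open>simp add: TSO3_R3_eq\<close>)

end

end

theorem theorem6p3:
  fixes E :: "real^'n^3" and W W0 VE :: "real^'n^'n" and UE :: "real^3^3" and SE :: "real^'n^3"
    and \<iota> :: "3 \<Rightarrow> 'n" and \<sigma> d :: "3 \<Rightarrow> real"
    and Phi dPhi ddPhi :: "real \<Rightarrow> real"
    and m :: real and D P :: "real^3^3"
    and R :: "real \<Rightarrow> real^3^3" and Omega Omega_m :: "real \<Rightarrow> real^3"
    and Um :: "real \<Rightarrow> real^'n^3" and \<beta> :: "real^3"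
  assumes rank_E: "rank E = 3"
    and svd: "is_svd E UE SE VE \<iota> \<sigma>"
    and W0_diag: "\<And>i j. i \<noteq> j \<Longrightarrow> W0 $ i $ j = 0"
    and W0_pos: "\<And>j. W0 $ j $ j > 0"
    and W0_first: "\<And>i. W0 $ \<iota> i $ \<iota> i = d i / (\<sigma> i)\<^sup>2"
    and d_pos: "\<And>i. d i > 0"
    and d_distinct: "inj d"
    and W: "W = VE ** W0 ** transpose VE"
    and m_pos: "m > 0"
    and D: "posdef D"
    and P: "posdef P"
    and Phi_nonneg: "\<And>x. x \<ge> 0 \<Longrightarrow> Phi x \<ge> 0"
    and Phi_0: "Phi 0 = 0"
    and Phi_deriv: "\<And>x. x \<ge> 0 \<Longrightarrow> (Phi has_real_derivative dPhi x) (at x within {0..})"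
    and dPhi_deriv: "\<And>x. x \<ge> 0 \<Longrightarrow> (dPhi has_real_derivative ddPhi x) (at x within {0..})"
    and ddPhi_cont: "continuous_on {0..} ddPhi"
    \<comment> \<open>Positivity of the derivative at 0 and a class-K upper bound exclude each other
        (such a bound vanishes at 0), so both alternatives are admitted.\<close>
    and dPhi: "(\<forall>x\<ge>0. dPhi x > 0) \<or>
               ((\<forall>x>0. dPhi x > 0) \<and> (\<exists>\<alpha>. class_K \<alpha> \<and> (\<forall>x\<ge>0. dPhi x \<le> \<alpha> x)))"
    and R_rot: "\<And>t. t \<ge> 0 \<Longrightarrow> rotation_matrix (R t)"
    and R_kin: "\<And>t. t \<ge> 0 \<Longrightarrow> (R has_vector_derivative R t ** skew (Omega t)) (at t within {0..})"
    and Omega_cont: "continuous_on {0..} Omega"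
    and Omega_bounded: "bounded (Omega ` {0..})"
    and Um: "\<And>t. t \<ge> 0 \<Longrightarrow> Um t = transpose (R t) ** E"
    and Omega_m: "\<And>t. t \<ge> 0 \<Longrightarrow> Omega_m t = Omega t + \<beta>"
  shows "let T = error_trajectories E W dPhi m D P Um Omega_m R \<beta>;
             A = domain_of_attraction TSO3_R3 T (mat 1, 0, 0)
         in asymptotically_stable TSO3_R3 T (mat 1, 0, 0) \<and>
            openin (top_of_set TSO3_R3) A \<and> TSO3_R3 \<subseteq> closure A"
proof -
  have K: "E ** W ** transpose E = UE ** diagm d ** transpose UE"
    unfolding W by (rule svd_gram[OF svd W0_diag W0_pos W0_first])
  interpret attitude_error UE "E ** W ** transpose E" d dPhi Phi m D P R Omega
  proof
    show "orthogonal_matrix UE" using svd by (simp add: is_svd_def)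
    show "\<exists>L. \<forall>x\<in>{0..M}. \<forall>y\<in>{0..M}. \<bar>dPhi x - dPhi y\<bar> \<le> L * \<bar>x - y\<bar>" for M
      by (rule lipschitz_of_continuous_deriv[OF dPhi_deriv ddPhi_cont])
    show "dPhi x > 0" if "x > 0" for x using dPhi that by auto
  qed (fact K d_pos d_distinct Phi_0 Phi_deriv m_pos D P R_rot R_kin Omega_cont Omega_bounded)+
  have A: "domain_of_attraction TSO3_R3 (error_trajectories E W dPhi m D P Um Omega_m R \<beta>) (mat 1, 0, 0) = basin"
    by (rule domain_eq_basin[OF refl]) (fact Um Omega_m)+
  have stable: "asymptotically_stable TSO3_R3 (error_trajectories E W dPhi m D P Um Omega_m R \<beta>) (mat 1, 0, 0)"
    by (rule trajs_asymptotically_stable[OF refl]) (fact Um Omega_m)+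
  show ?thesis
    unfolding Let_def A using stable openin_basin basin_dense by (simp add: TSO3_R3_def)
qed

end
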